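(* Let $(W,S)$ be a finite Coxeter system, $c$ a Coxeter element, and $\mathrm{c}$ a reduced expression for $c$. Let $I$ be a facet of the subword complex $\mathcal{SC}_{\mathrm{c}}$, let $\mathcal{O}$ be the $\mathsf{shift}_{\mathrm{c}}$-orbit of $I$, and let $\mathcal{O}'$ be the $\mathsf{shift}_{\mathrm{c}}$-orbit of the facet $(\psi_2^{-1}\circ\psi_1)(I)$ of $\mathcal{SC}_{\mathrm{c}}$. Then $$\sum_{J}\big(\mathsf{B}_{\mathrm{c}}(J)-\Omega_c\big)=0,$$ where the sum ranges over $J\in\mathcal{O}$ if the two orbits $\mathcal{O}$ and $\mathcal{O}'$ are equal, and over the disjoint union $J\in\mathcal{O}\sqcup\mathcal{O}'$ if they are different.
   Context: The finite Coxeter system $(W,S)$ acts as a (essential) finite reflection group on a real Euclidean space $V$ of dimension $n=|S|$. $\{\alpha_s : s\in S\}$ denotes the simple roots of the root system $\Phi=\{w(\alpha_s): w\in W,s\in S\}$ (with $\Phi\cap\mathbb{R}\alpha=\{\pm\alpha\}$ for $\alpha\in\Phi$). The fundamental weights $\omega_s$ are defined by $s(\omega_t)=\omega_t-\delta_{s=t}\,\alpha_s$ for all $s,t\in S$. $w_\circ$ is the longest element of $W$, and $\varphi:S\to S$ is $\varphi(s)=w_\circ s w_\circ$. Subword complex: for a word $\mathrm{Q}=q_1\cdots q_m$ on $S$ containing a reduced expression for $w_\circ$ as a subword, $\mathcal{SC}(\mathrm{Q})$ is the simplicial complex on $[m]=\{1,\dots,m\}$ whose faces are the sets of positions $I$ such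 that the word at the complementary positions contains a reduced expression for $w_\circ$. Its facets are the complements of sets of positions forming a reduced expression for $w_\circ$. For $X\subseteq[m]$, $\Pi\mathrm{Q}_X$ is the product of the reflections $q_x$, $x\in X$, in increasing order of $x$. For a facet $I$ and $k\in[m]$ the weight is $\mathsf{w}_{\mathrm{Q}}(I,k)=\Pi\mathrm{Q}_{[k-1]\smallsetminus I}(\omega_{q_k})$, and the brick vector is $\mathsf{B}_{\mathrm{Q}}(I)=\sum_{k\in[m]}\mathsf{w}_{\mathrm{Q}}(I,k)$. A Coxeter element is a product of all elements of $S$, each exactly once, in some order. For a reduced expression $\mathrm{c}=c_1\cdots c_n$ of a Coxeter element $c$, let $\mathrm{w}_\circ(\mathrm{c})=\mathrm{w}_1\cdots\mathrm{w}_N$ be the $\mathrm{c}$-sorting word of $w_\circ$, i.e. the lexicographically first (as a sequence of positions) subword of $\mathrm{c}^\infty=\mathrm{c}\mathrm{c}\mathrm{c}\cdots$ that is a reduced expression for $w_\circ$. Put $\mathcal{SC}_{\mathrm{c}}=\mathcal{SC}(\mathrm{c}\,\mathrm{w}_\circ(\mathrm{c}))$, $\mathsf{B}_{\mathrm{c}}(I)=\mathsf{B}_{\mathrm{c}\mathrm{w}_\circ(\mathrm{c})}(I)$ and $\Omega_c=\sum_{k\in[N]}w_1\cdots w_{k-1}(\omega_{w_k})$. Here $m=n+N$. Commutations: if two words differ by a sequence of transpositions of consecutive (distinct) commuting letters, the bijection of positions tracking the letters (which preserves the relative order of equal letters) induces an isomorphism of their subword complexes. Rotations: the rotation of $\mathrm{Q}=q_1\cdots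 q_m$ is the word $q_2\cdots q_m\varphi(q_1)$; the map $i\mapsto i-1$ on positions (with $0$ identified with $m$) induces an isomorphism of the subword complexes of $\mathrm{Q}$ and of its rotation. For $\mathrm{c}=c_1\cdots c_n$ and $\mathrm{c}'=c_2\cdots c_nc_1$, the rotation of $\mathrm{c}\,\mathrm{w}_\circ(\mathrm{c})$ coincides with $\mathrm{c}'\,\mathrm{w}_\circ(\mathrm{c}')$ up to commutations (known fact). Composing the rotation map with the commutation bijection gives an isomorphism $\mathcal{SC}_{\mathrm{c}}\to\mathcal{SC}_{\mathrm{c}'}$, called the isomorphism induced by rotating the first letter. If two reduced expressions of the same Coxeter element differ by commutations, the corresponding words $\mathrm{c}\,\mathrm{w}_\circ(\mathrm{c})$ also do, and their subword complexes are identified through the commutation bijection. $\mathsf{shift}_{\mathrm{c}}$ is the bijection on the facets of $\mathcal{SC}_{\mathrm{c}}$ obtained by successively rotating all letters $c_1,\dots,c_n$ of $\mathrm{c}$, i.e. the composition of the $n$ isomorphisms induced by rotating the first letter, $\mathcal{SC}_{c_1\cdots c_n}\to\mathcal{SC}_{c_2\cdots c_nc_1}\to\cdots\to\mathcal{SC}_{c_1\cdots c_n}$. Let $\mathrm{c}^{-1}=c_n\cdots c_1$ be the reversed word, a reduced expression for $c^{-1}$. $\psi_1:\mathcal{SC}_{\mathrm{c}}\to\mathcal{SC}_{\mathrm{c}^{-1}}$ is an isomorphism obtained by composing isomorphisms induced by rotating first letters and commutation identifications, along a sequence of rotations of initial letters (and commutations) leading from $\mathrm{c}$ to $\mathrm{c}^{-1}$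 (such a sequence exists since all Coxeter elements are related by repeated rotations of initial letters). $\psi_2:\mathcal{SC}_{\mathrm{c}}\to\mathcal{SC}_{\mathrm{c}^{-1}}$ is the isomorphism obtained by reversal and $w_\circ$-conjugation: if $\mathrm{c}\,\mathrm{w}_\circ(\mathrm{c})=q_1\cdots q_m$, then the word $\varphi(q_m)\cdots\varphi(q_1)$ coincides up to commutations with $\mathrm{c}^{-1}\,\mathrm{w}_\circ(\mathrm{c}^{-1})$ (known fact), and $\psi_2$ is induced by the position map $i\mapsto m-i+1$ followed by the commutation bijection. *)

theory Defs
  imports
    "HOL-Algebra.Algebra"
    "HOL-Analysis.Analysis"
begin

section \<open>Coxeter systems\<close>

text \<open>Words are lists of elements of S, evaluated in the group W by \<open>word_prod\<close>.\<close>

definition word_prod :: "('w, 'x) monoid_scheme \<Rightarrow> 'w list \<Rightarrow> 'w" where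
  "word_prod W Q = foldr (\<lambda>x y. x \<otimes>\<^bsub>W\<^esub> y) Q \<one>\<^bsub>W\<^esub>"

text \<open>Equality of words in the group presented by the generators S and the relations
  (st)^m(s,t) = 1, where m(s,t) is the order of st in W. An element of infinite order has
  \<open>group.ord\<close> equal to 0, so that its relation is void, as it should be. The case s = t gives
  the relation ss = 1, so the monoid congruence below is the group presentation.\<close>

inductive coxeter_equiv ::
    "('w, 'x) monoid_scheme \<Rightarrow> 'w set \<Rightarrow> 'w list \<Rightarrow> 'w list \<Rightarrow> bool"
  for W S where
  refl: "coxeter_equiv W S P P"
| sym: "coxeter_equiv W S P Q \<Longrightarrow> coxeter_equiv W S Q P"
| trans: "coxeter_equiv W S P Q \<Longrightarrow> coxeter_equiv W S Q R \<Longrightarrow> coxeter_equiv W S P R"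
| relation: "s \<in> S \<Longrightarrow> t \<in> S \<Longrightarrow>
    coxeter_equiv W S (P @ concat (replicate (group.ord W (s \<otimes>\<^bsub>W\<^esub> t)) [s, t]) @ Q) (P @ Q)"

definition coxeter_system :: "('w, 'x) monoid_scheme \<Rightarrow> 'w set \<Rightarrow> bool" where
  "coxeter_system W S \<longleftrightarrow>
     group W \<and> S \<subseteq> carrier W \<and> generate W S = carrier W \<and>
     (\<forall>s\<in>S. s \<noteq> \<one>\<^bsub>W\<^esub> \<and> s \<otimes>\<^bsub>W\<^esub> s = \<one>\<^bsub>W\<^esub>) \<and>
     (\<forall>Q\<in>lists S. word_prod W Q = \<one>\<^bsub>W\<^esub> \<longrightarrow> coxeter_equiv W S Q [])"

definition coxeter_length :: "('w, 'x) monoid_scheme \<Rightarrow> 'w set \<Rightarrow> 'w \<Rightarrow> nat" where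
  "coxeter_length W S w = (LEAST k. \<exists>Q\<in>lists S. word_prod W Q = w \<and> length Q = k)"

definition reduced_expression ::
    "('w, 'x) monoid_scheme \<Rightarrow> 'w set \<Rightarrow> 'w list \<Rightarrow> 'w \<Rightarrow> bool" where
  "reduced_expression W S Q w \<longleftrightarrow>
     Q \<in> lists S \<and> word_prod W Q = w \<and> length Q = coxeter_length W S w"

definition longest_element :: "('w, 'x) monoid_scheme \<Rightarrow> 'w set \<Rightarrow> 'w" where
  "longest_element W S =
     (THE w. w \<in> carrier W \<and> (\<forall>u\<in>carrier W. coxeter_length W S u \<le> coxeter_length W S w))"

definition conj_longest :: "('w, 'x) monoid_scheme \<Rightarrow> 'w set \<Rightarrow> 'w \<Rightarrow> 'w" where
  "conj_longest W S s = longest_element W S \<otimes>\<^bsub>W\<^esub> s \<otimes>\<^bsub>W\<^esub> longest_element W S"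

definition coxeter_element :: "('w, 'x) monoid_scheme \<Rightarrow> 'w set \<Rightarrow> 'w \<Rightarrow> bool" where
  "coxeter_element W S c \<longleftrightarrow> (\<exists>Q. distinct Q \<and> set Q = S \<and> word_prod W Q = c)"

section \<open>The geometric side\<close>

definition reflection :: "'v::real_inner \<Rightarrow> 'v \<Rightarrow> 'v" where
  "reflection a v = v - (2 * (v \<bullet> a) / (a \<bullet> a)) *\<^sub>R a"

definition root_system :: "('w, 'x) monoid_scheme \<Rightarrow> 'w set \<Rightarrow> ('w \<Rightarrow> 'v \<Rightarrow> 'v) \<Rightarrow> ('w \<Rightarrow> 'v) \<Rightarrow> 'v set" where
  "root_system W S \<rho> \<alpha> = {\<rho> w (\<alpha> s) |w s. w \<in> carrier W \<and> s \<in> S}"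

text \<open>The group W acts faithfully on V through \<open>\<rho>\<close>, each s in S acting as the orthogonal reflection
  in the hyperplane orthogonal to \<open>\<alpha> s\<close>. The simple roots form a basis of V, so V is Euclidean
  of dimension n = |S| and the action is essential; working over \<open>real_inner\<close> instead of
  \<open>euclidean_space\<close> retains the case n = 0. The last two conditions say that
  the \<open>\<alpha> s\<close> are the simple roots of a reduced root system.\<close>

definition reflection_representation ::
    "('w, 'x) monoid_scheme \<Rightarrow> 'w set \<Rightarrow> ('w \<Rightarrow> 'v \<Rightarrow> 'v::real_inner) \<Rightarrow> ('w \<Rightarrow> 'v) \<Rightarrow> bool" where
  "reflection_representation W S \<rho> \<alpha> \<longleftrightarrow>
     faithful_action W UNIV \<rho> \<and>
     (\<forall>s\<in>S. \<rho> s = reflection (\<alpha> s)) \<and>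
     inj_on \<alpha> S \<and> independent (\<alpha> ` S) \<and> span (\<alpha> ` S) = UNIV \<and>
     (\<forall>\<beta>\<in>root_system W S \<rho> \<alpha>. root_system W S \<rho> \<alpha> \<inter> span {\<beta>} = {\<beta>, - \<beta>}) \<and>
     (\<forall>\<beta>\<in>root_system W S \<rho> \<alpha>. \<exists>f. (\<forall>s\<in>S. 0 \<le> f s) \<and>
        (\<beta> = (\<Sum>s\<in>S. f s *\<^sub>R \<alpha> s) \<or> \<beta> = - (\<Sum>s\<in>S. f s *\<^sub>R \<alpha> s)))"

definition fundamental_weight ::
    "'w set \<Rightarrow> ('w \<Rightarrow> 'v \<Rightarrow> 'v::real_inner) \<Rightarrow> ('w \<Rightarrow> 'v) \<Rightarrow> 'w \<Rightarrow> 'v" where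
  "fundamental_weight S \<rho> \<alpha> t =
     (THE v. \<forall>s\<in>S. \<rho> s v = v - (if s = t then \<alpha> s else 0))"

section \<open>Subword complexes and brick vectors\<close>

text \<open>Positions are numbered from 0: the letters of Q are \<open>Q ! 0, \<dots>, Q ! (m - 1)\<close>, and
  \<open>nths Q X\<close> is the subword of Q at the positions in X.\<close>

definition subword_complex ::
    "('w, 'x) monoid_scheme \<Rightarrow> 'w set \<Rightarrow> 'w list \<Rightarrow> nat set set" where
  "subword_complex W S Q =
     {I. I \<subseteq> {..<length Q} \<and>
         (\<exists>J \<subseteq> {..<length Q} - I. reduced_expression W S (nths Q J) (longest_element W S))}"

definition facets :: "nat set set \<Rightarrow> nat set set" where
  "facets K = {I \<in> K. \<forall>J\<in>K. I \<subseteq> J \<longrightarrow> J = I}"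

definition weight ::
    "('w, 'x) monoid_scheme \<Rightarrow> 'w set \<Rightarrow> ('w \<Rightarrow> 'v \<Rightarrow> 'v::real_inner) \<Rightarrow> ('w \<Rightarrow> 'v) \<Rightarrow>
     'w list \<Rightarrow> nat set \<Rightarrow> nat \<Rightarrow> 'v" where
  "weight W S \<rho> \<alpha> Q I k =
     \<rho> (word_prod W (nths Q ({..<k} - I))) (fundamental_weight S \<rho> \<alpha> (Q ! k))"

definition brick_vector ::
    "('w, 'x) monoid_scheme \<Rightarrow> 'w set \<Rightarrow> ('w \<Rightarrow> 'v \<Rightarrow> 'v::real_inner) \<Rightarrow> ('w \<Rightarrow> 'v) \<Rightarrow>
     'w list \<Rightarrow> nat set \<Rightarrow> 'v" where
  "brick_vector W S \<rho> \<alpha> Q I = (\<Sum>k<length Q. weight W S \<rho> \<alpha> Q I k)"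

section \<open>Sorting words\<close>

text \<open>The letter of the infinite word ccc... at position i is \<open>c ! (i mod length c)\<close>.\<close>

definition subword_power :: "'w list \<Rightarrow> nat list \<Rightarrow> 'w list" where
  "subword_power c p = map (\<lambda>i. c ! (i mod length c)) p"

definition longest_positions ::
    "('w, 'x) monoid_scheme \<Rightarrow> 'w set \<Rightarrow> 'w list \<Rightarrow> nat list \<Rightarrow> bool" where
  "longest_positions W S c p \<longleftrightarrow>
     sorted_wrt (<) p \<and> reduced_expression W S (subword_power c p) (longest_element W S)"

definition sorting_word ::
    "('w, 'x) monoid_scheme \<Rightarrow> 'w set \<Rightarrow> 'w list \<Rightarrow> 'w list" where
  "sorting_word W S c = subword_power c
     (THE p. longest_positions W S c p \<and>
        (\<forall>p'. longest_positions W S c p' \<longrightarrow> p' = p \<or> (p, p') \<in> lexord less_than))"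

definition cw_word :: "('w, 'x) monoid_scheme \<Rightarrow> 'w set \<Rightarrow> 'w list \<Rightarrow> 'w list" where
  "cw_word W S c = c @ sorting_word W S c"

definition Omega ::
    "('w, 'x) monoid_scheme \<Rightarrow> 'w set \<Rightarrow> ('w \<Rightarrow> 'v \<Rightarrow> 'v::real_inner) \<Rightarrow> ('w \<Rightarrow> 'v) \<Rightarrow>
     'w list \<Rightarrow> 'v" where
  "Omega W S \<rho> \<alpha> c =
     (let w = sorting_word W S c
      in \<Sum>k<length w. \<rho> (word_prod W (take k w)) (fundamental_weight S \<rho> \<alpha> (w ! k)))"

section \<open>Commutations, rotations and the shift\<close>

text \<open>\<open>commutations W Q f R\<close>: the word R arises from Q by successive transpositions of consecutive
  distinct commuting letters, and f tracks the letters, i.e. the letter at position i of Q ends up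
  at position f i of R. As equal letters are never exchanged, f is determined by Q and R (it fixes
  the numbers that are not positions), which justifies the description in \<open>commutation_bij\<close>.\<close>

inductive commutations ::
    "('w, 'x) monoid_scheme \<Rightarrow> 'w list \<Rightarrow> (nat \<Rightarrow> nat) \<Rightarrow> 'w list \<Rightarrow> bool"
  for W Q where
  id: "commutations W Q id Q"
| step: "commutations W Q f (P @ a # b # R) \<Longrightarrow> a \<noteq> b \<Longrightarrow> a \<otimes>\<^bsub>W\<^esub> b = b \<otimes>\<^bsub>W\<^esub> a \<Longrightarrow>
    commutations W Q (Transposition.transpose (length P) (Suc (length P)) \<circ> f) (P @ b # a # R)"

definition commutation_bij ::
    "('w, 'x) monoid_scheme \<Rightarrow> 'w list \<Rightarrow> 'w list \<Rightarrow> nat \<Rightarrow> nat" where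
  "commutation_bij W Q R = (THE f. commutations W Q f R)"

fun rotation :: "('w, 'x) monoid_scheme \<Rightarrow> 'w set \<Rightarrow> 'w list \<Rightarrow> 'w list" where
  "rotation W S [] = []"
| "rotation W S (q # Q) = Q @ [conj_longest W S q]"

definition rotation_pos :: "nat \<Rightarrow> nat \<Rightarrow> nat" where
  "rotation_pos m i = (if i = 0 then m - 1 else i - 1)"

text \<open>Simplicial isomorphisms are represented by their action on sets of positions.
  \<open>rotate_first W S c\<close> is the isomorphism induced by rotating the first letter of c.\<close>

definition rotate_first ::
    "('w, 'x) monoid_scheme \<Rightarrow> 'w set \<Rightarrow> 'w list \<Rightarrow> nat set \<Rightarrow> nat set" where
  "rotate_first W S c I =
     commutation_bij W (rotation W S (cw_word W S c)) (cw_word W S (rotate1 c)) `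
       rotation_pos (length (cw_word W S c)) ` I"

definition commute_iso ::
    "('w, 'x) monoid_scheme \<Rightarrow> 'w set \<Rightarrow> 'w list \<Rightarrow> 'w list \<Rightarrow> nat set \<Rightarrow> nat set" where
  "commute_iso W S c c' I = commutation_bij W (cw_word W S c) (cw_word W S c') ` I"

primrec rotate_firsts ::
    "('w, 'x) monoid_scheme \<Rightarrow> 'w set \<Rightarrow> 'w list \<Rightarrow> nat \<Rightarrow> nat set \<Rightarrow> nat set" where
  "rotate_firsts W S c 0 = id"
| "rotate_firsts W S c (Suc k) = rotate_first W S (rotate k c) \<circ> rotate_firsts W S c k"

definition shift ::
    "('w, 'x) monoid_scheme \<Rightarrow> 'w set \<Rightarrow> 'w list \<Rightarrow> nat set \<Rightarrow> nat set" where
  "shift W S c = rotate_firsts W S c (length c)"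

text \<open>The shift permutes the finite set of facets, so its forward iterates give the full orbit.\<close>

definition shift_orbit ::
    "('w, 'x) monoid_scheme \<Rightarrow> 'w set \<Rightarrow> 'w list \<Rightarrow> nat set \<Rightarrow> nat set set" where
  "shift_orbit W S c I = {(shift W S c ^^ k) I |k. True}"

section \<open>The isomorphisms to the complex of the inverse Coxeter element\<close>

text \<open>\<open>rotation_path W S c F d\<close>: F is the composition of the isomorphisms along some sequence of
  rotations of initial letters and commutations leading from c to d. The isomorphisms
  \<open>\<psi>\<^sub>1\<close> are the F with \<open>rotation_path W S c F (rev c)\<close>.\<close>

inductive rotation_path ::
    "('w, 'x) monoid_scheme \<Rightarrow> 'w set \<Rightarrow> 'w list \<Rightarrow> (nat set \<Rightarrow> nat set) \<Rightarrow> 'w list \<Rightarrow> bool"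
  for W S c where
  id: "rotation_path W S c id c"
| rotate: "rotation_path W S c F d \<Longrightarrow>
    rotation_path W S c (rotate_first W S d \<circ> F) (rotate1 d)"
| commute: "rotation_path W S c F d \<Longrightarrow> commutations W d f e \<Longrightarrow>
    rotation_path W S c (commute_iso W S d e \<circ> F) e"

definition psi2 ::
    "('w, 'x) monoid_scheme \<Rightarrow> 'w set \<Rightarrow> 'w list \<Rightarrow> nat set \<Rightarrow> nat set" where
  "psi2 W S c I =
     (let Q = cw_word W S c
      in commutation_bij W (map (conj_longest W S) (rev Q)) (cw_word W S (rev c)) `
           (\<lambda>i. length Q - 1 - i) ` I)"

end

theory Submission
  imports Defs
begin

text \<open>
  Write \<open>D(I)\<close> for the brick vector of a facet \<open>I\<close> minus \<open>\<Omega>\<close>. Rotating the first letter \<open>c\<^sub>1\<close> changes \<open>D\<close> only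
  by a multiple of \<open>\<alpha> c\<^sub>1\<close>. Summing over a shift-invariant set of facets and rotating all letters of c, one
  returns to the same sum, so that a linear combination of the simple roots vanishes and each of the
  changes is zero: the sum of \<open>D\<close> over an orbit is invariant under every rotation of initial letters, hence
  under \<open>\<psi>\<^sub>1\<close>. The reversal \<open>\<psi>\<^sub>2\<close> changes the sign of \<open>D\<close>. Since \<open>\<psi>\<^sub>1\<close> commutes with the shift and \<open>\<psi>\<^sub>2\<close> conjugates
  the shift of c to the inverse of the shift of the reversed word, the sums over the two orbits are opposite.

  The behaviour of sorting words under rotation and reversal comes from the roots \<open>c\<^sup>k \<beta>\<^sub>s\<close>, where
  \<open>\<beta>\<^sub>s = (1 - c) \<omega>\<^sub>s\<close>. If \<open>h\<^sub>s\<close> is the least k for which \<open>c\<^sup>k \<beta>\<^sub>s\<close> is negative, then \<open>c\<^sup>k \<omega>\<^sub>s\<close> is the negative of a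
  fundamental weight for \<open>k = h\<^sub>s\<close>, and pairing such weights with the roots shows that \<open>h\<^sub>t \<le> h\<^sub>s \<le> h\<^sub>t + 1\<close> whenever
  the noncommuting letters s and t occur in this order in c. Hence the letters of \<open>ccc\<dots>\<close> in which each s is
  used \<open>h\<^sub>s\<close> times form a reduced word of the longest element, which is the sorting word.
\<close>

section \<open>Reflections and fundamental weights\<close>

text \<open>The maps \<open>rotate_first\<close>, \<open>commute_iso\<close> and \<open>psi2\<close>
  contain a bijection given by a definite description, which has a meaning only after the two words
  in question have been shown to differ by commutations. The known facts on rotated and reversed
  sorting words are therefore proved here, for commutation classes rather than words: a class is
  determined by its projections to pairs of noncommuting letters, for the words at hand these
  projections alternate, and so only the number of occurrences of each letter has to be followed.
  Position maps are never computed. The commutation bijection is the only one that preserves each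
  letter together with the index of its occurrence, so identities between composed maps are checked
  on such pairs. This is what makes \<open>\<psi>\<^sub>1\<close> commute with the shift, since the
  shifts of two words that differ by commutations rotate the letters in different orders. Finally,
  \<Omega> is treated as the brick vector of the sorting word with no letter marked, so that both
  parts of D obey the same formulas under rotation and reversal.\<close>

lemma rev_in_lists [simp]: "rev Q \<in> lists A \<longleftrightarrow> Q \<in> lists A"
  by (simp add: lists_eq_set)

lemma linear_reflection: "linear (reflection a)"
  by (rule linearI) (auto simp: reflection_def inner_add_left algebra_simps add_divide_distrib)

lemma reflection_inner: "reflection a x \<bullet> reflection a y = x \<bullet> y"
  by (cases "a = 0") (auto simp: reflection_def inner_diff_left inner_diff_right inner_commute field_simps)

lemma reflection_involution: "reflection a (reflection a x) = x"
  by (cases "a = 0") (auto simp: reflection_def inner_diff_left algebra_simps)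

lemma reflection_uminus: "reflection (- a) = reflection a"
  by (auto simp: reflection_def)

lemma reflection_self: "reflection a a = - a"
  by (cases "a = 0") (auto simp: reflection_def scaleR_2)

text \<open>A Gram-Schmidt step: u is the residue of the new vector b modulo the span of B, and
  correcting by a multiple of u achieves orthogonality to b without disturbing that to B. The
  fundamental weights are obtained from this projection.\<close>

lemma finite_span_projection:
  fixes B :: "'v::real_inner set"
  assumes "finite B"
  shows "\<exists>y\<in>span B. \<forall>b\<in>B. (x - y) \<bullet> b = 0"
  using assms
proof (induction B arbitrary: x rule: finite_induct)
  case empty
  then show ?case by auto
next
  case (insert b B)
  obtain z where z: "z \<in> span B" "\<forall>e\<in>B. (b - z) \<bullet> e = 0" using insert.IH by blast
  obtain y where y: "y \<in> span B" "\<forall>e\<in>B. (x - y) \<bullet> e = 0" using insert.IH by blast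
  define u where "u = b - z"
  have orth: "v \<bullet> u' = 0" if "\<forall>e\<in>B. v \<bullet> e = 0" "u' \<in> span B" for v u'
    using that(2,1) by (induction rule: span_induct) (auto simp: inner_add_right intro!: subspaceI)
  have zb: "z \<in> span (insert b B)" "y \<in> span (insert b B)" "b \<in> span (insert b B)"
    using z y span_mono[of B "insert b B"] by (auto intro: span_base)
  show ?case
  proof (cases "u = 0")
    case True
    then have "b = z" by (simp add: u_def)
    then show ?thesis using y orth z(1) zb by blast
  next
    case False
    define y' where "y' = y + ((x - y) \<bullet> u / (u \<bullet> u)) *\<^sub>R u"
    have "y' \<in> span (insert b B)" unfolding y'_def u_def
      using zb by (intro span_add span_scale span_diff)
    moreover have 1: "(x - y') \<bullet> e = 0" if "e \<in> B" for e
      using that y z by (auto simp: y'_def u_def[symmetric] inner_diff_left inner_add_left)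
    moreover have "(x - y') \<bullet> b = 0"
    proof -
      have "(x - y') \<bullet> z = 0" using 1 orth z(1) by blast
      moreover have "(x - y') \<bullet> u = 0"
        using False by (auto simp: y'_def inner_diff_left inner_add_left)
      ultimately show ?thesis by (simp add: u_def inner_diff_right)
    qed
    ultimately show ?thesis by blast
  qed
qed

locale finite_coxeter =
  fixes W :: "('w, 'x) monoid_scheme"
    and S :: "'w set"
    and \<rho> :: "'w \<Rightarrow> 'v \<Rightarrow> 'v::real_inner"
    and \<alpha> :: "'w \<Rightarrow> 'v"
  assumes system: "coxeter_system W S"
    and finite_carrier: "finite (carrier W)"
    and representation: "reflection_representation W S \<rho> \<alpha>"
begin

abbreviation act :: "'w list \<Rightarrow> 'v \<Rightarrow> 'v" where
  "act Q \<equiv> \<rho> (word_prod W Q)"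

abbreviation \<omega> :: "'w \<Rightarrow> 'v" where
  "\<omega> \<equiv> fundamental_weight S \<rho> \<alpha>"

abbreviation \<Phi> :: "'v set" where
  "\<Phi> \<equiv> root_system W S \<rho> \<alpha>"

sublocale group W
  using system by (simp add: coxeter_system_def)

sublocale faithful_action W UNIV \<rho>
  using representation by (simp add: reflection_representation_def)

lemma gen_carrier: "s \<in> S \<Longrightarrow> s \<in> carrier W"
  using system by (auto simp: coxeter_system_def)

lemma gen_square: "s \<in> S \<Longrightarrow> s \<otimes>\<^bsub>W\<^esub> s = \<one>\<^bsub>W\<^esub>"
  using system by (auto simp: coxeter_system_def)

lemma finite_S: "finite S"
  using gen_carrier finite_carrier by (meson finite_subset subsetI)

lemma word_prod_Nil [simp]: "word_prod W [] = \<one>\<^bsub>W\<^esub>"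
  and word_prod_Cons [simp]: "word_prod W (q # Q) = q \<otimes>\<^bsub>W\<^esub> word_prod W Q"
  by (auto simp: word_prod_def)

lemma word_prod_closed [simp]: "Q \<in> lists S \<Longrightarrow> word_prod W Q \<in> carrier W"
  by (induction Q) (auto simp: gen_carrier)

lemma word_prod_append:
  "P \<in> lists S \<Longrightarrow> Q \<in> lists S \<Longrightarrow> word_prod W (P @ Q) = word_prod W P \<otimes>\<^bsub>W\<^esub> word_prod W Q"
  by (induction P) (auto simp: gen_carrier m_assoc)

lemma action_one [simp]: "\<rho> \<one>\<^bsub>W\<^esub> v = v"
  by (metis UNIV_I id_eq_one restrict_apply')

lemma action_mult: "g \<in> carrier W \<Longrightarrow> h \<in> carrier W \<Longrightarrow> \<rho> (g \<otimes>\<^bsub>W\<^esub> h) v = \<rho> g (\<rho> h v)"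
  by (simp add: composition_rule)

lemma action_inj: "g \<in> carrier W \<Longrightarrow> h \<in> carrier W \<Longrightarrow> (\<And>v. \<rho> g v = \<rho> h v) \<Longrightarrow> g = h"
  using faithful_action_axioms unfolding faithful_action_def faithful_action_axioms_def inj_on_def
  by blast

lemma act_Nil [simp]: "act [] v = v"
  by simp

lemma act_Cons: "s \<in> S \<Longrightarrow> Q \<in> lists S \<Longrightarrow> act (s # Q) v = \<rho> s (act Q v)"
  by (simp add: action_mult gen_carrier)

lemma act_append: "P \<in> lists S \<Longrightarrow> Q \<in> lists S \<Longrightarrow> act (P @ Q) v = act P (act Q v)"
  by (simp add: action_mult word_prod_append)

lemma act_single: "s \<in> S \<Longrightarrow> act [s] v = \<rho> s v"
  by (simp add: gen_carrier)

lemma act_inj: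
  "P \<in> lists S \<Longrightarrow> Q \<in> lists S \<Longrightarrow> (\<And>v. act P v = act Q v) \<Longrightarrow> word_prod W P = word_prod W Q"
  by (rule action_inj) auto

lemma gen_reflection: "s \<in> S \<Longrightarrow> \<rho> s = reflection (\<alpha> s)"
  using representation by (auto simp: reflection_representation_def)

lemma gen_involution: "s \<in> S \<Longrightarrow> \<rho> s (\<rho> s v) = v"
  by (simp add: gen_reflection reflection_involution)

lemma act_rev: "Q \<in> lists S \<Longrightarrow> act (rev Q) (act Q v) = v"
proof (induction Q arbitrary: v)
  case (Cons q Q)
  then have "act (rev (q # Q)) (act (q # Q) v) = act (rev Q) (\<rho> q (\<rho> q (act Q v)))"
    by (simp add: act_append act_Cons act_single gen_carrier del: word_prod_Cons)
  with Cons show ?case by (simp add: gen_involution)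
qed simp

lemma act_rev': "Q \<in> lists S \<Longrightarrow> act Q (act (rev Q) v) = v"
  using act_rev[of "rev Q"] by simp

lemma word_prod_rev: "Q \<in> lists S \<Longrightarrow> word_prod W (rev Q) = inv\<^bsub>W\<^esub> word_prod W Q"
proof -
  assume Q: "Q \<in> lists S"
  then have rQ: "rev Q \<in> lists S" by simp
  have "word_prod W (rev Q @ Q) = word_prod W []"
    using Q rQ by (intro act_inj) (auto simp: act_append act_rev)
  then show ?thesis using Q rQ by (simp add: word_prod_append inv_equality)
qed

lemma ex_word:
  assumes "w \<in> carrier W"
  shows "\<exists>Q\<in>lists S. word_prod W Q = w"
proof -
  have "w \<in> generate W S" using assms system by (simp add: coxeter_system_def)
  then show ?thesis
  proof (induction rule: generate.induct)
    case one
    show ?case by (rule bexI[of _ "[]"]) auto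
  next
    case (incl h)
    then show ?case by (intro bexI[of _ "[h]"]) (auto simp: gen_carrier)
  next
    case (inv h)
    then have "inv\<^bsub>W\<^esub> h = h" by (simp add: gen_carrier gen_square inv_equality)
    with inv show ?case by (intro bexI[of _ "[h]"]) (auto simp: gen_carrier)
  next
    case (eng h1 h2)
    then obtain P Q where "P \<in> lists S" "Q \<in> lists S" "word_prod W P = h1" "word_prod W Q = h2"
      by blast
    then show ?case by (intro bexI[of _ "P @ Q"]) (auto simp: word_prod_append)
  qed
qed

lemma linear_act: "Q \<in> lists S \<Longrightarrow> linear (act Q)"
proof (induction Q)
  case Nil
  have "act [] = id" by auto
  then show ?case by (metis linear_id)
next
  case (Cons q Q)
  then have "act (q # Q) = \<rho> q \<circ> act Q"
    using act_Cons by fastforce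
  then show ?case using Cons linear_reflection gen_reflection
    by (metis linear_compose listsE)
qed

lemma act_inner: "Q \<in> lists S \<Longrightarrow> act Q x \<bullet> act Q y = x \<bullet> y"
  by (induction Q) (auto simp: act_Cons gen_reflection reflection_inner simp del: word_prod_Cons)

lemma act_inner_left: "Q \<in> lists S \<Longrightarrow> act Q x \<bullet> y = x \<bullet> act (rev Q) y"
  by (metis act_inner act_rev')

lemma act_zero [simp]: "Q \<in> lists S \<Longrightarrow> act Q 0 = 0"
  using linear_act linear_0 by blast

lemma act_minus: "Q \<in> lists S \<Longrightarrow> act Q (- x) = - act Q x"
  using linear_act linear_neg by blast

lemma act_diff: "Q \<in> lists S \<Longrightarrow> act Q (x - y) = act Q x - act Q y"
  using linear_act linear_diff by blast

lemma act_add: "Q \<in> lists S \<Longrightarrow> act Q (x + y) = act Q x + act Q y"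
  using linear_act linear_add by blast

lemma act_scale: "Q \<in> lists S \<Longrightarrow> act Q (r *\<^sub>R x) = r *\<^sub>R act Q x"
  using linear_act linear_cmul by blast

lemma act_sum: "Q \<in> lists S \<Longrightarrow> act Q (\<Sum>i\<in>A. f i) = (\<Sum>i\<in>A. act Q (f i))"
  using linear_act linear_sum by blast

lemma act_eq_iff: "Q \<in> lists S \<Longrightarrow> act Q x = act Q y \<longleftrightarrow> x = y"
  by (metis act_rev)

section \<open>Fundamental weights as a dual basis of the simple roots\<close>

lemma span_simple: "span (\<alpha> ` S) = UNIV"
  and independent_simple: "independent (\<alpha> ` S)"
  and inj_simple: "inj_on \<alpha> S"
  using representation by (auto simp: reflection_representation_def)

lemma simple_nonzero: "s \<in> S \<Longrightarrow> \<alpha> s \<noteq> 0"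
  using independent_simple dependent_zero imageI by metis

lemma inner_simple_eqI:
  assumes "\<And>s. s \<in> S \<Longrightarrow> v \<bullet> \<alpha> s = w \<bullet> \<alpha> s"
  shows "v = w"
proof -
  have "(v - w) \<bullet> x = 0" if "x \<in> span (\<alpha> ` S)" for x
    using that by (induction rule: span_induct)
      (auto simp: assms inner_diff_left inner_add_right intro!: subspaceI)
  then have "(v - w) \<bullet> (v - w) = 0" by (simp add: span_simple)
  then show ?thesis by simp
qed

text \<open>The residue u of \<open>\<alpha> t\<close> modulo the span of the other simple roots is
  orthogonal to them, and nonzero by independence; only its length has to be adjusted.\<close>

lemma ex_fundamental_weight:
  assumes "t \<in> S"
  shows "\<exists>v. \<forall>s\<in>S. v \<bullet> \<alpha> s = (if s = t then \<alpha> t \<bullet> \<alpha> t / 2 else 0)"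
proof -
  obtain y where y: "y \<in> span (\<alpha> ` (S - {t}))" "\<forall>b\<in>\<alpha> ` (S - {t}). (\<alpha> t - y) \<bullet> b = 0"
    using finite_span_projection[of "\<alpha> ` (S - {t})" "\<alpha> t"] finite_S by blast
  define u where "u = \<alpha> t - y"
  have *: "\<alpha> ` S - {\<alpha> t} = \<alpha> ` (S - {t})" using inj_simple assms by (auto simp: inj_on_def)
  have "u \<noteq> 0"
    using independent_simple assms y(1) * unfolding u_def dependent_def by (metis eq_iff_diff_eq_0 imageI)
  have "u \<bullet> x = 0" if "x \<in> span (\<alpha> ` (S - {t}))" for x
    using that y(2) by (induction rule: span_induct)
      (auto simp: u_def inner_add_right intro!: subspaceI)
  then have "u \<bullet> y = 0" using y(1) by blast
  then have ut: "u \<bullet> \<alpha> t = u \<bullet> u" by (simp add: u_def inner_diff_right)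
  show ?thesis
    using y(2) \<open>u \<noteq> 0\<close> assms
    \<comment> \<open>As u pairs with \<open>\<alpha> t\<close> to \<open>u \<bullet> u\<close>,
      this factor normalizes the pairing to half the squared length of \<open>\<alpha> t\<close>,
      that is, to 1 with the coroot.\<close>
    by (intro exI[of _ "(\<alpha> t \<bullet> \<alpha> t / 2 / (u \<bullet> u)) *\<^sub>R u"]) (auto simp: ut u_def[symmetric])
qed

text \<open>Turns a condition on the action of s into the value of an inner product; r = 1 and r = 0
  give the defining equations of a fundamental weight.\<close>

lemma gen_fix_iff:
  assumes "s \<in> S"
  shows "\<rho> s v = v - r *\<^sub>R \<alpha> s \<longleftrightarrow> v \<bullet> \<alpha> s = r * (\<alpha> s \<bullet> \<alpha> s / 2)"
  using simple_nonzero[OF assms]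
  by (auto simp: gen_reflection[OF assms] reflection_def field_simps)

lemma weight_property_iff:
  assumes "t \<in> S"
  shows "(\<forall>s\<in>S. \<rho> s v = v - (if s = t then \<alpha> s else 0)) \<longleftrightarrow>
    (\<forall>s\<in>S. v \<bullet> \<alpha> s = (if s = t then \<alpha> t \<bullet> \<alpha> t / 2 else 0))"
  using gen_fix_iff[of _ v 1] gen_fix_iff[of _ v 0] by (auto split: if_splits)

lemma weight_unique:
  assumes "t \<in> S" "\<And>s. s \<in> S \<Longrightarrow> \<rho> s v = v - (if s = t then \<alpha> s else 0)"
  shows "\<omega> t = v"
  unfolding fundamental_weight_def
proof (rule the_equality)
  show "\<forall>s\<in>S. \<rho> s v = v - (if s = t then \<alpha> s else 0)" using assms by blast
next
  fix u assume u: "\<forall>s\<in>S. \<rho> s u = u - (if s = t then \<alpha> s else 0)"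
  show "u = v"
    using u assms weight_property_iff[of t u] weight_property_iff[of t v]
    by (intro inner_simple_eqI) auto
qed

lemma gen_weight:
  assumes "t \<in> S" "s \<in> S"
  shows "\<rho> s (\<omega> t) = \<omega> t - (if s = t then \<alpha> s else 0)"
proof -
  obtain v where "\<forall>s\<in>S. v \<bullet> \<alpha> s = (if s = t then \<alpha> t \<bullet> \<alpha> t / 2 else 0)"
    using ex_fundamental_weight[OF assms(1)] by blast
  then have v: "\<forall>s\<in>S. \<rho> s v = v - (if s = t then \<alpha> s else 0)"
    using weight_property_iff[OF assms(1)] by blast
  then have "\<omega> t = v" using weight_unique[OF assms(1)] by blast
  with v assms(2) show ?thesis by blast
qed

lemma weight_inner:
  assumes "t \<in> S" "s \<in> S"
  shows "\<alpha> s \<bullet> \<omega> t = (if s = t then \<alpha> t \<bullet> \<alpha> t / 2 else 0)"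
  using weight_property_iff[OF assms(1), of "\<omega> t"] gen_weight assms by (auto simp: inner_commute)

lemma simple_norm_pos: "s \<in> S \<Longrightarrow> 0 < \<alpha> s \<bullet> \<alpha> s"
  using simple_nonzero by simp

text \<open>Up to positive factors the fundamental weights are the coordinate functions of the basis
  of simple roots. Signs of roots are tested in this way throughout.\<close>

lemma expansion: "v = (\<Sum>s\<in>S. (2 * (v \<bullet> \<omega> s) / (\<alpha> s \<bullet> \<alpha> s)) *\<^sub>R \<alpha> s)"
proof -
  have "\<exists>f. v = (\<Sum>s\<in>S. f s *\<^sub>R \<alpha> s)"
  proof -
    have "v \<in> span (\<alpha> ` S)" by (simp add: span_simple)
    then obtain u where "v = (\<Sum>x\<in>\<alpha> ` S. u x *\<^sub>R x)"
      using finite_S by (auto simp: span_finite)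
    then show ?thesis using inj_simple by (auto simp: sum.reindex)
  qed
  then obtain f where f: "v = (\<Sum>s\<in>S. f s *\<^sub>R \<alpha> s)" by blast
  have "v \<bullet> \<omega> t = f t * (\<alpha> t \<bullet> \<alpha> t / 2)" if "t \<in> S" for t
  proof -
    have "v \<bullet> \<omega> t = (\<Sum>s\<in>S. if s = t then f t * (\<alpha> t \<bullet> \<alpha> t / 2) else 0)"
      unfolding f inner_sum_left by (intro sum.cong) (auto simp: weight_inner that)
    then show ?thesis using that finite_S by simp
  qed
  then have "(2 * (v \<bullet> \<omega> t) / (\<alpha> t \<bullet> \<alpha> t)) *\<^sub>R \<alpha> t = f t *\<^sub>R \<alpha> t" if "t \<in> S" for t
    using that simple_nonzero by (simp add: divide_eq_eq mult.commute)
  then have "(\<Sum>s\<in>S. (2 * (v \<bullet> \<omega> s) / (\<alpha> s \<bullet> \<alpha> s)) *\<^sub>R \<alpha> s) = (\<Sum>s\<in>S. f s *\<^sub>R \<alpha> s)"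
    by (intro sum.cong) auto
  then show ?thesis using f by simp
qed

lemma inner_weight_eqI:
  assumes "\<And>s. s \<in> S \<Longrightarrow> v \<bullet> \<omega> s = w \<bullet> \<omega> s"
  shows "v = w"
  by (subst expansion[of v], subst expansion[of w]) (simp add: assms)

lemma inner_expansion: "v \<bullet> x = (\<Sum>s\<in>S. 2 * (v \<bullet> \<omega> s) / (\<alpha> s \<bullet> \<alpha> s) * (\<alpha> s \<bullet> x))"
  by (subst expansion[of v]) (simp add: inner_sum_left)

end

section \<open>Inversions and length\<close>

context finite_coxeter
begin

text \<open>By \<open>expansion\<close>, membership in the cone spanned by the simple roots.\<close>

definition nonneg :: "'v \<Rightarrow> bool" where
  "nonneg v \<longleftrightarrow> (\<forall>s\<in>S. 0 \<le> v \<bullet> \<omega> s)"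

definition pos_roots :: "'v set" where
  "pos_roots = {\<beta>\<in>\<Phi>. nonneg \<beta>}"

text \<open>The left inversions of the product: on this side, appending a letter changes the set by
  a single root, and for a reduced word the set consists of the roots met along its
  prefixes.\<close>

definition inversions :: "'w list \<Rightarrow> 'v set" where
  "inversions Q = {\<beta>\<in>pos_roots. act (rev Q) \<beta> \<notin> pos_roots}"

text \<open>Reducedness in a form that can be checked letter by letter; see
  \<open>reduced_expression_iff\<close>.\<close>

definition pos_word :: "'w list \<Rightarrow> bool" where
  "pos_word Q \<longleftrightarrow> (\<forall>k<length Q. act (take k Q) (\<alpha> (Q ! k)) \<in> pos_roots)"

section \<open>Positive and negative roots\<close>

lemma gen_inner: "s \<in> S \<Longrightarrow> \<rho> s x \<bullet> y = x \<bullet> \<rho> s y"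
  using act_inner_left[of "[s]" x y] by (simp add: gen_carrier)

lemma simple_root: "s \<in> S \<Longrightarrow> \<alpha> s \<in> \<Phi>"
  unfolding root_system_def by (rule CollectI, rule exI[of _ "\<one>\<^bsub>W\<^esub>"], rule exI[of _ s]) simp

lemma root_word:
  assumes "\<beta> \<in> \<Phi>"
  obtains Q s where "Q \<in> lists S" "s \<in> S" "\<beta> = act Q (\<alpha> s)"
  using assms ex_word unfolding root_system_def by blast

lemma act_simple_root: "Q \<in> lists S \<Longrightarrow> s \<in> S \<Longrightarrow> act Q (\<alpha> s) \<in> \<Phi>"
  unfolding root_system_def by (rule CollectI, rule exI[of _ "word_prod W Q"], rule exI[of _ s]) simp

lemma act_root: "Q \<in> lists S \<Longrightarrow> \<beta> \<in> \<Phi> \<Longrightarrow> act Q \<beta> \<in> \<Phi>"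
proof (erule root_word)
  fix P s assume "Q \<in> lists S" "P \<in> lists S" "s \<in> S" "\<beta> = act P (\<alpha> s)"
  then show ?thesis using act_simple_root[of "Q @ P" s] by (simp add: act_append)
qed

lemma gen_root: "s \<in> S \<Longrightarrow> \<beta> \<in> \<Phi> \<Longrightarrow> \<rho> s \<beta> \<in> \<Phi>"
  using act_root[of "[s]" \<beta>] by (simp add: gen_carrier)

lemma gen_self: "s \<in> S \<Longrightarrow> \<rho> s (\<alpha> s) = - \<alpha> s"
  by (simp add: gen_reflection reflection_self)

lemma gen_minus: "s \<in> S \<Longrightarrow> \<rho> s (- v) = - \<rho> s v"
  using act_minus[of "[s]" v] by (simp add: gen_carrier)

lemma gen_diff: "s \<in> S \<Longrightarrow> \<rho> s (x - y) = \<rho> s x - \<rho> s y"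
  using act_diff[of "[s]" x y] by (simp add: gen_carrier)

lemma finite_roots: "finite \<Phi>"
proof -
  have "\<Phi> = (\<lambda>(w, s). \<rho> w (\<alpha> s)) ` (carrier W \<times> S)"
    unfolding root_system_def by auto
  then show ?thesis using finite_carrier finite_S by simp
qed

lemma uminus_root: "\<beta> \<in> \<Phi> \<Longrightarrow> - \<beta> \<in> \<Phi>"
proof (erule root_word)
  fix P s assume "P \<in> lists S" "s \<in> S" "\<beta> = act P (\<alpha> s)"
  then show ?thesis using act_simple_root[of "P @ [s]" s]
    by (simp add: act_append act_single gen_self act_minus del: word_prod_Cons)
qed

lemma root_nonzero: "\<beta> \<in> \<Phi> \<Longrightarrow> \<beta> \<noteq> 0"
proof (erule root_word)
  fix P s assume "P \<in> lists S" "s \<in> S" "\<beta> = act P (\<alpha> s)"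
  then show ?thesis using simple_nonzero act_eq_iff[of P "\<alpha> s" 0] by auto
qed

lemma nonneg_simple: "s \<in> S \<Longrightarrow> nonneg (\<alpha> s)"
  by (auto simp: nonneg_def weight_inner)

lemma simple_pos_root: "s \<in> S \<Longrightarrow> \<alpha> s \<in> pos_roots"
  by (simp add: pos_roots_def simple_root nonneg_simple)

lemma nonneg_antisym: "nonneg v \<Longrightarrow> nonneg (- v) \<Longrightarrow> v = 0"
  by (rule inner_weight_eqI) (force simp: nonneg_def intro: order_antisym)

lemma root_cases:
  assumes "\<beta> \<in> \<Phi>"
  shows "\<beta> \<in> pos_roots \<longleftrightarrow> - \<beta> \<notin> pos_roots"
proof -
  have sums: "nonneg (\<Sum>s\<in>S. f s *\<^sub>R \<alpha> s)" if "\<forall>s\<in>S. 0 \<le> f s" for f :: "'w \<Rightarrow> real"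
    unfolding nonneg_def inner_sum_left using that
    by (auto intro!: sum_nonneg simp: weight_inner)
  obtain f where "\<forall>s\<in>S. 0 \<le> f s"
    "\<beta> = (\<Sum>s\<in>S. f s *\<^sub>R \<alpha> s) \<or> \<beta> = - (\<Sum>s\<in>S. f s *\<^sub>R \<alpha> s)"
    using assms representation unfolding reflection_representation_def by meson
  then have "nonneg \<beta> \<or> nonneg (- \<beta>)" using sums by auto
  moreover have "\<not> (nonneg \<beta> \<and> nonneg (- \<beta>))" using nonneg_antisym root_nonzero assms by blast
  ultimately show ?thesis using assms uminus_root by (auto simp: pos_roots_def)
qed

lemma pos_root_root: "\<beta> \<in> pos_roots \<Longrightarrow> \<beta> \<in> \<Phi>"
  by (simp add: pos_roots_def)

lemma finite_pos_roots: "finite pos_roots"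
  using finite_roots by (simp add: pos_roots_def)

lemma pos_root_inner: "\<beta> \<in> pos_roots \<Longrightarrow> s \<in> S \<Longrightarrow> 0 \<le> \<beta> \<bullet> \<omega> s"
  by (simp add: pos_roots_def nonneg_def)

lemma pos_rootI:
  assumes "\<beta> \<in> \<Phi>" "s \<in> S" "0 < \<beta> \<bullet> \<omega> s"
  shows "\<beta> \<in> pos_roots"
proof (rule ccontr)
  assume "\<beta> \<notin> pos_roots"
  then have "- \<beta> \<in> pos_roots" using root_cases assms by blast
  with assms show False using pos_root_inner[of "- \<beta>" s] by simp
qed

text \<open>The only roots on the line of \<open>\<alpha> s\<close> are \<open>\<alpha> s\<close>
  and its negative, so another positive root has a positive coordinate at some t different from s,
  and s leaves that coordinate unchanged.\<close>

lemma gen_pos_root: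
  assumes "s \<in> S" "\<beta> \<in> pos_roots" "\<beta> \<noteq> \<alpha> s"
  shows "\<rho> s \<beta> \<in> pos_roots"
proof -
  have "\<exists>t\<in>S - {s}. 0 < \<beta> \<bullet> \<omega> t"
  proof (rule ccontr)
    assume "\<not> ?thesis"
    then have 0: "\<beta> \<bullet> \<omega> t = 0" if "t \<in> S" "t \<noteq> s" for t
      using that pos_root_inner[OF assms(2) that(1)] by (metis DiffI singletonD less_eq_real_def)
    have "\<beta> = (\<Sum>t\<in>S. if t = s then (2 * (\<beta> \<bullet> \<omega> s) / (\<alpha> s \<bullet> \<alpha> s)) *\<^sub>R \<alpha> s else 0)"
      by (subst expansion[of \<beta>], rule sum.cong) (auto simp: 0)
    also have "\<dots> = (2 * (\<beta> \<bullet> \<omega> s) / (\<alpha> s \<bullet> \<alpha> s)) *\<^sub>R \<alpha> s"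
      using finite_S assms(1) by (simp add: sum.delta)
    finally have "\<beta> \<in> span {\<alpha> s}" by (metis span_base span_scale singletonI)
    moreover have "\<Phi> \<inter> span {\<alpha> s} = {\<alpha> s, - \<alpha> s}"
      using representation simple_root[OF assms(1)] unfolding reflection_representation_def by blast
    ultimately have "\<beta> = - \<alpha> s" using assms pos_root_root by blast
    then show False using root_cases[OF simple_root[OF assms(1)]] simple_pos_root assms by auto
  qed
  then obtain t where t: "t \<in> S" "t \<noteq> s" "0 < \<beta> \<bullet> \<omega> t" by blast
  then have "0 < \<rho> s \<beta> \<bullet> \<omega> t" using assms(1) by (simp add: gen_inner gen_weight)
  then show ?thesis using pos_rootI t assms gen_root pos_root_root by blast
qed

lemma gen_pos_root_iff:
  assumes "s \<in> S" "\<beta> \<in> \<Phi>"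
  shows "\<rho> s \<beta> \<in> pos_roots \<longleftrightarrow> (\<beta> \<in> pos_roots \<and> \<beta> \<noteq> \<alpha> s) \<or> \<beta> = - \<alpha> s"
proof -
  have neg: "- \<alpha> s \<notin> pos_roots"
    using root_cases[OF simple_root[OF assms(1)]] simple_pos_root[OF assms(1)] by simp
  show ?thesis
  proof (cases "\<beta> = \<alpha> s \<or> \<beta> = - \<alpha> s")
    case True
    then show ?thesis
      using assms simple_pos_root neg root_nonzero[OF simple_root[OF assms(1)]]
      by (auto simp: gen_self gen_minus)
  next
    case False
    then have "\<beta> \<notin> pos_roots \<Longrightarrow> \<rho> s (- \<beta>) \<in> pos_roots"
      using gen_pos_root[OF assms(1), of "- \<beta>"] root_cases[OF assms(2)] by (metis minus_minus)
    then show ?thesis using False gen_pos_root assms root_cases[OF gen_root[OF assms]]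
      by (auto simp: gen_minus)
  qed
qed

text \<open>By \<open>gen_pos_root_iff\<close> the new letter s changes signs only at the two roots
  that the inverse of Q carries to \<open>\<alpha> s\<close> and its negative.\<close>

lemma inversions_snoc:
  assumes Q: "Q \<in> lists S" and s: "s \<in> S"
  shows "inversions (Q @ [s]) = (inversions Q - {- act Q (\<alpha> s)}) \<union> ({act Q (\<alpha> s)} \<inter> pos_roots)"
proof -
  have "\<beta> \<in> inversions (Q @ [s]) \<longleftrightarrow>
    \<beta> \<in> pos_roots \<and> (\<beta> \<in> inversions Q \<and> \<beta> \<noteq> - act Q (\<alpha> s) \<or> \<beta> = act Q (\<alpha> s))"
    (is "_ \<longleftrightarrow> ?R") for \<beta>
  proof (cases "\<beta> \<in> pos_roots")
    case True
    let ?g = "act (rev Q) \<beta>"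
    have root: "?g \<in> \<Phi>" using True Q by (simp add: act_root pos_root_root)
    have "\<beta> = act Q ?g" using Q by (simp add: act_rev')
    then have eqs: "?g = \<alpha> s \<longleftrightarrow> \<beta> = act Q (\<alpha> s)" "?g = - \<alpha> s \<longleftrightarrow> \<beta> = - act Q (\<alpha> s)"
      using act_eq_iff[OF Q, of ?g "\<alpha> s"] act_eq_iff[OF Q, of ?g "- \<alpha> s"] by (simp_all add: act_minus[OF Q])
    have "act (rev (Q @ [s])) \<beta> = \<rho> s ?g" using Q s by (simp add: act_Cons del: word_prod_Cons)
    then have "\<beta> \<in> inversions (Q @ [s]) \<longleftrightarrow> \<not> (?g \<in> pos_roots \<and> ?g \<noteq> \<alpha> s \<or> ?g = - \<alpha> s)"
      using True gen_pos_root_iff[OF s root] by (simp add: inversions_def)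
    moreover have "\<alpha> s \<noteq> - \<alpha> s"
      using root_cases[OF simple_root[OF s]] simple_pos_root[OF s] by metis
    ultimately show ?thesis using True eqs unfolding inversions_def by auto
  next
    case False
    then show ?thesis by (simp add: inversions_def)
  qed
  then show ?thesis by (auto simp: inversions_def)
qed

lemma finite_inversions: "finite (inversions Q)"
  using finite_pos_roots by (simp add: inversions_def)

lemma inversions_Nil [simp]: "inversions [] = {}"
  by (auto simp: inversions_def)

lemma card_inversions_le: "Q \<in> lists S \<Longrightarrow> card (inversions Q) \<le> length Q"
proof (induction Q rule: rev_induct)
  case (snoc s Q)
  have "card (inversions (Q @ [s])) \<le> card (inversions Q - {- act Q (\<alpha> s)}) + card ({act Q (\<alpha> s)} \<inter> pos_roots)"
    using snoc.prems by (subst inversions_snoc) (auto intro: card_Un_le)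
  also have "\<dots> \<le> card (inversions Q) + card {act Q (\<alpha> s)}"
    by (intro add_mono card_mono) (auto simp: finite_inversions)
  finally show ?case using snoc by simp
qed simp

lemma pos_word_snoc:
  "pos_word (Q @ [s]) \<longleftrightarrow> pos_word Q \<and> act Q (\<alpha> s) \<in> pos_roots"
  by (auto simp: pos_word_def nth_append less_Suc_eq)

lemma pos_word_Nil [simp]: "pos_word []"
  by (simp add: pos_word_def)

lemma pos_word_inversions:
  assumes "Q \<in> lists S" "pos_word Q"
  shows "inversions Q = (\<lambda>k. act (take k Q) (\<alpha> (Q ! k))) ` {..<length Q} \<and> card (inversions Q) = length Q"
  using assms
proof (induction Q rule: rev_induct)
  case (snoc s Q)
  let ?b = "act Q (\<alpha> s)"
  have Q: "Q \<in> lists S" "s \<in> S" "pos_word Q" "?b \<in> pos_roots"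
    using snoc.prems by (auto simp: pos_word_snoc)
  have "- ?b \<notin> pos_roots" "?b \<notin> inversions Q"
    using Q root_cases[of ?b] pos_root_root simple_pos_root by (auto simp: inversions_def act_rev)
  then have inv: "inversions (Q @ [s]) = insert ?b (inversions Q)"
    using Q inversions_snoc[of Q s] by (auto simp: inversions_def)
  have "(\<lambda>k. act (take k (Q @ [s])) (\<alpha> ((Q @ [s]) ! k))) ` {..<length Q}
    = (\<lambda>k. act (take k Q) (\<alpha> (Q ! k))) ` {..<length Q}"
    by (rule image_cong) (auto simp: nth_append)
  then have img: "(\<lambda>k. act (take k (Q @ [s])) (\<alpha> ((Q @ [s]) ! k))) ` {..<length (Q @ [s])}
    = insert ?b ((\<lambda>k. act (take k Q) (\<alpha> (Q ! k))) ` {..<length Q})"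
    by (simp add: lessThan_Suc)
  have "card (inversions (Q @ [s])) = Suc (card (inversions Q))"
    using \<open>?b \<notin> inversions Q\<close> finite_inversions inv by simp
  then have "card (inversions (Q @ [s])) = length (Q @ [s])"
    using snoc.IH[OF Q(1,3)] by (metis length_append_singleton)
  moreover have "inversions (Q @ [s]) = insert ?b ((\<lambda>k. act (take k Q) (\<alpha> (Q ! k))) ` {..<length Q})"
    using snoc.IH Q inv by metis
  ultimately show ?case using img by metis
qed auto

section \<open>Deletion, length and reduced words\<close>

lemma act_reflection:
  assumes "Q \<in> lists S"
  shows "act Q (reflection a v) = reflection (act Q a) (act Q v)"
  using assms by (simp add: reflection_def act_diff act_scale act_inner)

lemma act_commute_gen:
  assumes "B \<in> lists S" "s \<in> S" "t \<in> S" "act B (\<alpha> s) = \<alpha> t \<or> act B (\<alpha> s) = - \<alpha> t"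
  shows "act B (\<rho> s v) = \<rho> t (act B v)"
  using assms act_reflection[OF assms(1), of "\<alpha> s" v]
  by (auto simp: gen_reflection reflection_uminus)

text \<open>If the letter s meets a negative root, its negative was met at an earlier letter t.
  Writing Q = A t B, this means that B carries \<open>\<alpha> s\<close> to
  \<open>\<alpha> t\<close>, so B s and t B agree as elements and both t and s can be
  deleted.\<close>

lemma deletion:
  assumes "Q \<in> lists S" "\<not> pos_word Q"
  shows "\<exists>R\<in>lists S. word_prod W R = word_prod W Q \<and> length R < length Q"
  using assms
proof (induction Q rule: rev_induct)
  case (snoc s Q)
  then have Q: "Q \<in> lists S" "s \<in> S" by auto
  show ?case
  proof (cases "pos_word Q")
    case False
    then obtain R where "R \<in> lists S" "word_prod W R = word_prod W Q" "length R < length Q"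
      using snoc.IH Q by blast
    then show ?thesis using Q by (intro bexI[of _ "R @ [s]"]) (auto simp: word_prod_append)
  next
    case True
    let ?b = "act Q (\<alpha> s)"
    have root: "?b \<in> \<Phi>" using Q by (simp add: act_simple_root)
    have "?b \<notin> pos_roots" using True snoc.prems by (simp add: pos_word_snoc)
    then have "- ?b \<in> pos_roots" using root_cases[OF root] by blast
    moreover have "act (rev Q) (- ?b) \<notin> pos_roots"
      using Q root_cases[OF simple_root[OF Q(2)]] simple_pos_root
      by (simp add: act_minus act_rev)
    ultimately have "- ?b \<in> inversions Q" by (simp add: inversions_def)
    then obtain k where k: "k < length Q" "act (take k Q) (\<alpha> (Q ! k)) = - ?b"
      using pos_word_inversions[OF Q(1) True] by auto
    define A t B where "A = take k Q" and "t = Q ! k" and "B = drop (Suc k) Q"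
    have split: "Q = A @ t # B" using k by (simp add: A_def t_def B_def id_take_nth_drop)
    have mem: "A \<in> lists S" "t \<in> S" "B \<in> lists S" using Q split by auto
    have "act A (\<alpha> t) = act A (- \<rho> t (act B (\<alpha> s)))"
    proof -
      have "act A (\<alpha> t) = - act Q (\<alpha> s)" using k(2) by (simp add: A_def t_def)
      then have "act A (\<alpha> t) = - act (A @ t # B) (\<alpha> s)" by (simp only: split)
      then show ?thesis using mem by (simp add: act_append act_Cons act_minus del: word_prod_Cons)
    qed
    then have "\<alpha> t = - \<rho> t (act B (\<alpha> s))" using act_eq_iff mem by blast
    then have "\<rho> t (\<alpha> t) = - act B (\<alpha> s)" using mem by (simp add: gen_minus gen_involution)
    then have "act B (\<alpha> s) = \<alpha> t" using mem by (simp add: gen_self)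
    then have comm: "act B (\<rho> s v) = \<rho> t (act B v)" for v
      using act_commute_gen mem Q by blast
    have "word_prod W (A @ B) = word_prod W (Q @ [s])"
      using mem Q by (intro act_inj)
        (auto simp: split act_append act_Cons act_single comm gen_involution simp del: word_prod_Cons)
    then show ?thesis using mem by (intro bexI[of _ "A @ B"]) (auto simp: split)
  qed
qed simp

lemma ex_pos_word:
  assumes "Q \<in> lists S"
  shows "\<exists>R\<in>lists S. word_prod W R = word_prod W Q \<and> pos_word R"
  using assms
proof (induction "length Q" arbitrary: Q rule: less_induct)
  case less
  show ?case
  proof (cases "pos_word Q")
    case True
    then show ?thesis using less.prems by blast
  next
    case False
    then show ?thesis using deletion[OF less.prems] less.hyps by metis
  qed
qed

lemma inversions_cong:
  assumes "P \<in> lists S" "Q \<in> lists S" "word_prod W P = word_prod W Q"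
  shows "inversions P = inversions Q"
  using assms by (simp add: inversions_def word_prod_rev)

lemma coxeter_length_word:
  assumes "Q \<in> lists S"
  shows "coxeter_length W S (word_prod W Q) = card (inversions Q)"
  unfolding coxeter_length_def
proof (rule Least_equality)
  obtain R where "R \<in> lists S" "word_prod W R = word_prod W Q" "pos_word R"
    using ex_pos_word assms by blast
  then show "\<exists>R\<in>lists S. word_prod W R = word_prod W Q \<and> length R = card (inversions Q)"
    using pos_word_inversions inversions_cong assms by metis
next
  fix k assume "\<exists>R\<in>lists S. word_prod W R = word_prod W Q \<and> length R = k"
  then show "card (inversions Q) \<le> k" using card_inversions_le inversions_cong assms by metis
qed

lemma pos_word_iff:
  assumes "Q \<in> lists S"
  shows "pos_word Q \<longleftrightarrow> length Q = card (inversions Q)"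
proof
  assume "pos_word Q"
  then show "length Q = card (inversions Q)" using pos_word_inversions[OF assms] by metis
next
  assume len: "length Q = card (inversions Q)"
  show "pos_word Q"
  proof (rule ccontr)
    assume "\<not> pos_word Q"
    then obtain R where "R \<in> lists S" "word_prod W R = word_prod W Q" "length R < length Q"
      using deletion[OF assms] by blast
    then show False using len card_inversions_le[of R] inversions_cong[OF _ assms, of R] by simp
  qed
qed

lemma reduced_expression_iff:
  "reduced_expression W S Q w \<longleftrightarrow> Q \<in> lists S \<and> word_prod W Q = w \<and> pos_word Q"
  unfolding reduced_expression_def using coxeter_length_word pos_word_iff by metis

end

section \<open>The longest element\<close>

context finite_coxeter
begin

abbreviation w\<^sub>0 :: 'w where
  "w\<^sub>0 \<equiv> longest_element W S"

abbreviation \<phi> :: "'w \<Rightarrow> 'w" where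
  "\<phi> \<equiv> conj_longest W S"

lemma nonneg_expansion_inner:
  assumes "nonneg v" "\<And>s. s \<in> S \<Longrightarrow> 0 \<le> \<alpha> s \<bullet> x"
  shows "0 \<le> v \<bullet> x"
  unfolding inner_expansion[of v x] using assms
  by (intro sum_nonneg mult_nonneg_nonneg divide_nonneg_nonneg) (auto simp: nonneg_def)

lemma inversions_full_iff:
  assumes Q: "Q \<in> lists S"
  shows "inversions Q = pos_roots \<longleftrightarrow> (\<forall>s\<in>S. act Q (\<alpha> s) \<notin> pos_roots)"
proof
  assume inv: "inversions Q = pos_roots"
  show "\<forall>s\<in>S. act Q (\<alpha> s) \<notin> pos_roots"
  proof
    fix s assume "s \<in> S"
    then show "act Q (\<alpha> s) \<notin> pos_roots"
      using inv Q act_rev[of Q "\<alpha> s"] simple_pos_root[of s] unfolding inversions_def by force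
  qed
next
  assume neg: "\<forall>s\<in>S. act Q (\<alpha> s) \<notin> pos_roots"
  have "act (rev Q) \<beta> \<notin> pos_roots" if \<beta>: "\<beta> \<in> pos_roots" for \<beta>
  proof
    assume \<gamma>: "act (rev Q) \<beta> \<in> pos_roots"
    have "nonneg (- \<beta>)" unfolding nonneg_def
    proof
      fix t assume t: "t \<in> S"
      \<comment> \<open>The second vector pairs nonnegatively with every simple root, because Q
        makes these roots negative; hence it does so with the root assumed positive.\<close>
      have "0 \<le> act (rev Q) \<beta> \<bullet> (- act (rev Q) (\<omega> t))"
      proof (rule nonneg_expansion_inner)
        show "nonneg (act (rev Q) \<beta>)" using \<gamma> by (simp add: pos_roots_def)
        fix s assume s: "s \<in> S"
        then have "- act Q (\<alpha> s) \<in> pos_roots" using neg Q act_simple_root root_cases by blast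
        from pos_root_inner[OF this t] show "0 \<le> \<alpha> s \<bullet> - act (rev Q) (\<omega> t)"
          using act_inner_left[OF Q] by simp
      qed
      then show "0 \<le> - \<beta> \<bullet> \<omega> t" using Q by (simp add: act_inner)
    qed
    then show False using \<beta> nonneg_antisym root_nonzero by (auto simp: pos_roots_def)
  qed
  then show "inversions Q = pos_roots" by (auto simp: inversions_def)
qed

lemma inversions_empty:
  assumes "Q \<in> lists S" "inversions Q = {}"
  shows "word_prod W Q = \<one>\<^bsub>W\<^esub>"
proof -
  obtain R where R: "R \<in> lists S" "word_prod W R = word_prod W Q" "pos_word R"
    using ex_pos_word assms by blast
  then have "length R = 0" using pos_word_iff inversions_cong assms by (metis card.empty)
  then show ?thesis using R by auto
qed

text \<open>Two elements that both reverse the signs of all roots differ by an element that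
  preserves positivity, which has no inversions and is trivial.\<close>

lemma inversions_full_unique:
  assumes "P \<in> lists S" "Q \<in> lists S" "inversions P = pos_roots" "inversions Q = pos_roots"
  shows "word_prod W P = word_prod W Q"
proof -
  have neg: "- act (rev R) \<beta> \<in> pos_roots" if "R \<in> lists S" "inversions R = pos_roots" "\<beta> \<in> pos_roots" for R \<beta>
    using that root_cases[of "act (rev R) \<beta>"] act_root[of "rev R" \<beta>] pos_root_root
    unfolding inversions_def by auto
  have rev_full: "inversions (rev R) = pos_roots" if R: "R \<in> lists S" "inversions R = pos_roots" for R
  proof -
    have "act R \<beta> \<notin> pos_roots" if \<beta>: "\<beta> \<in> pos_roots" for \<beta>
    proof
      assume "act R \<beta> \<in> pos_roots"
      then have "- \<beta> \<in> pos_roots" using neg[OF R] R act_rev by metis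
      then show False using \<beta> root_cases pos_root_root by blast
    qed
    then show ?thesis by (auto simp: inversions_def)
  qed
  have "inversions (P @ rev Q) = {}"
  proof -
    have "act Q (act (rev P) \<beta>) \<in> pos_roots" if "\<beta> \<in> pos_roots" for \<beta>
      using neg[OF assms(1,3) that] neg[OF _ rev_full[OF assms(2,4)], of "- act (rev P) \<beta>"] assms
      by (simp add: act_minus)
    then show ?thesis using assms by (auto simp: inversions_def act_append)
  qed
  then have 1: "word_prod W (P @ rev Q) = \<one>\<^bsub>W\<^esub>" using inversions_empty assms by simp
  show ?thesis
  proof (rule act_inj)
    fix v
    have "act (P @ rev Q) (act Q v) = act Q v" using 1 by simp
    then show "act P v = act Q v" using assms by (simp add: act_append act_rev)
  qed (use assms in auto)
qed

text \<open>Take a word with the maximal number of inversions: if it left a simple root positive,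
  appending that letter would add an inversion.\<close>

lemma ex_inversions_full: "\<exists>Q\<in>lists S. inversions Q = pos_roots"
proof -
  have "finite {card (inversions Q) |Q. Q \<in> lists S}"
    by (rule finite_subset[of _ "{..card pos_roots}"])
      (auto intro!: card_mono finite_pos_roots simp: inversions_def)
  moreover have "{card (inversions Q) |Q. Q \<in> lists S} \<noteq> {}" by blast
  ultimately obtain Q where Q: "Q \<in> lists S"
    and max: "\<And>R. R \<in> lists S \<Longrightarrow> card (inversions R) \<le> card (inversions Q)"
    using Max_in[of "{card (inversions Q) |Q. Q \<in> lists S}"] Max_ge[of "{card (inversions Q) |Q. Q \<in> lists S}"]
    by (smt (verit, best) mem_Collect_eq)
  have "act Q (\<alpha> s) \<notin> pos_roots" if s: "s \<in> S" for s
  proof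
    assume b: "act Q (\<alpha> s) \<in> pos_roots"
    then have "- act Q (\<alpha> s) \<notin> inversions Q" "act Q (\<alpha> s) \<notin> inversions Q"
      using Q s root_cases[of "act Q (\<alpha> s)"] pos_root_root simple_pos_root
      by (auto simp: inversions_def act_rev)
    then have "card (inversions (Q @ [s])) = Suc (card (inversions Q))"
      using b s Q finite_inversions by (simp add: inversions_snoc)
    then show False using max[of "Q @ [s]"] Q s by simp
  qed
  then show ?thesis using Q inversions_full_iff by blast
qed

lemma longest_iff:
  assumes "Q \<in> lists S"
  shows "word_prod W Q = w\<^sub>0 \<longleftrightarrow> inversions Q = pos_roots"
proof -
  obtain P where P: "P \<in> lists S" "inversions P = pos_roots" using ex_inversions_full by blast
  have le: "card (inversions Q) \<le> card pos_roots" for Q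
    by (auto intro!: card_mono finite_pos_roots simp: inversions_def)
  have "w\<^sub>0 = word_prod W P" unfolding longest_element_def
  proof (rule the_equality)
    show "word_prod W P \<in> carrier W \<and> (\<forall>u\<in>carrier W. coxeter_length W S u \<le> coxeter_length W S (word_prod W P))"
      using P le ex_word coxeter_length_word by (metis word_prod_closed)
  next
    fix w assume w: "w \<in> carrier W \<and> (\<forall>u\<in>carrier W. coxeter_length W S u \<le> coxeter_length W S w)"
    then obtain R where R: "R \<in> lists S" "word_prod W R = w" using ex_word by blast
    then have "card pos_roots \<le> card (inversions R)"
      using w P coxeter_length_word by (metis word_prod_closed)
    then have "inversions R = pos_roots"
      by (intro card_subset_eq) (use le[of R] finite_pos_roots in \<open>auto simp: inversions_def\<close>)
    then show "w = word_prod W P" using R P inversions_full_unique by metis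
  qed
  then show ?thesis using P assms inversions_full_unique inversions_cong by metis
qed

lemma longest_iff_simple:
  "Q \<in> lists S \<Longrightarrow> word_prod W Q = w\<^sub>0 \<longleftrightarrow> (\<forall>s\<in>S. act Q (\<alpha> s) \<notin> pos_roots)"
  using longest_iff inversions_full_iff by metis

lemma reduced_longest_iff:
  "reduced_expression W S Q w\<^sub>0 \<longleftrightarrow> Q \<in> lists S \<and> pos_word Q \<and> length Q = card pos_roots"
proof -
  have "inversions Q = pos_roots \<longleftrightarrow> length Q = card pos_roots" if Q: "Q \<in> lists S" "pos_word Q"
  proof
    assume "length Q = card pos_roots"
    then have "card (inversions Q) = card pos_roots" using Q pos_word_iff by metis
    then show "inversions Q = pos_roots"
      by (intro card_subset_eq) (auto simp: inversions_def finite_pos_roots)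
  qed (use Q pos_word_iff in metis)
  then show ?thesis unfolding reduced_expression_iff using longest_iff by blast
qed

lemma reduced_longest_iff':
  "reduced_expression W S Q w\<^sub>0 \<longleftrightarrow> Q \<in> lists S \<and> word_prod W Q = w\<^sub>0 \<and> length Q = card pos_roots"
proof -
  have "pos_word Q \<longleftrightarrow> length Q = card pos_roots" if "Q \<in> lists S" "word_prod W Q = w\<^sub>0"
    using that pos_word_iff longest_iff by metis
  then show ?thesis unfolding reduced_expression_iff by blast
qed

lemma longest_word:
  obtains L where "L \<in> lists S" "word_prod W L = w\<^sub>0" "pos_word L"
  using ex_inversions_full ex_pos_word longest_iff inversions_cong by metis

lemma longest_carrier: "w\<^sub>0 \<in> carrier W"
  using longest_word by (metis word_prod_closed)

lemma longest_pos_root: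
  assumes "\<beta> \<in> pos_roots"
  shows "- \<rho> w\<^sub>0 \<beta> \<in> pos_roots"
proof -
  obtain L where L: "L \<in> lists S" "word_prod W L = w\<^sub>0" by (rule longest_word)
  have "act L \<beta> \<notin> pos_roots"
  proof
    assume "act L \<beta> \<in> pos_roots"
    then have "act (rev L) (act L \<beta>) \<notin> pos_roots"
      using L longest_iff unfolding inversions_def by blast
    then show False using act_rev[OF L(1)] assms by metis
  qed
  then show ?thesis using root_cases act_root pos_root_root assms L by metis
qed

lemma longest_involution: "\<rho> w\<^sub>0 (\<rho> w\<^sub>0 v) = v"
proof -
  obtain L where L: "L \<in> lists S" "word_prod W L = w\<^sub>0" by (rule longest_word)
  have "act (rev L) (\<alpha> s) \<notin> pos_roots" if "s \<in> S" for s
    using that L longest_iff simple_pos_root unfolding inversions_def by blast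
  then have "word_prod W (rev L) = w\<^sub>0" using longest_iff_simple[of "rev L"] L by simp
  then show ?thesis using act_rev[OF L(1), of v] L by metis
qed

lemma longest_inner: "\<rho> w\<^sub>0 x \<bullet> \<rho> w\<^sub>0 y = x \<bullet> y"
  by (rule longest_word) (use act_inner in metis)

lemma longest_minus: "\<rho> w\<^sub>0 (- x) = - \<rho> w\<^sub>0 x"
  by (rule longest_word) (use act_minus in metis)

lemma longest_diff: "\<rho> w\<^sub>0 (x - y) = \<rho> w\<^sub>0 x - \<rho> w\<^sub>0 y"
  by (rule longest_word) (use act_diff in metis)

section \<open>Conjugation by the longest element\<close>

lemma conj_longest_closed: "s \<in> S \<Longrightarrow> \<phi> s \<in> carrier W"
  by (simp add: conj_longest_def longest_carrier gen_carrier)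

lemma conj_longest_action: "s \<in> S \<Longrightarrow> \<rho> (\<phi> s) v = \<rho> w\<^sub>0 (\<rho> s (\<rho> w\<^sub>0 v))"
  by (simp add: conj_longest_def action_mult longest_carrier gen_carrier)

text \<open>The negative of \<open>w\<^sub>0\<close> permutes the positive roots, which reduces the
  inversions of a reduced word R of \<open>\<phi> s\<close> to those of s. So R has the single
  inversion b and is a single letter.\<close>

lemma conj_longest_simple:
  assumes s: "s \<in> S"
  shows conj_longest_gen: "\<phi> s \<in> S" and longest_simple: "\<rho> w\<^sub>0 (\<alpha> s) = - \<alpha> (\<phi> s)"
proof -
  obtain L where L: "L \<in> lists S" "word_prod W L = w\<^sub>0" by (rule longest_word)
  define b where "b = - \<rho> w\<^sub>0 (\<alpha> s)"
  have b: "b \<in> pos_roots" unfolding b_def using longest_pos_root simple_pos_root s by blast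
  obtain R where R: "R \<in> lists S" "word_prod W R = word_prod W (L @ [s] @ L)" "pos_word R"
    using ex_pos_word[of "L @ [s] @ L"] L s by auto
  have wR: "word_prod W R = \<phi> s"
    using R L s longest_carrier
    by (simp add: word_prod_append conj_longest_def gen_carrier m_assoc)
  have actR: "act (rev R) v = \<rho> w\<^sub>0 (\<rho> s (\<rho> w\<^sub>0 v))" for v
  proof -
    have "act R (\<rho> w\<^sub>0 (\<rho> s (\<rho> w\<^sub>0 v))) = v"
      using s by (simp add: wR conj_longest_action longest_involution gen_involution)
    then show ?thesis using act_rev[OF R(1)] by metis
  qed
  have "\<beta> \<in> inversions R \<longleftrightarrow> \<beta> = b" if \<beta>: "\<beta> \<in> pos_roots" for \<beta>
  proof -
    define \<gamma> where "\<gamma> = - \<rho> w\<^sub>0 \<beta>"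
    have \<gamma>: "\<gamma> \<in> pos_roots" unfolding \<gamma>_def using longest_pos_root \<beta> by blast
    have \<beta>\<gamma>: "\<beta> = - \<rho> w\<^sub>0 \<gamma>" by (simp add: \<gamma>_def longest_minus longest_involution)
    have r: "\<rho> s \<gamma> \<in> \<Phi>" using gen_root s \<gamma> pos_root_root by blast
    have e: "act (rev R) \<beta> = - \<rho> w\<^sub>0 (\<rho> s \<gamma>)"
      using s by (simp add: actR \<beta>\<gamma> longest_minus gen_minus longest_involution)
    have "\<beta> \<in> inversions R \<longleftrightarrow> - \<rho> w\<^sub>0 (\<rho> s \<gamma>) \<notin> pos_roots"
      using \<beta> by (simp add: inversions_def e)
    also have "\<dots> \<longleftrightarrow> \<rho> s \<gamma> \<notin> pos_roots"
    proof
      assume "- \<rho> w\<^sub>0 (\<rho> s \<gamma>) \<notin> pos_roots"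
      then show "\<rho> s \<gamma> \<notin> pos_roots" using longest_pos_root by blast
    next
      assume "\<rho> s \<gamma> \<notin> pos_roots"
      then have "- \<rho> w\<^sub>0 (- \<rho> s \<gamma>) \<in> pos_roots" using longest_pos_root root_cases r by blast
      then have "\<rho> w\<^sub>0 (\<rho> s \<gamma>) \<in> pos_roots" by (simp add: longest_minus)
      then show "- \<rho> w\<^sub>0 (\<rho> s \<gamma>) \<notin> pos_roots" using root_cases pos_root_root by blast
    qed
    also have "\<dots> \<longleftrightarrow> \<gamma> = \<alpha> s"
      using gen_pos_root_iff[OF s pos_root_root[OF \<gamma>]] \<gamma> root_cases[OF simple_root[OF s]] simple_pos_root[OF s]
      by auto
    also have "\<dots> \<longleftrightarrow> \<beta> = b" unfolding b_def \<beta>\<gamma>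
      by (metis longest_involution minus_minus)
    finally show ?thesis .
  qed
  then have inv: "inversions R = {b}" using b by (auto simp: inversions_def)
  then have "length R = 1" using R pos_word_iff by simp
  then obtain t where t: "R = [t]" by (metis One_nat_def length_0_conv length_Suc_conv)
  then have tS: "t \<in> S" using R by simp
  have "\<phi> s = t" using wR t tS by (simp add: gen_carrier)
  moreover have "b = \<alpha> t"
  proof -
    have "inversions [t] = {\<alpha> t}" using inversions_snoc[of "[]" t] tS simple_pos_root by simp
    then show ?thesis using inv t by simp
  qed
  ultimately show "\<phi> s \<in> S" "\<rho> w\<^sub>0 (\<alpha> s) = - \<alpha> (\<phi> s)" using tS b_def by (metis, metis minus_minus)
qed

lemma conj_longest_involution: "s \<in> S \<Longrightarrow> \<phi> (\<phi> s) = s"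
  by (intro action_inj)
    (auto simp: conj_longest_closed conj_longest_gen conj_longest_action longest_involution gen_carrier)

lemma longest_gen: "s \<in> S \<Longrightarrow> \<rho> w\<^sub>0 (\<rho> s v) = \<rho> (\<phi> s) (\<rho> w\<^sub>0 v)"
  by (simp add: conj_longest_action longest_involution)

text \<open>The negative of \<open>w\<^sub>0\<close> carries the defining equations of
  \<open>\<omega> s\<close> to those of \<open>\<omega> (\<phi> s)\<close>.\<close>

lemma longest_weight:
  assumes s: "s \<in> S"
  shows "\<rho> w\<^sub>0 (\<omega> s) = - \<omega> (\<phi> s)"
proof -
  have "\<omega> (\<phi> s) = - \<rho> w\<^sub>0 (\<omega> s)"
  proof (rule weight_unique)
    show "\<phi> s \<in> S" using s by (rule conj_longest_gen)
    fix r assume r: "r \<in> S"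
    then have r': "\<phi> r \<in> S" "\<phi> (\<phi> r) = r" by (simp_all add: conj_longest_gen conj_longest_involution)
    have "\<rho> r (- \<rho> w\<^sub>0 (\<omega> s)) = - \<rho> w\<^sub>0 (\<rho> (\<phi> r) (\<omega> s))"
      using r r' by (simp add: gen_minus longest_gen)
    also have "\<dots> = - \<rho> w\<^sub>0 (\<omega> s) - (if r = \<phi> s then \<alpha> r else 0)"
    proof (cases "r = \<phi> s")
      case True
      then have "\<phi> r = s" using s conj_longest_involution by simp
      then show ?thesis using True s by (simp add: gen_weight longest_diff longest_simple)
    next
      case False
      then have "\<phi> r \<noteq> s" using r' by auto
      then show ?thesis using False s r' by (simp add: gen_weight)
    qed
    finally show "\<rho> r (- \<rho> w\<^sub>0 (\<omega> s)) = - \<rho> w\<^sub>0 (\<omega> s) - (if r = \<phi> s then \<alpha> r else 0)" .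
  qed
  then show ?thesis by simp
qed

text \<open>The number \<open>- (\<alpha> s \<bullet> \<alpha> t)\<close> is, up to a positive
  factor, the coordinate at s of the positive root \<open>\<rho> s (\<alpha> t)\<close>.\<close>

lemma simple_inner_nonpos:
  assumes "s \<in> S" "t \<in> S" "s \<noteq> t"
  shows "\<alpha> s \<bullet> \<alpha> t \<le> 0"
proof -
  have "\<alpha> t \<noteq> \<alpha> s" using inj_simple assms by (auto simp: inj_on_def)
  then have "\<rho> s (\<alpha> t) \<in> pos_roots" using gen_pos_root assms simple_pos_root by blast
  then have "0 \<le> \<rho> s (\<alpha> t) \<bullet> \<omega> s" using pos_root_inner assms by blast
  also have "\<rho> s (\<alpha> t) \<bullet> \<omega> s = - (\<alpha> t \<bullet> \<alpha> s)"
    using assms by (simp add: gen_inner gen_weight inner_diff_right weight_inner)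
  finally show ?thesis by (simp add: inner_commute)
qed

lemma simple_inner_neg:
  assumes "s \<in> S" "t \<in> S" "s \<otimes>\<^bsub>W\<^esub> t \<noteq> t \<otimes>\<^bsub>W\<^esub> s"
  shows "\<alpha> s \<bullet> \<alpha> t < 0"
proof -
  have "\<alpha> s \<bullet> \<alpha> t \<noteq> 0"
  proof
    assume 0: "\<alpha> s \<bullet> \<alpha> t = 0"
    have "s \<otimes>\<^bsub>W\<^esub> t = t \<otimes>\<^bsub>W\<^esub> s"
      using assms 0 by (intro action_inj)
        (auto simp: gen_carrier action_mult gen_reflection reflection_def inner_diff_left inner_diff_right
          inner_commute[of "\<alpha> t" "\<alpha> s"])
    then show False using assms by blast
  qed
  moreover have "s \<noteq> t" using assms by auto
  ultimately show ?thesis using simple_inner_nonpos assms by fastforce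
qed

end

section \<open>Words of Coxeter elements\<close>

definition first_index :: "'a list \<Rightarrow> 'a \<Rightarrow> nat" where
  "first_index c s = length (takeWhile (\<lambda>x. x \<noteq> s) c)"

lemma first_index_append: "first_index (A @ B) s = (if s \<in> set A then first_index A s else length A + first_index B s)"
  by (induction A) (auto simp: first_index_def)

lemma first_index_Cons: "first_index (a # c) s = (if s = a then 0 else Suc (first_index c s))"
  by (auto simp: first_index_def)

lemma first_index_less_iff: "first_index c s < length c \<longleftrightarrow> s \<in> set c"
  by (induction c) (auto simp: first_index_Cons first_index_def)

lemma nth_first_index: "s \<in> set c \<Longrightarrow> c ! first_index c s = s"
  by (induction c) (auto simp: first_index_Cons)

lemma first_index_nth: "distinct c \<Longrightarrow> k < length c \<Longrightarrow> first_index c (c ! k) = k"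
  by (metis first_index_less_iff nth_eq_iff_index_eq nth_first_index nth_mem)

lemma first_index_eq_iff: "s \<in> set c \<Longrightarrow> t \<in> set c \<Longrightarrow> first_index c s = first_index c t \<longleftrightarrow> s = t"
  by (metis nth_first_index)

lemma first_index_split:
  assumes "distinct c" "c = A @ s # B"
  shows "first_index c t < first_index c s \<longleftrightarrow> t \<in> set A"
  using assms first_index_less_iff[of A t] by (auto simp: first_index_append first_index_Cons)

lemma first_index_rev:
  assumes "distinct c" "s \<in> set c"
  shows "first_index (rev c) s = length c - 1 - first_index c s"
proof -
  have l: "first_index c s < length c" using assms by (simp add: first_index_less_iff)
  then have "rev c ! (length c - 1 - first_index c s) = s"
    using assms by (simp add: rev_nth nth_first_index Suc_diff_Suc)
  then show ?thesis using l first_index_nth[of "rev c" "length c - 1 - first_index c s"] assms by simp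
qed

context finite_coxeter
begin

lemma act_weight_fix: "Q \<in> lists S \<Longrightarrow> s \<in> S \<Longrightarrow> s \<notin> set Q \<Longrightarrow> act Q (\<omega> s) = \<omega> s"
  by (induction Q) (auto simp: act_Cons gen_weight simp del: word_prod_Cons)

lemma weight_inner_self_pos:
  assumes "s \<in> S"
  shows "0 < \<alpha> s \<bullet> \<omega> s"
proof -
  have "\<alpha> s \<bullet> \<omega> s = (\<alpha> s \<bullet> \<alpha> s) / 2" using assms by (simp add: weight_inner)
  then show ?thesis using simple_norm_pos[OF assms] by linarith
qed

text \<open>The expansion of v has no term at p, and every other simple root has a nonpositive inner
  product with \<open>\<alpha> p\<close>.\<close>

lemma nonneg_inner_simple:
  assumes "nonneg v" "p \<in> S" "v \<bullet> \<omega> p = 0"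
  shows "v \<bullet> \<alpha> p \<le> 0"
    and "s \<in> S \<Longrightarrow> 0 < v \<bullet> \<omega> s \<Longrightarrow> \<alpha> s \<bullet> \<alpha> p < 0 \<Longrightarrow> v \<bullet> \<alpha> p < 0"
proof -
  let ?f = "\<lambda>l. 2 * (v \<bullet> \<omega> l) / (\<alpha> l \<bullet> \<alpha> l) * (\<alpha> l \<bullet> \<alpha> p)"
  have f: "?f l \<le> 0" if "l \<in> S" for l
  proof (cases "l = p")
    case False
    then have "\<alpha> l \<bullet> \<alpha> p \<le> 0" using simple_inner_nonpos that assms by blast
    then show ?thesis using assms that
      by (intro mult_nonneg_nonpos divide_nonneg_nonneg) (auto simp: nonneg_def)
  qed (simp add: assms)
  have eq: "v \<bullet> \<alpha> p = sum ?f S" by (rule inner_expansion)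
  show "v \<bullet> \<alpha> p \<le> 0" unfolding eq using f by (rule sum_nonpos)
  assume s: "s \<in> S" "0 < v \<bullet> \<omega> s" "\<alpha> s \<bullet> \<alpha> p < 0"
  have "sum ?f S = ?f s + sum ?f (S - {s})" using s finite_S by (simp add: sum.remove)
  moreover have "?f s < 0" using s simple_norm_pos[of s] by (intro mult_pos_neg divide_pos_pos) auto
  moreover have "sum ?f (S - {s}) \<le> 0" using f by (intro sum_nonpos) auto
  ultimately show "v \<bullet> \<alpha> p < 0" using eq by linarith
qed

text \<open>The reflection p changes only the coordinate at p, which is zero beforehand since no
  letter repeats. By \<open>nonneg_inner_simple\<close> it becomes nonnegative, and positive if p
  does not commute with s.\<close>

lemma act_distinct_simple:
  assumes "P \<in> lists S" "distinct P" "s \<in> S" "s \<notin> set P"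
  shows "nonneg (act P (\<alpha> s)) \<and>
    (\<forall>t\<in>S. t \<notin> set P \<longrightarrow> act P (\<alpha> s) \<bullet> \<omega> t = \<alpha> s \<bullet> \<omega> t) \<and>
    (\<forall>t\<in>set P. s \<otimes>\<^bsub>W\<^esub> t \<noteq> t \<otimes>\<^bsub>W\<^esub> s \<longrightarrow> 0 < act P (\<alpha> s) \<bullet> \<omega> t)"
  using assms
proof (induction P)
  case Nil
  then show ?case by (simp add: nonneg_simple)
next
  case (Cons p P)
  let ?x = "act P (\<alpha> s)"
  have p: "p \<in> S" "P \<in> lists S" "p \<notin> set P" "s \<noteq> p" "s \<notin> set P" using Cons by auto
  have IH: "nonneg ?x" "\<And>t. t \<in> S \<Longrightarrow> t \<notin> set P \<Longrightarrow> ?x \<bullet> \<omega> t = \<alpha> s \<bullet> \<omega> t"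
    "\<And>t. t \<in> set P \<Longrightarrow> s \<otimes>\<^bsub>W\<^esub> t \<noteq> t \<otimes>\<^bsub>W\<^esub> s \<Longrightarrow> 0 < ?x \<bullet> \<omega> t"
    using Cons p by auto
  have act: "act (p # P) (\<alpha> s) = \<rho> p ?x" using p by (simp add: act_Cons del: word_prod_Cons)
  have other: "\<rho> p ?x \<bullet> \<omega> t = ?x \<bullet> \<omega> t" if "t \<in> S" "t \<noteq> p" for t
    using that p by (simp add: gen_inner gen_weight)
  have x0: "?x \<bullet> \<omega> p = 0" using IH(2)[of p] p Cons.prems by (simp add: weight_inner)
  then have own: "\<rho> p ?x \<bullet> \<omega> p = - (?x \<bullet> \<alpha> p)"
    using p by (simp add: gen_inner gen_weight inner_diff_right)
  have xs: "0 < ?x \<bullet> \<omega> s" using IH(2)[of s] p Cons.prems weight_inner_self_pos[of s] by simp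
  have "nonneg (\<rho> p ?x)"
    unfolding nonneg_def using IH(1) other own nonneg_inner_simple(1)[OF IH(1) p(1) x0]
    by (metis neg_0_le_iff_le nonneg_def)
  moreover have "\<rho> p ?x \<bullet> \<omega> t = \<alpha> s \<bullet> \<omega> t" if "t \<in> S" "t \<notin> set (p # P)" for t
    using that other IH by simp
  moreover have "0 < \<rho> p ?x \<bullet> \<omega> t" if t: "t \<in> set (p # P)" "s \<otimes>\<^bsub>W\<^esub> t \<noteq> t \<otimes>\<^bsub>W\<^esub> s" for t
  proof (cases "t = p")
    case True
    then have "\<alpha> s \<bullet> \<alpha> p < 0" using simple_inner_neg t Cons.prems p by blast
    then have "?x \<bullet> \<alpha> p < 0" using nonneg_inner_simple(2)[OF IH(1) p(1) x0] xs Cons.prems by blast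
    then show ?thesis using own True by simp
  next
    case False
    then have "t \<in> set P" using t by simp
    moreover from this have "t \<in> S" using p(2) by (auto simp: lists_eq_set)
    ultimately show ?thesis using False other IH(3) t by simp
  qed
  ultimately show ?case unfolding act by blast
qed

section \<open>The roots inverted by a Coxeter element\<close>

definition cox_word :: "'w list \<Rightarrow> bool" where
  "cox_word c \<longleftrightarrow> distinct c \<and> set c = S"

lemma cox_word_lists: "cox_word c \<Longrightarrow> c \<in> lists S"
  by (auto simp: cox_word_def)

lemma cox_word_rev: "cox_word c \<Longrightarrow> cox_word (rev c)"
  by (auto simp: cox_word_def)

lemma cox_word_rotate1: "cox_word c \<Longrightarrow> cox_word (rotate1 c)"
  by (auto simp: cox_word_def)

lemma cox_word_split:
  assumes "cox_word c" "s \<in> S"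
  obtains A B where "c = A @ s # B" "A \<in> lists S" "B \<in> lists S" "s \<notin> set A" "s \<notin> set B"
    "distinct A" "distinct (B @ A)"
proof -
  obtain A B where "c = A @ s # B" using assms split_list[of s c] by (auto simp: cox_word_def)
  then show ?thesis using assms that[of A B] by (auto simp: cox_word_def lists_eq_set)
qed

text \<open>By \<open>cox_root_split\<close> this is the root met at the letter s of c, so these
  vectors are exactly the inversions of c. The form as a difference of weights is the one that
  iterates well under c.\<close>

definition cox_root :: "'w list \<Rightarrow> 'w \<Rightarrow> 'v" where
  "cox_root c s = \<omega> s - act c (\<omega> s)"

lemma act_weight_last:
  assumes "A \<in> lists S" "B \<in> lists S" "s \<in> S" "s \<notin> set A" "s \<notin> set B"
  shows "act (A @ s # B) (\<omega> s) = \<omega> s - act A (\<alpha> s)"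
  using assms by (simp add: act_append act_Cons act_weight_fix gen_weight act_diff del: word_prod_Cons)

lemma cox_root_split:
  assumes "c = A @ s # B" "A \<in> lists S" "B \<in> lists S" "s \<in> S" "s \<notin> set A" "s \<notin> set B"
  shows "cox_root c s = act A (\<alpha> s)"
  using act_weight_last[OF assms(2-)] by (simp add: cox_root_def assms(1))

lemma cox_root_pos:
  assumes "cox_word c" "s \<in> S"
  shows "cox_root c s \<in> pos_roots"
proof (rule cox_word_split[OF assms])
  fix A B assume s: "c = A @ s # B" "A \<in> lists S" "B \<in> lists S" "s \<notin> set A" "s \<notin> set B" "distinct A"
  then show ?thesis
    using act_distinct_simple[of A s] act_simple_root assms by (simp add: cox_root_split pos_roots_def)
qed

lemma cox_root_inner_self:
  assumes "cox_word c" "s \<in> S"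
  shows "0 < cox_root c s \<bullet> \<omega> s"
proof (rule cox_word_split[OF assms])
  fix A B assume s: "c = A @ s # B" "A \<in> lists S" "B \<in> lists S" "s \<notin> set A" "s \<notin> set B" "distinct A"
  then show ?thesis
    using act_distinct_simple[of A s] assms simple_norm_pos by (simp add: cox_root_split weight_inner)
qed

lemma cox_root_inner_before:
  assumes "cox_word c" "s \<in> S" "t \<in> S" "s \<otimes>\<^bsub>W\<^esub> t \<noteq> t \<otimes>\<^bsub>W\<^esub> s" "first_index c t < first_index c s"
  shows "0 < cox_root c s \<bullet> \<omega> t"
proof (rule cox_word_split[OF assms(1,2)])
  fix A B assume s: "c = A @ s # B" "A \<in> lists S" "B \<in> lists S" "s \<notin> set A" "s \<notin> set B" "distinct A"
  moreover have "t \<in> set A" using first_index_split[of c] s assms by (auto simp: cox_word_def)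
  ultimately show ?thesis
    using act_distinct_simple[of A s] assms by (simp add: cox_root_split)
qed

lemma cox_root_inner_after:
  assumes "cox_word c" "s \<in> S" "t \<in> S" "first_index c s < first_index c t"
  shows "cox_root c s \<bullet> \<omega> t = 0"
proof (rule cox_word_split[OF assms(1,2)])
  fix A B assume s: "c = A @ s # B" "A \<in> lists S" "B \<in> lists S" "s \<notin> set A" "s \<notin> set B" "distinct A"
  moreover have "t \<notin> set A" using first_index_split[of c A s B t] s assms by (auto simp: cox_word_def)
  moreover have "s \<noteq> t" using assms by auto
  ultimately show ?thesis
    using act_distinct_simple[of A s] assms by (simp add: cox_root_split weight_inner)
qed

text \<open>With c = A s B the vector is A s applied to the image of \<open>\<alpha> s\<close> under
  B A. The letters of A s leave the coordinate at t unchanged, and t occurs in B.\<close>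

lemma cox_root_inner_next:
  assumes "cox_word c" "s \<in> S" "t \<in> S" "s \<otimes>\<^bsub>W\<^esub> t \<noteq> t \<otimes>\<^bsub>W\<^esub> s" "first_index c s < first_index c t"
  shows "0 < act c (cox_root c s) \<bullet> \<omega> t"
proof (rule cox_word_split[OF assms(1,2)])
  fix A B assume s: "c = A @ s # B" "A \<in> lists S" "B \<in> lists S" "s \<notin> set A" "s \<notin> set B" "distinct (B @ A)"
  have "s \<noteq> t" "t \<notin> set A" using first_index_split[of c A s B t] s assms by (auto simp: cox_word_def)
  then have tB: "t \<in> set B" using s assms by (auto simp: cox_word_def)
  have "act c (cox_root c s) = act (A @ [s]) (act (B @ A) (\<alpha> s))"
    using s assms by (simp add: cox_root_split act_append act_Cons act_single del: word_prod_Cons)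
  moreover have "act (rev (A @ [s])) (\<omega> t) = \<omega> t"
    using s assms \<open>s \<noteq> t\<close> \<open>t \<notin> set A\<close> by (intro act_weight_fix) auto
  ultimately have "act c (cox_root c s) \<bullet> \<omega> t = act (B @ A) (\<alpha> s) \<bullet> \<omega> t"
    using s assms act_inner_left[of "A @ [s]"] by simp
  moreover have "0 < act (B @ A) (\<alpha> s) \<bullet> \<omega> t"
    using act_distinct_simple[of "B @ A" s] s assms tB by simp
  ultimately show ?thesis by simp
qed

lemma cox_word_pos_word:
  assumes "Q \<in> lists S" "distinct Q"
  shows "pos_word Q"
  unfolding pos_word_def
proof (intro allI impI)
  fix k assume k: "k < length Q"
  have "take k Q \<in> lists S" using assms by (auto dest: in_set_takeD)
  moreover have "Q ! k \<in> S" using assms k by (auto simp: in_lists_conv_set)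
  moreover have "Q ! k \<notin> set (take k Q)"
    using assms k by (auto simp: in_set_conv_nth nth_eq_iff_index_eq)
  ultimately show "act (take k Q) (\<alpha> (Q ! k)) \<in> pos_roots"
    using act_distinct_simple[of "take k Q" "Q ! k"] act_simple_root assms by (simp add: pos_roots_def)
qed

lemma inversions_cox_word:
  assumes "cox_word c"
  shows "inversions c = cox_root c ` S"
proof -
  have c: "c \<in> lists S" "distinct c" "set c = S" using assms by (auto simp: cox_word_def)
  have "inversions c = (\<lambda>k. act (take k c) (\<alpha> (c ! k))) ` {..<length c}"
    using pos_word_inversions[OF c(1) cox_word_pos_word[OF c(1,2)]] by blast
  also have "\<dots> = (\<lambda>k. cox_root c (c ! k)) ` {..<length c}"
  proof (rule image_cong)
    fix k assume "k \<in> {..<length c}"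
    then have k: "k < length c" by simp
    show "act (take k c) (\<alpha> (c ! k)) = cox_root c (c ! k)"
    proof (rule cox_root_split[symmetric])
      show "c = take k c @ c ! k # drop (Suc k) c" using k by (rule id_take_nth_drop)
      then have "distinct (take k c @ c ! k # drop (Suc k) c)" using c by simp
      then show "c ! k \<notin> set (take k c)" "c ! k \<notin> set (drop (Suc k) c)" by auto
      show "take k c \<in> lists S" "drop (Suc k) c \<in> lists S" "c ! k \<in> S"
        using c k by (auto dest: in_set_takeD in_set_dropD)
    qed
  qed simp
  also have "\<dots> = cox_root c ` S"
    using c by (auto simp: set_conv_nth image_iff)
  finally show ?thesis .
qed

text \<open>A fixed vector x is orthogonal to every \<open>cox_root c s\<close>. Reading c from the
  left, the letters before s are already known to fix x, so this root can be replaced by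
  \<open>\<alpha> s\<close>; finally x is orthogonal to all simple roots.\<close>

lemma cox_fixed_zero:
  assumes "cox_word c" "act c x = x"
  shows "x = 0"
proof -
  have c: "c \<in> lists S" using assms cox_word_lists by blast
  have "\<forall>t\<in>set A. x \<bullet> \<alpha> t = 0" if "\<exists>B. c = A @ B" for A
    using that
  proof (induction A rule: rev_induct)
    case (snoc s A)
    then obtain B where cs: "c = A @ s # B" by auto
    then have mem: "A \<in> lists S" "B \<in> lists S" "s \<in> S" "s \<notin> set A" "s \<notin> set B"
      using c assms(1) by (auto simp: cox_word_def)
    have A: "\<forall>t\<in>set A. x \<bullet> \<alpha> t = 0" using snoc.IH cs by blast
    have "act Q x = x" if "Q \<in> lists S" "set Q \<subseteq> set A" for Q
      using that
    proof (induction Q)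
      case (Cons q Q)
      then show ?case using A gen_fix_iff[of q x 0] by (auto simp: act_Cons simp del: word_prod_Cons)
    qed simp
    then have "act (rev A) x = x" using mem by simp
    moreover have "x \<bullet> cox_root c s = 0"
      using act_inner[OF c, of x "\<omega> s"] assms(2) by (simp add: cox_root_def inner_diff_right)
    ultimately have "x \<bullet> \<alpha> s = 0"
      using mem act_inner_left[of A "\<alpha> s" x] by (simp add: cox_root_split[OF cs] inner_commute)
    then show ?case using A by simp
  qed simp
  then have "\<forall>t\<in>set c. x \<bullet> \<alpha> t = 0" by auto
  then show ?thesis using assms(1) by (intro inner_simple_eqI) (auto simp: cox_word_def)
qed

lemma cox_root_inj:
  assumes "cox_word c" "x - act c x = y - act c y"
  shows "x = y"
proof -
  have "act c (x - y) = x - y" using assms cox_word_lists by (simp add: act_diff algebra_simps)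
  then show ?thesis using cox_fixed_zero assms by fastforce
qed

lemma weight_inj: "s \<in> S \<Longrightarrow> t \<in> S \<Longrightarrow> \<omega> s = \<omega> t \<Longrightarrow> s = t"
  using weight_inner[of s s] weight_inner[of t s] simple_norm_pos[of s] by (auto split: if_splits)

text \<open>If a letter s were missing from c, then c would fix \<open>\<omega> s\<close> and the
  root \<open>cox_root Q s\<close> would be zero. So all letters occur, and the length leaves room
  for one occurrence of each.\<close>

lemma reduced_coxeter_word:
  assumes "coxeter_element W S w" "reduced_expression W S c w"
  shows "cox_word c"
proof -
  obtain Q where Q: "distinct Q" "set Q = S" "word_prod W Q = w"
    using assms(1) by (auto simp: coxeter_element_def)
  then have cQ: "cox_word Q" by (simp add: cox_word_def)
  have c: "c \<in> lists S" "word_prod W c = w" "pos_word c" using assms(2) by (auto simp: reduced_expression_iff)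
  have "pos_word Q" using cox_word_pos_word cox_word_lists cQ Q by blast
  then have len: "length c = length Q"
    using c cQ cox_word_lists pos_word_iff inversions_cong Q by metis
  have "S \<subseteq> set c"
  proof
    fix s assume s: "s \<in> S"
    show "s \<in> set c"
    proof (rule ccontr)
      assume "s \<notin> set c"
      then have "act c (\<omega> s) = \<omega> s" using act_weight_fix c s by blast
      then have "cox_root Q s = 0" using c Q by (simp add: cox_root_def)
      then show False using cox_root_pos[OF cQ s] root_nonzero pos_root_root by blast
    qed
  qed
  then have "set c = S" using c by auto
  moreover have "card (set c) = length c" using calculation Q len distinct_card by metis
  ultimately show ?thesis using card_distinct by (auto simp: cox_word_def)
qed

end

section \<open>Powers of a Coxeter element\<close>

context finite_coxeter
begin

definition word_power :: "'w list \<Rightarrow> nat \<Rightarrow> 'w list" where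
  "word_power c k = concat (replicate k c)"

lemma word_power_0 [simp]: "word_power c 0 = []"
  by (simp add: word_power_def)

lemma word_power_Suc: "word_power c (Suc k) = c @ word_power c k"
  by (simp add: word_power_def)

lemma word_power_lists [simp]: "c \<in> lists S \<Longrightarrow> word_power c k \<in> lists S"
  by (induction k) (auto simp: word_power_Suc)

lemma act_word_power_Suc: "c \<in> lists S \<Longrightarrow> act (word_power c (Suc k)) v = act c (act (word_power c k) v)"
  by (simp add: word_power_Suc act_append)

lemma act_word_power_Suc': "c \<in> lists S \<Longrightarrow> act (word_power c (Suc k)) v = act (word_power c k) (act c v)"
  by (induction k) (simp_all add: act_word_power_Suc del: word_prod_Cons)

lemma act_word_power_add: "c \<in> lists S \<Longrightarrow> act (word_power c (k + l)) v = act (word_power c k) (act (word_power c l) v)"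
  by (induction k) (simp_all add: act_word_power_Suc)

definition wt :: "'w list \<Rightarrow> nat \<Rightarrow> 'w \<Rightarrow> 'v" where
  "wt c k s = act (word_power c k) (\<omega> s)"

definition rt :: "'w list \<Rightarrow> nat \<Rightarrow> 'w \<Rightarrow> 'v" where
  "rt c k s = act (word_power c k) (cox_root c s)"

lemma wt_0 [simp]: "wt c 0 s = \<omega> s"
  by (simp add: wt_def)

lemma rt_0 [simp]: "rt c 0 s = cox_root c s"
  by (simp add: rt_def)

lemma wt_Suc: "c \<in> lists S \<Longrightarrow> wt c (Suc k) s = act c (wt c k s)"
  by (simp add: wt_def act_word_power_Suc)

lemma rt_Suc: "c \<in> lists S \<Longrightarrow> rt c (Suc k) s = act c (rt c k s)"
  by (simp add: rt_def act_word_power_Suc)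

lemma rt_wt: "c \<in> lists S \<Longrightarrow> rt c k s = wt c k s - wt c (Suc k) s"
  by (simp add: wt_def rt_def cox_root_def act_diff act_word_power_Suc')

lemma rt_root: "cox_word c \<Longrightarrow> s \<in> S \<Longrightarrow> rt c k s \<in> \<Phi>"
  by (simp add: rt_def act_root cox_root_pos pos_root_root cox_word_lists)

lemma ex_order: "c \<in> lists S \<Longrightarrow> \<exists>h>0. \<forall>v. act (word_power c h) v = v"
proof -
  assume c: "c \<in> lists S"
  have eq: "word_prod W (word_power c k) = word_prod W c [^]\<^bsub>W\<^esub> k" for k
  proof (induction k)
    case (Suc k)
    then show ?case using c nat_pow_Suc2[of "word_prod W c" k] by (simp add: word_power_Suc word_prod_append)
  qed simp
  have "0 < Coset.order W" using finite_carrier by (simp add: order_gt_0_iff_finite)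
  moreover have "act (word_power c (Coset.order W)) v = v" for v
    using c by (simp add: eq pow_order_eq_1)
  ultimately show ?thesis by blast
qed

lemma orbit_sum_zero:
  assumes "cox_word c" "\<And>v. act (word_power c h) v = v"
  shows "(\<Sum>k<h. act (word_power c k) x) = 0"
proof (rule cox_fixed_zero[OF assms(1)])
  have c: "c \<in> lists S" using assms cox_word_lists by blast
  have "act c (\<Sum>k<h. act (word_power c k) x) + x = (\<Sum>k<Suc h. act (word_power c k) x)"
    unfolding sum.lessThan_Suc_shift using c by (simp add: act_sum act_word_power_Suc)
  also have "\<dots> = (\<Sum>k<h. act (word_power c k) x) + x" by (simp add: assms(2))
  finally show "act c (\<Sum>k<h. act (word_power c k) x) = (\<Sum>k<h. act (word_power c k) x)" by simp
qed

text \<open>Otherwise the coordinates at s along the orbit would be nonnegative with a positive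
  first one, whereas the sum over the orbit is fixed by c and vanishes.\<close>

lemma ex_rt_neg:
  assumes "cox_word c" "s \<in> S"
  shows "\<exists>k. rt c k s \<notin> pos_roots"
proof (rule ccontr)
  assume "\<not> ?thesis"
  then have pos: "rt c k s \<in> pos_roots" for k by blast
  obtain h where h: "h > 0" "\<And>v. act (word_power c h) v = v" using ex_order cox_word_lists assms by blast
  have "0 = (\<Sum>k<h. rt c k s) \<bullet> \<omega> s" unfolding rt_def using orbit_sum_zero[OF assms(1) h(2)] by simp
  also have "\<dots> = (\<Sum>k<h. rt c k s \<bullet> \<omega> s)" by (simp add: inner_sum_left)
  also have "\<dots> > 0"
    using h(1) pos pos_root_inner assms cox_root_inner_self[OF assms]
    by (intro sum_pos2[of _ 0]) auto
  finally show False by simp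
qed

definition height :: "'w list \<Rightarrow> 'w \<Rightarrow> nat" where
  "height c s = (LEAST k. rt c k s \<notin> pos_roots)"

lemma rt_height: "cox_word c \<Longrightarrow> s \<in> S \<Longrightarrow> rt c (height c s) s \<notin> pos_roots"
  unfolding height_def using ex_rt_neg by (rule LeastI_ex)

lemma rt_less_height: "k < height c s \<Longrightarrow> rt c k s \<in> pos_roots"
  unfolding height_def using not_less_Least by blast

lemma height_pos: "cox_word c \<Longrightarrow> s \<in> S \<Longrightarrow> 0 < height c s"
  using rt_height[of c s] cox_root_pos by (metis gr0I rt_0)

lemma height_eqI:
  assumes "cox_word c" "s \<in> S" "\<And>k. k < h \<Longrightarrow> rt c k s \<in> pos_roots" "rt c h s \<notin> pos_roots"
  shows "height c s = h"
  unfolding height_def using assms by (intro Least_equality) (auto simp: not_less[symmetric])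

text \<open>At the height h the negative of \<open>rt c h s\<close> is positive and the inverse of c
  makes it negative, so it is an inversion of c, that is, some \<open>cox_root c t\<close>.
  Injectivity of 1 - c passes from these roots to the weights. That t is \<open>\<phi> s\<close>
  follows only in \<open>wt_height_conj\<close>.\<close>

lemma wt_height:
  assumes "cox_word c" "s \<in> S"
  shows "\<exists>t\<in>S. wt c (height c s) s = - \<omega> t"
proof -
  have c: "c \<in> lists S" using assms cox_word_lists by blast
  define h where "h = height c s"
  have h: "0 < h" "rt c h s \<notin> pos_roots" "rt c (h - 1) s \<in> pos_roots"
    using assms height_pos rt_height rt_less_height by (auto simp: h_def)
  then have "rt c h s = act c (rt c (h - 1) s)" using rt_Suc[OF c, of "h - 1"] by simp
  then have "act (rev c) (- rt c h s) = - rt c (h - 1) s" using c by (simp add: act_minus act_rev)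
  moreover have "- rt c h s \<in> pos_roots" using h rt_root assms root_cases by blast
  moreover have "- rt c (h - 1) s \<notin> pos_roots" using h root_cases pos_root_root by blast
  ultimately have "- rt c h s \<in> inversions c" by (simp add: inversions_def)
  then obtain t where t: "t \<in> S" "- rt c h s = cox_root c t" using inversions_cox_word assms by auto
  then have "- (wt c h s - act c (wt c h s)) = \<omega> t - act c (\<omega> t)"
    using c by (simp add: rt_wt wt_Suc cox_root_def)
  then have "- wt c h s - act c (- wt c h s) = \<omega> t - act c (\<omega> t)"
    using c by (simp add: act_minus)
  then have "- wt c h s = \<omega> t" by (rule cox_root_inj[OF assms(1)])
  then show ?thesis using t by (metis h_def minus_minus)
qed

lemma rt_wt_inner:
  "c \<in> lists S \<Longrightarrow> rt c (l + k) s \<bullet> wt c k t = rt c l s \<bullet> \<omega> t"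
  using act_word_power_add[of c k l] by (simp add: rt_def wt_def act_inner add.commute)

text \<open>The inner product of \<open>c\<^sup>k \<beta>\<^sub>t\<close> and \<open>c\<^sup>k \<omega>\<^sub>s\<close> does not depend on k; it is positive, while for k equal to the
  height of s the weight is minus a fundamental weight, so that the root cannot be positive.\<close>

lemma height_interlace:
  assumes c: "cox_word c" and s: "s \<in> S" and t: "t \<in> S" and nc: "s \<otimes>\<^bsub>W\<^esub> t \<noteq> t \<otimes>\<^bsub>W\<^esub> s"
    and bef: "first_index c s < first_index c t"
  shows "height c t \<le> height c s" "height c s \<le> Suc (height c t)"
proof -
  have cl: "c \<in> lists S" using c cox_word_lists by blast
  show "height c t \<le> height c s"
  proof (rule ccontr)
    assume "\<not> ?thesis"
    then have "rt c (height c s) t \<in> pos_roots" using rt_less_height by simp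
    moreover obtain u where u: "u \<in> S" "wt c (height c s) s = - \<omega> u" using wt_height c s by blast
    ultimately have "rt c (height c s) t \<bullet> wt c (height c s) s \<le> 0" using pos_root_inner by simp
    then have "cox_root c t \<bullet> \<omega> s \<le> 0" using rt_wt_inner[OF cl, of 0] by simp
    then show False using cox_root_inner_before[OF c t s] nc bef by (metis not_less)
  qed
  show "height c s \<le> Suc (height c t)"
  proof (rule ccontr)
    assume "\<not> ?thesis"
    then have "rt c (1 + height c t) s \<in> pos_roots" using rt_less_height by simp
    moreover obtain u where u: "u \<in> S" "wt c (height c t) t = - \<omega> u" using wt_height c t by blast
    ultimately have "rt c (1 + height c t) s \<bullet> wt c (height c t) t \<le> 0" using pos_root_inner by fastforce
    then have "act c (cox_root c s) \<bullet> \<omega> t \<le> 0"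
      using rt_wt_inner[OF cl, of 1 "height c t" s t] rt_Suc[OF cl, of 0 s] by simp
    then show False using cox_root_inner_next[OF c s t nc bef] by simp
  qed
qed

section \<open>The root met after a prefix of a power of c\<close>

lemma simple_expansion:
  assumes s: "s \<in> S"
  shows "\<alpha> s = (\<Sum>t\<in>S. (2 * (\<alpha> s \<bullet> \<alpha> t) / (\<alpha> t \<bullet> \<alpha> t)) *\<^sub>R \<omega> t)"
proof (rule inner_simple_eqI)
  fix r assume r: "r \<in> S"
  have "(\<Sum>t\<in>S. (2 * (\<alpha> s \<bullet> \<alpha> t) / (\<alpha> t \<bullet> \<alpha> t)) *\<^sub>R \<omega> t) \<bullet> \<alpha> r
    = (\<Sum>t\<in>S. if t = r then \<alpha> s \<bullet> \<alpha> r else 0)"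
    unfolding inner_sum_left
  proof (rule sum.cong)
    fix t assume "t \<in> S"
    then show "(2 * (\<alpha> s \<bullet> \<alpha> t) / (\<alpha> t \<bullet> \<alpha> t)) *\<^sub>R \<omega> t \<bullet> \<alpha> r = (if t = r then \<alpha> s \<bullet> \<alpha> r else 0)"
      using r weight_inner[of t r] simple_nonzero by (auto simp: inner_commute)
  qed simp
  then show "\<alpha> s \<bullet> \<alpha> r = (\<Sum>t\<in>S. (2 * (\<alpha> s \<bullet> \<alpha> t) / (\<alpha> t \<bullet> \<alpha> t)) *\<^sub>R \<omega> t) \<bullet> \<alpha> r"
    using r finite_S by simp
qed

lemma act_simple_expansion:
  assumes "Q \<in> lists S" "s \<in> S"
  shows "act Q (\<alpha> s) = (\<Sum>t\<in>S. (2 * (\<alpha> s \<bullet> \<alpha> t) / (\<alpha> t \<bullet> \<alpha> t)) *\<^sub>R act Q (\<omega> t))"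
  using arg_cong[OF simple_expansion[OF assms(2)], of "act Q"] assms(1) by (simp add: act_sum act_scale)

lemma cartan_nonzero:
  assumes "s \<in> S" "t \<in> S" "\<alpha> s \<bullet> \<alpha> t \<noteq> 0" "s \<noteq> t"
  shows "s \<otimes>\<^bsub>W\<^esub> t \<noteq> t \<otimes>\<^bsub>W\<^esub> s"
proof
  assume com: "s \<otimes>\<^bsub>W\<^esub> t = t \<otimes>\<^bsub>W\<^esub> s"
  have "\<rho> s (\<rho> t (\<omega> t)) = \<rho> t (\<rho> s (\<omega> t))"
    using com assms gen_carrier by (metis action_mult)
  then have "\<rho> s (\<omega> t - \<alpha> t) = \<omega> t - \<alpha> t" using assms by (simp add: gen_weight)
  then have "\<omega> t - \<rho> s (\<alpha> t) = \<omega> t - \<alpha> t" using assms by (simp add: gen_diff gen_weight)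
  then have "\<rho> s (\<alpha> t) = \<alpha> t" by simp
  then show False using gen_fix_iff[of s "\<alpha> t" 0] assms by (simp add: inner_commute)
qed

text \<open>Expanding \<open>\<alpha> s\<close> in fundamental weights reduces the root of the next letter of a prefix
  of \<open>ccc\<dots>\<close> to the weights of the neighbours of that letter.\<close>

lemma mesh:
  assumes c: "cox_word c" and s: "s \<in> S" and u: "u \<in> lists S"
    and us: "act u (\<omega> s) = wt c k s"
    and ut: "\<And>t. t \<in> S \<Longrightarrow> s \<otimes>\<^bsub>W\<^esub> t \<noteq> t \<otimes>\<^bsub>W\<^esub> s \<Longrightarrow>
      act u (\<omega> t) = wt c (if first_index c t < first_index c s then Suc k else k) t"
  shows "act u (\<alpha> s) = rt c k s"
proof (rule cox_word_split[OF c s])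
  fix A B assume AB: "c = A @ s # B" "A \<in> lists S" "B \<in> lists S" "s \<notin> set A" "s \<notin> set B" "distinct A"
  have cl: "c \<in> lists S" using c cox_word_lists by blast
  \<comment> \<open>On s and its neighbours, u acts like k copies of c followed by the part A of c
    before s; no other fundamental weights occur in the expansion of
    \<open>\<alpha> s\<close>.\<close>
  have *: "act u (\<omega> t) = act (word_power c k @ A) (\<omega> t)" if t: "t \<in> S" "\<alpha> s \<bullet> \<alpha> t \<noteq> 0" for t
  proof (cases "t \<in> set A")
    case True
    then have "first_index c t < first_index c s" using first_index_split AB c by (metis cox_word_def)
    moreover have "s \<noteq> t" using True AB by auto
    ultimately have "act u (\<omega> t) = wt c (Suc k) t" using ut cartan_nonzero t s by simp
    also have "\<dots> = act (word_power c k) (act c (\<omega> t))" using cl by (simp add: wt_def act_word_power_Suc')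
    also have "act c (\<omega> t) = act A (act (s # B) (\<omega> t))"
      unfolding AB(1) by (rule act_append) (use AB s in auto)
    also have "act (s # B) (\<omega> t) = \<omega> t"
      using AB True t s c by (intro act_weight_fix) (auto simp: cox_word_def)
    finally show ?thesis using cl AB by (simp add: act_append)
  next
    case False
    then have "\<not> first_index c t < first_index c s" using first_index_split AB c by (metis cox_word_def)
    then have "act u (\<omega> t) = wt c k t" using ut us cartan_nonzero t s by (cases "s = t") auto
    then show ?thesis using False t AB cl by (simp add: wt_def act_append act_weight_fix)
  qed
  have "act u (\<alpha> s) = (\<Sum>t\<in>S. (2 * (\<alpha> s \<bullet> \<alpha> t) / (\<alpha> t \<bullet> \<alpha> t)) *\<^sub>R act u (\<omega> t))"
    using u s by (rule act_simple_expansion)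
  also have "\<dots> = (\<Sum>t\<in>S. (2 * (\<alpha> s \<bullet> \<alpha> t) / (\<alpha> t \<bullet> \<alpha> t)) *\<^sub>R act (word_power c k @ A) (\<omega> t))"
    using * by (intro sum.cong) auto
  also have "\<dots> = act (word_power c k @ A) (\<alpha> s)"
    using act_simple_expansion[of "word_power c k @ A" s] cl AB s by simp
  also have "\<dots> = rt c k s"
    using AB s cl by (simp add: rt_def cox_root_split act_append)
  finally show ?thesis .
qed

end

section \<open>Sorting words\<close>

lemma ex_first_difference:
  assumes "length x = length y" "x \<noteq> y"
  shows "\<exists>i<length x. take i x = take i y \<and> x ! i \<noteq> y ! i"
proof -
  let ?P = "\<lambda>i. i < length x \<and> x ! i \<noteq> y ! i"
  have "\<exists>i. ?P i" using assms by (meson nth_equalityI)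
  then have L: "?P (LEAST i. ?P i)" by (rule LeastI_ex)
  have "take (LEAST i. ?P i) x = take (LEAST i. ?P i) y"
  proof (rule nth_equalityI)
    show "length (take (LEAST i. ?P i) x) = length (take (LEAST i. ?P i) y)" using assms by simp
    fix j assume "j < length (take (LEAST i. ?P i) x)"
    then have j: "j < (LEAST i. ?P i)" "j < length x" by auto
    then have "x ! j = y ! j" using not_less_Least[of j ?P] by auto
    then show "take (LEAST i. ?P i) x ! j = take (LEAST i. ?P i) y ! j" using j by simp
  qed
  then show ?thesis using L by blast
qed

text \<open>\<open>i div length c\<close> numbers the copy of c that contains position i, so a
  letter s is picked from its first \<open>g s\<close> copies.\<close>

definition sorting_positions :: "'w list \<Rightarrow> ('w \<Rightarrow> nat) \<Rightarrow> nat \<Rightarrow> nat list" where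
  "sorting_positions c g p = filter (\<lambda>i. i div length c < g (c ! (i mod length c))) [0..<p]"

definition sorting_prefix :: "'w list \<Rightarrow> ('w \<Rightarrow> nat) \<Rightarrow> nat \<Rightarrow> 'w list" where
  "sorting_prefix c g p = subword_power c (sorting_positions c g p)"

definition occurrences :: "'w list \<Rightarrow> nat \<Rightarrow> 'w \<Rightarrow> nat" where
  "occurrences c p s = p div length c + (if first_index c s < p mod length c then 1 else 0)"

lemma occurrences_Suc:
  assumes "distinct c" "s \<in> set c"
  shows "occurrences c (Suc p) s = occurrences c p s + (if s = c ! (p mod length c) then 1 else 0)"
proof -
  define n r where "n = length c" and "r = p mod n"
  have "0 < n" using assms by (auto simp: n_def intro: length_pos_if_in_set)
  then have n: "0 < n" "first_index c s < n" "r < n"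
    using assms by (simp_all add: n_def r_def first_index_less_iff)
  have eq: "s = c ! r \<longleftrightarrow> first_index c s = r"
    using assms n by (metis first_index_nth n_def nth_first_index)
  show ?thesis
    using n unfolding occurrences_def n_def[symmetric] r_def[symmetric] eq
    by (auto simp: div_Suc mod_Suc r_def[symmetric])
qed

lemma sorting_prefix_0 [simp]: "sorting_prefix c g 0 = []"
  by (simp add: sorting_prefix_def sorting_positions_def subword_power_def)

lemma sorting_prefix_Suc:
  "sorting_prefix c g (Suc p) = sorting_prefix c g p @
    (if p div length c < g (c ! (p mod length c)) then [c ! (p mod length c)] else [])"
  by (simp add: sorting_prefix_def sorting_positions_def subword_power_def)

context finite_coxeter
begin

text \<open>Letter counts of prefixes of the periodic word have this shape, and so do the heights by
  \<open>height_interlace\<close>; hence it survives when every letter is cut off at its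
  height.\<close>

definition interlaced :: "'w list \<Rightarrow> ('w \<Rightarrow> nat) \<Rightarrow> bool" where
  "interlaced c g \<longleftrightarrow> (\<forall>s\<in>S. \<forall>t\<in>S. s \<otimes>\<^bsub>W\<^esub> t \<noteq> t \<otimes>\<^bsub>W\<^esub> s \<longrightarrow>
     first_index c s < first_index c t \<longrightarrow> g t \<le> g s \<and> g s \<le> Suc (g t))"

text \<open>In an alternating word two noncommuting letters occur alternately, starting with the one
  that comes first in c.\<close>

definition alternating :: "'w list \<Rightarrow> 'w list \<Rightarrow> bool" where
  "alternating c u \<longleftrightarrow> (\<forall>k. interlaced c (count_list (take k u)))"

lemma alternating_snoc: "alternating c (u @ [x]) \<longleftrightarrow> alternating c u \<and> interlaced c (count_list (u @ [x]))"
proof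
  assume a: "alternating c (u @ [x])"
  have "interlaced c (count_list (take k u))" for k
  proof (cases "k \<le> length u")
    case True
    then show ?thesis using a unfolding alternating_def by (metis append_Nil2 diff_is_0_eq take_0 take_append)
  next
    case False
    then have "take k u = take (length u) (u @ [x])" by simp
    then show ?thesis using a unfolding alternating_def by metis
  qed
  moreover have "interlaced c (count_list (u @ [x]))"
    using a unfolding alternating_def by (metis take_all order_refl)
  ultimately show "alternating c u \<and> interlaced c (count_list (u @ [x]))" unfolding alternating_def by blast
next
  assume a: "alternating c u \<and> interlaced c (count_list (u @ [x]))"
  have "interlaced c (count_list (take k (u @ [x])))" for k
  proof (cases "k \<le> length u")
    case True
    then show ?thesis using a unfolding alternating_def by simp
  next
    case False
    then have "take k (u @ [x]) = u @ [x]" by simp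
    then show ?thesis using a by metis
  qed
  then show "alternating c (u @ [x])" unfolding alternating_def by blast
qed

lemma alternating_Nil [simp]: "alternating c []"
  by (simp add: alternating_def interlaced_def)

lemma interlaced_height: "cox_word c \<Longrightarrow> interlaced c (height c)"
  unfolding interlaced_def using height_interlace by blast

lemma act_simple_not_pos:
  assumes "u \<in> lists S" "s \<in> S" "t \<in> S" "act u (\<omega> s) = - \<omega> t"
  shows "act u (\<alpha> s) \<notin> pos_roots"
proof
  assume "act u (\<alpha> s) \<in> pos_roots"
  then have "0 \<le> act u (\<alpha> s) \<bullet> - act u (\<omega> s)" using pos_root_inner[of _ t] assms by simp
  moreover have "act u (\<alpha> s) \<bullet> act u (\<omega> s) = \<alpha> s \<bullet> \<omega> s" using act_inner assms by blast
  ultimately show False using weight_inner_self_pos[OF assms(2)] by simp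
qed

text \<open>While s is still in use, interlacing makes the cut-off at the heights invisible for its
  neighbours, and \<open>mesh\<close> computes the next root. Once s is exhausted, its weight is the
  negative of a fundamental weight and the next root cannot be positive.\<close>

lemma sorting_prefix_step:
  assumes c: "cox_word c" "c \<noteq> []" and s: "s = c ! (p mod length c)"
    and u: "u \<in> lists S" "\<And>t. t \<in> S \<Longrightarrow> act u (\<omega> t) = wt c (min (height c t) (occurrences c p t)) t"
  shows "act u (\<alpha> s) \<in> pos_roots \<longleftrightarrow> p div length c < height c s"
    and "p div length c < height c s \<Longrightarrow> act u (\<alpha> s) = rt c (p div length c) s"
proof -
  define k where "k = p div length c"
  have len: "p mod length c < length c" using c by simp
  then have sS: "s \<in> S" using c s by (metis cox_word_def nth_mem)
  have fs: "first_index c s = p mod length c" using first_index_nth[OF _ len] c s by (simp add: cox_word_def)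
  have occ: "occurrences c p t = (if first_index c t < first_index c s then Suc k else k)" for t
    by (simp add: occurrences_def fs k_def)
  show root: "act u (\<alpha> s) = rt c (p div length c) s" if h: "p div length c < height c s"
    unfolding k_def[symmetric]
  proof (rule mesh[OF c(1) sS u(1)])
    show "act u (\<omega> s) = wt c k s" using u(2)[OF sS] occ[of s] h by (simp add: k_def)
    fix t assume t: "t \<in> S" "s \<otimes>\<^bsub>W\<^esub> t \<noteq> t \<otimes>\<^bsub>W\<^esub> s"
    have ne: "s \<noteq> t" using t by auto
    then have neq: "first_index c s \<noteq> first_index c t"
      using first_index_eq_iff[of s c t] sS t c by (auto simp: cox_word_def)
    have il: "interlaced c (height c)" using c interlaced_height by blast
    have "min (height c t) (occurrences c p t) = occurrences c p t"
    proof (cases "first_index c t < first_index c s")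
      case True
      then have "height c s \<le> height c t" using il t sS unfolding interlaced_def by metis
      then show ?thesis using True h occ[of t] by (simp add: k_def)
    next
      case False
      then have "height c s \<le> Suc (height c t)" using il t sS neq unfolding interlaced_def by (metis linorder_neqE_nat)
      then show ?thesis using False h occ[of t] by (simp add: k_def)
    qed
    then show "act u (\<omega> t) = wt c (if first_index c t < first_index c s then Suc k else k) t"
      using u(2)[OF t(1)] occ[of t] by simp
  qed
  show "act u (\<alpha> s) \<in> pos_roots \<longleftrightarrow> p div length c < height c s"
  proof (cases "p div length c < height c s")
    case True
    then show ?thesis using root rt_less_height by simp
  next
    case False
    then have "act u (\<omega> s) = wt c (height c s) s" using u(2)[OF sS] occ[of s] by (simp add: k_def)
    then show ?thesis using wt_height[OF c(1) sS] act_simple_not_pos[OF u(1) sS] False by metis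
  qed
qed

text \<open>On each fundamental weight the prefix acts like the power of c whose exponent is the
  number of uses of that letter. A new letter s preserves this because the root it meets is the
  difference of two consecutive weights of s. The alternative p = 0 covers the empty word.\<close>

lemma sorting_prefix_invariant:
  assumes c: "cox_word c" and p: "c \<noteq> [] \<or> p = 0"
  shows "sorting_prefix c (height c) p \<in> lists S \<and> pos_word (sorting_prefix c (height c) p) \<and>
    alternating c (sorting_prefix c (height c) p) \<and>
    (\<forall>s\<in>S. act (sorting_prefix c (height c) p) (\<omega> s) = wt c (min (height c s) (occurrences c p s)) s \<and>
      count_list (sorting_prefix c (height c) p) s = min (height c s) (occurrences c p s))"
  using p
proof (induction p)
  case 0
  show ?case by (simp add: occurrences_def)
next
  case (Suc p)
  define u where "u = sorting_prefix c (height c) p"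
  define s where "s = c ! (p mod length c)"
  define k where "k = p div length c"
  have ne: "c \<noteq> []" using Suc.prems by simp
  have dc: "distinct c" "set c = S" "c \<in> lists S" using c by (auto simp: cox_word_def)
  have IH: "u \<in> lists S" "pos_word u" "alternating c u"
    "\<And>t. t \<in> S \<Longrightarrow> act u (\<omega> t) = wt c (min (height c t) (occurrences c p t)) t"
    "\<And>t. t \<in> S \<Longrightarrow> count_list u t = min (height c t) (occurrences c p t)"
    using Suc.IH ne by (auto simp: u_def)
  have sS: "s \<in> S" using ne dc by (auto simp: s_def)
  have occ_s: "occurrences c p s = k"
    using first_index_nth[OF dc(1), of "p mod length c"] ne by (simp add: occurrences_def s_def k_def)
  have occ_Suc: "occurrences c (Suc p) t = occurrences c p t + (if t = s then 1 else 0)" if "t \<in> S" for t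
    using occurrences_Suc[OF dc(1), of t p] that dc by (simp add: s_def)
  show ?case
  proof (cases "k < height c s")
    case False
    then have "sorting_prefix c (height c) (Suc p) = u"
      by (simp add: sorting_prefix_Suc u_def k_def s_def)
    moreover have "min (height c t) (occurrences c (Suc p) t) = min (height c t) (occurrences c p t)" if "t \<in> S" for t
      using False occ_Suc[OF that] occ_s by auto
    ultimately show ?thesis using IH by simp
  next
    case True
    then have pre: "sorting_prefix c (height c) (Suc p) = u @ [s]"
      by (simp add: sorting_prefix_Suc u_def k_def s_def)
    have root: "act u (\<alpha> s) = rt c k s"
      using sorting_prefix_step(2)[OF c ne s_def IH(1) IH(4)] True k_def by blast
    have min_Suc: "min (height c t) (occurrences c (Suc p) t)
        = min (height c t) (occurrences c p t) + (if t = s then 1 else 0)" if "t \<in> S" for t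
      using True occ_Suc[OF that] occ_s by auto
    have cnt: "count_list (u @ [s]) t = min (height c t) (occurrences c (Suc p) t)" if "t \<in> S" for t
      using IH(5)[OF that] min_Suc[OF that] by simp
    have wt: "act (u @ [s]) (\<omega> t) = wt c (min (height c t) (occurrences c (Suc p) t)) t" if t: "t \<in> S" for t
    proof (cases "t = s")
      case True
      have "act (u @ [s]) (\<omega> s) = act u (\<omega> s) - act u (\<alpha> s)"
        using IH(1) sS by (simp add: act_append act_single gen_weight act_diff del: word_prod_Cons)
      also have "\<dots> = wt c (Suc k) s"
        using root IH(4)[OF sS] occ_s \<open>k < height c s\<close> dc by (simp add: rt_wt)
      finally show ?thesis using True min_Suc[OF t] occ_s \<open>k < height c s\<close> by simp
    next
      case False
      have "act (u @ [s]) (\<omega> t) = act u (\<omega> t)"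
        using IH(1) sS t False by (simp add: act_append act_single gen_weight del: word_prod_Cons)
      then show ?thesis using False min_Suc[OF t] IH(4)[OF t] by simp
    qed
    have "interlaced c (count_list (u @ [s]))"
      unfolding interlaced_def
    proof (intro ballI impI)
      fix x y assume xy: "x \<in> S" "y \<in> S" "x \<otimes>\<^bsub>W\<^esub> y \<noteq> y \<otimes>\<^bsub>W\<^esub> x" "first_index c x < first_index c y"
      have "height c y \<le> height c x" "height c x \<le> Suc (height c y)"
        using height_interlace[OF c xy] by auto
      moreover have "occurrences c (Suc p) y \<le> occurrences c (Suc p) x"
        "occurrences c (Suc p) x \<le> Suc (occurrences c (Suc p) y)"
        using xy(4) by (auto simp: occurrences_def)
      ultimately show "count_list (u @ [s]) y \<le> count_list (u @ [s]) x \<and>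
          count_list (u @ [s]) x \<le> Suc (count_list (u @ [s]) y)"
        unfolding cnt[OF xy(1)] cnt[OF xy(2)] by auto
    qed
    then show ?thesis unfolding pre
      using IH sS True root rt_less_height wt cnt by (auto simp: pos_word_snoc alternating_snoc simp del: count_list_append)
  qed
qed

text \<open>The sum of the heights bounds each single height, so that many copies of c suffice for
  every letter.\<close>

definition sorting_bound :: "'w list \<Rightarrow> nat" where
  "sorting_bound c = length c * (\<Sum>s\<in>S. height c s)"

lemma min_height_bound:
  assumes "cox_word c" "s \<in> S"
  shows "min (height c s) (occurrences c (sorting_bound c) s) = height c s"
proof -
  have "length c > 0" using assms by (auto simp: cox_word_def)
  then have "occurrences c (sorting_bound c) s = (\<Sum>s\<in>S. height c s)"
    by (simp add: occurrences_def sorting_bound_def)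
  moreover have "height c s \<le> (\<Sum>s\<in>S. height c s)" using assms finite_S by (intro member_le_sum) auto
  ultimately show ?thesis by simp
qed

lemma sorting_prefix_bound:
  assumes c: "cox_word c"
  defines "u \<equiv> sorting_prefix c (height c) (sorting_bound c)"
  shows "u \<in> lists S" "pos_word u" "alternating c u" "s \<in> S \<Longrightarrow> act u (\<omega> s) = wt c (height c s) s"
    "s \<in> S \<Longrightarrow> count_list u s = height c s" "reduced_expression W S u w\<^sub>0"
proof -
  have *: "c \<noteq> [] \<or> sorting_bound c = 0" by (auto simp: sorting_bound_def)
  show u: "u \<in> lists S" "pos_word u" "alternating c u" "s \<in> S \<Longrightarrow> count_list u s = height c s"
    using sorting_prefix_invariant[OF c *] min_height_bound[OF c] unfolding u_def by simp_all
  have wt: "act u (\<omega> s) = wt c (height c s) s" if "s \<in> S" for s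
    using sorting_prefix_invariant[OF c *] min_height_bound[OF c] that unfolding u_def by simp
  show "s \<in> S \<Longrightarrow> act u (\<omega> s) = wt c (height c s) s" by (rule wt)
  have "act u (\<alpha> s) \<notin> pos_roots" if "s \<in> S" for s
    using wt_height[OF c that] wt[OF that] act_simple_not_pos[OF u(1) that] by metis
  then have "word_prod W u = w\<^sub>0" using longest_iff_simple u(1) by blast
  then show "reduced_expression W S u w\<^sub>0" using u by (simp add: reduced_expression_iff)
qed

text \<open>A competitor p that first departs from P with an earlier position q would extend the
  part of P below q by a letter whose root is not positive, by \<open>sorting_prefix_step\<close>.
  Reduced words of the longest element have equal length, so the lexicographic comparison is decided
  at the first difference.\<close>

lemma sorting_word_eq:
  assumes c: "cox_word c"
  shows "sorting_word W S c = sorting_prefix c (height c) (sorting_bound c)"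
proof -
  define P where "P = sorting_positions c (height c) (sorting_bound c)"
  define Q where "Q = (\<lambda>i. i div length c < height c (c ! (i mod length c)))"
  have P_filter: "P = filter Q [0..<sorting_bound c]" by (simp add: P_def sorting_positions_def Q_def)
  have sP: "sorted_wrt (<) P" unfolding P_filter by (intro sorted_wrt_filter) simp
  have lP: "longest_positions W S c P"
    using sorting_prefix_bound(6)[OF c] sP by (simp add: longest_positions_def P_def sorting_prefix_def)
  have least: "p = P \<or> (P, p) \<in> lexord less_than" if p: "longest_positions W S c p" for p
  proof (cases "p = P")
    case False
    have len: "length P = length p"
      using p lP by (simp add: longest_positions_def reduced_longest_iff subword_power_def)
    obtain r where r: "r < length P" "take r P = take r p" "P ! r \<noteq> p ! r"
      using ex_first_difference[OF len] False by blast
    have "P ! r < p ! r"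
    proof (rule ccontr)
      assume "\<not> P ! r < p ! r"
      then have q: "p ! r < P ! r" using r by simp
      define q where "q = p ! r"
      \<comment> \<open>F is the part of P below q. Comparing the increasing sequences P and p shows
        that it has length r, so F is exactly what p and P share before they differ.\<close>
      define F G where "F = filter Q [0..<q]" and "G = filter Q [q..<sorting_bound c]"
      have "P ! r \<in> set P" using r by simp
      then have "q < sorting_bound c" using q by (auto simp: P_filter q_def)
      then have PFG: "P = F @ G"
      proof -
        have "[0..<sorting_bound c] = [0..<q] @ [q..<sorting_bound c]"
          using upt_add_eq_append[of 0 q "sorting_bound c - q"] \<open>q < sorting_bound c\<close> by simp
        then show ?thesis unfolding P_filter F_def G_def by (simp only: filter_append)
      qed
      have F_less: "F ! i < q" if "i < length F" for i
        using nth_mem[OF that] by (auto simp: F_def)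
      have G_ge: "q \<le> G ! i" if "i < length G" for i
        using nth_mem[OF that] by (auto simp: G_def)
      have "length F \<le> r"
      proof (rule ccontr)
        assume "\<not> length F \<le> r"
        then show False using F_less[of r] q by (simp add: PFG nth_append q_def)
      qed
      moreover have "r \<le> length F"
      proof (rule ccontr)
        assume "\<not> r \<le> length F"
        then have l: "length F < r" by simp
        then have "P ! length F = p ! length F" using r(2) by (metis nth_take)
        moreover have "p ! length F < q"
          using p l r(1) len unfolding longest_positions_def q_def by (auto simp: sorted_wrt_iff_nth_less)
        moreover have "q \<le> P ! length F"
        proof -
          have "0 < length G" using l r(1) unfolding PFG length_append by linarith
          then show ?thesis using G_ge[of 0] by (simp add: PFG nth_append)
        qed
        ultimately show False by simp
      qed
      ultimately have rF: "r = length F" by simp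
      have "\<not> Q q"
      proof
        assume "Q q"
        then have "G = q # filter Q [Suc q..<sorting_bound c]"
          unfolding G_def using upt_conv_Cons[OF \<open>q < sorting_bound c\<close>] by simp
        then show False using q rF by (simp add: PFG q_def nth_append)
      qed
      have "take r p = sorting_positions c (height c) q"
        using r(2) rF by (simp add: PFG F_def sorting_positions_def Q_def)
      then have take: "take r (subword_power c p) = sorting_prefix c (height c) q"
        by (simp add: sorting_prefix_def subword_power_def take_map)
      have "pos_word (subword_power c p)" using p by (simp add: longest_positions_def reduced_expression_iff)
      then have pos: "act (sorting_prefix c (height c) q) (\<alpha> (c ! (q mod length c))) \<in> pos_roots"
        using r(1) len unfolding pos_word_def take[symmetric] by (auto simp: subword_power_def q_def)
      have "c \<noteq> []" using \<open>q < sorting_bound c\<close> by (auto simp: sorting_bound_def)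
      then have "q div length c < height c (c ! (q mod length c))"
        using sorting_prefix_step(1)[OF c _ HOL.refl, of "sorting_prefix c (height c) q" q]
          sorting_prefix_invariant[OF c, of q] pos by blast
      then show False using \<open>\<not> Q q\<close> by (simp add: Q_def)
    qed
    then show ?thesis unfolding lexord_take_index_conv using r len by auto
  qed simp
  have "(THE p. longest_positions W S c p \<and>
      (\<forall>p'. longest_positions W S c p' \<longrightarrow> p' = p \<or> (p, p') \<in> lexord less_than)) = P"
  proof (rule the_equality)
    show "longest_positions W S c P \<and> (\<forall>p'. longest_positions W S c p' \<longrightarrow> p' = P \<or> (P, p') \<in> lexord less_than)"
      using lP least by blast
  next
    fix p assume p: "longest_positions W S c p \<and>
      (\<forall>p'. longest_positions W S c p' \<longrightarrow> p' = p \<or> (p, p') \<in> lexord less_than)"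
    show "p = P"
    proof (rule ccontr)
      assume "p \<noteq> P"
      then have "(P, p) \<in> lexord less_than" "(p, P) \<in> lexord less_than" using p least lP by metis+
      then show False using lexord_asymmetric[of less_than P p] by (auto simp: asym_less_than)
    qed
  qed
  then show ?thesis by (simp add: sorting_word_def sorting_prefix_def P_def)
qed

lemma sorting_word_props:
  assumes c: "cox_word c"
  shows sorting_word_lists: "sorting_word W S c \<in> lists S"
    and sorting_word_alternating: "alternating c (sorting_word W S c)"
    and sorting_word_count: "s \<in> S \<Longrightarrow> count_list (sorting_word W S c) s = height c s"
    and sorting_word_reduced: "reduced_expression W S (sorting_word W S c) w\<^sub>0"
  using sorting_prefix_bound[OF c] by (simp_all add: sorting_word_eq[OF c])

text \<open>The sorting word acts on \<open>\<omega> s\<close> as the power of c given by the height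
  of s, and it also acts as the longest element.\<close>

lemma wt_height_conj:
  assumes "cox_word c" "s \<in> S"
  shows "wt c (height c s) s = - \<omega> (\<phi> s)"
  using sorting_prefix_bound(4,6)[OF assms(1)] assms(2) longest_weight
  by (simp add: reduced_longest_iff')

end

section \<open>Heights under rotation and reversal\<close>

context finite_coxeter
begin

lemma rt_height_conj:
  assumes "cox_word c" "s \<in> S"
  shows "rt c (height c s) s = - cox_root c (\<phi> s)"
  using assms cox_word_lists
  by (simp add: rt_wt wt_Suc wt_height_conj act_minus cox_root_def)

lemma cox_root_eq_iff:
  "cox_word c \<Longrightarrow> s \<in> S \<Longrightarrow> t \<in> S \<Longrightarrow> cox_root c s = cox_root c t \<longleftrightarrow> s = t"
  using cox_root_inj weight_inj unfolding cox_root_def by metis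

lemma act_rev_cox_root:
  assumes "cox_word c" "s \<in> S"
  shows "act (rev c) (cox_root c s) \<notin> pos_roots"
  using inversions_cox_word[OF assms(1)] assms(2) unfolding inversions_def by auto

lemma act_rev_rt: "c \<in> lists S \<Longrightarrow> act (word_power (rev c) j) (rt c (j + l) s) = rt c l s"
  by (induction j) (simp_all add: act_word_power_Suc' rt_Suc act_rev)

text \<open>For k > 0 the inverse of c would take \<open>rt c k s\<close> to an earlier, hence
  positive root, whereas it makes every \<open>cox_root c t\<close> negative.\<close>

lemma rt_eq_cox_root:
  assumes c: "cox_word c" and s: "s \<in> S" "t \<in> S" and k: "k < height c s" and eq: "rt c k s = cox_root c t"
  shows "k = 0 \<and> s = t"
proof (cases k)
  case 0
  then show ?thesis using eq cox_root_eq_iff c s by simp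
next
  case (Suc l)
  have cl: "c \<in> lists S" using c cox_word_lists by blast
  have "act (rev c) (rt c k s) = rt c l s" using cl by (simp add: Suc rt_Suc act_rev)
  then have "act (rev c) (cox_root c t) \<in> pos_roots" using rt_less_height[of l c s] k Suc eq by simp
  then show ?thesis using act_rev_cox_root c s by blast
qed

lemma sum_height: "cox_word c \<Longrightarrow> (\<Sum>s\<in>S. height c s) = card pos_roots"
proof -
  assume c: "cox_word c"
  have "(\<Sum>s\<in>S. height c s) = (\<Sum>s\<in>S. count_list (sorting_word W S c) s)"
    using sorting_word_count[OF c] by simp
  also have "\<dots> = length (sorting_word W S c)"
    using sorting_word_lists[OF c] finite_S by (intro sum_count_set) (auto simp: lists_eq_set)
  finally show ?thesis using sorting_word_reduced[OF c] by (simp add: reduced_longest_iff)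
qed

text \<open>The inverse of c runs through the same roots backwards:
  \<open>cox_root (rev c) (\<phi> s)\<close> is the last positive root
  \<open>rt c (h - 1) s\<close>.\<close>

lemma height_rev:
  assumes c: "cox_word c" and s: "s \<in> S"
  shows "height (rev c) (\<phi> s) = height c s"
proof -
  have cl: "c \<in> lists S" using c cox_word_lists by blast
  define h where "h = height c s"
  have h: "0 < h" using height_pos c s by (simp add: h_def)
  have t: "\<phi> s \<in> S" using s by (rule conj_longest_gen)
  have "cox_root (rev c) (\<phi> s) = act (rev c) (- cox_root c (\<phi> s))"
    using cl by (simp add: cox_root_def act_diff act_minus act_rev)
  then have root: "cox_root (rev c) (\<phi> s) = act (rev c) (rt c h s)"
    using c s by (simp add: rt_height_conj h_def)
  have rts: "rt (rev c) k (\<phi> s) = act (word_power (rev c) (Suc k)) (rt c h s)" for k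
    using cl by (simp add: rt_def[of "rev c"] root act_word_power_Suc')
  show ?thesis unfolding h_def[symmetric]
  proof (rule height_eqI)
    show "cox_word (rev c)" using c by (rule cox_word_rev)
    show "\<phi> s \<in> S" by (rule t)
    fix k assume "k < h"
    then have "rt (rev c) k (\<phi> s) = rt c (h - Suc k) s"
      using act_rev_rt[OF cl, of "Suc k" "h - Suc k" s] rts[of k] by simp
    then show "rt (rev c) k (\<phi> s) \<in> pos_roots" using rt_less_height[of "h - Suc k" c s] \<open>k < h\<close> by (simp add: h_def)
  next
    have "rt (rev c) h (\<phi> s) = act (rev c) (act (word_power (rev c) h) (rt c h s))"
      using cl by (simp add: rts act_word_power_Suc)
    also have "\<dots> = act (rev c) (cox_root c s)" using act_rev_rt[OF cl, of h 0 s] by simp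
    finally show "rt (rev c) h (\<phi> s) \<notin> pos_roots" using act_rev_cox_root c s by simp
  qed
qed

text \<open>The invariant inner products behind \<open>height_interlace\<close> are evaluated where
  the root and the weight have both become negatives of those belonging to \<open>\<phi> s\<close>
  and \<open>\<phi> t\<close>. Their positivity rules out one order of these two letters in c by
  \<open>cox_root_inner_after\<close>.\<close>

lemma height_conj_order:
  assumes c: "cox_word c" and s: "s \<in> S" and t: "t \<in> S" and nc: "s \<otimes>\<^bsub>W\<^esub> t \<noteq> t \<otimes>\<^bsub>W\<^esub> s"
    and bef: "first_index c s < first_index c t"
  shows "height c s = height c t \<Longrightarrow> first_index c (\<phi> s) \<le> first_index c (\<phi> t)"
    and "height c s = Suc (height c t) \<Longrightarrow> first_index c (\<phi> t) \<le> first_index c (\<phi> s)"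
proof -
  have cl: "c \<in> lists S" using c cox_word_lists by blast
  have \<phi>: "\<phi> s \<in> S" "\<phi> t \<in> S" using s t conj_longest_gen by blast+
  {
    assume eq: "height c s = height c t"
    have "cox_root c (\<phi> t) \<bullet> \<omega> (\<phi> s) = rt c (height c t) t \<bullet> wt c (height c s) s"
      using c s t by (simp add: rt_height_conj wt_height_conj)
    also have "\<dots> = cox_root c t \<bullet> \<omega> s" using rt_wt_inner[OF cl, of 0] eq by simp
    also have "\<dots> > 0" using cox_root_inner_before[OF c t s] nc bef by metis
    finally show "first_index c (\<phi> s) \<le> first_index c (\<phi> t)"
      using cox_root_inner_after[OF c \<phi>(2,1)] by (metis less_irrefl not_le)
  }
  {
    assume eq: "height c s = Suc (height c t)"
    have "cox_root c (\<phi> s) \<bullet> \<omega> (\<phi> t) = rt c (1 + height c t) s \<bullet> wt c (height c t) t"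
      using rt_height_conj[OF c s] wt_height_conj[OF c t] eq by simp
    also have "\<dots> = act c (cox_root c s) \<bullet> \<omega> t"
      using rt_wt_inner[OF cl, of 1 "height c t" s t] rt_Suc[OF cl, of 0 s] by simp
    also have "\<dots> > 0" using cox_root_inner_next[OF c s t nc bef] .
    finally show "first_index c (\<phi> t) \<le> first_index c (\<phi> s)"
      using cox_root_inner_after[OF c \<phi>] by (metis less_irrefl not_le)
  }
qed

lemma conj_longest_noncommuting:
  assumes "s \<in> S" "t \<in> S" "s \<otimes>\<^bsub>W\<^esub> t \<noteq> t \<otimes>\<^bsub>W\<^esub> s"
  shows "\<phi> s \<otimes>\<^bsub>W\<^esub> \<phi> t \<noteq> \<phi> t \<otimes>\<^bsub>W\<^esub> \<phi> s"
proof (rule cartan_nonzero)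
  show "\<phi> s \<in> S" "\<phi> t \<in> S" using assms conj_longest_gen by blast+
  have "\<alpha> (\<phi> s) \<bullet> \<alpha> (\<phi> t) = \<rho> w\<^sub>0 (\<alpha> s) \<bullet> \<rho> w\<^sub>0 (\<alpha> t)" using assms by (simp add: longest_simple)
  then show "\<alpha> (\<phi> s) \<bullet> \<alpha> (\<phi> t) \<noteq> 0" using simple_inner_neg[OF assms] by (simp add: longest_inner)
  show "\<phi> s \<noteq> \<phi> t" using assms conj_longest_involution by metis
qed

section \<open>How the heights change with the word of the Coxeter element\<close>

lemma act_word_power_cong:
  assumes "c \<in> lists S" "d \<in> lists S" "word_prod W c = word_prod W d"
  shows "act (word_power c k) v = act (word_power d k) v"
  using assms by (induction k) (simp_all add: act_word_power_Suc)

lemma height_cong: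
  assumes "c \<in> lists S" "d \<in> lists S" "word_prod W c = word_prod W d"
  shows "height c s = height d s"
  using act_word_power_cong[OF assms] assms(3) by (simp add: height_def rt_def cox_root_def)

text \<open>The rotated Coxeter element is the conjugate by a. For s different from a the weight
  \<open>\<omega> s\<close> is fixed by a, so the roots are just reflected; for s = a the reflected
  weight equals c applied to \<open>\<omega> a\<close>, which shifts the index by one.\<close>

lemma rt_rotate:
  assumes c: "cox_word (a # d)" and s: "s \<in> S"
  shows "rt (d @ [a]) k s = \<rho> a (rt (a # d) (if s = a then Suc k else k) s)"
proof -
  let ?c = "a # d"
  have mem: "a \<in> S" "d \<in> lists S" "?c \<in> lists S" "d @ [a] \<in> lists S" "a \<notin> set d"
    using c by (auto simp: cox_word_def)
  have step: "act (d @ [a]) v = \<rho> a (act ?c (\<rho> a v))" for v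
    using mem by (simp add: act_append act_Cons act_single gen_involution del: word_prod_Cons)
  have pow: "act (word_power (d @ [a]) k) v = \<rho> a (act (word_power ?c k) (\<rho> a v))" for v
    using mem by (induction k) (simp_all add: act_word_power_Suc step gen_involution del: word_prod_Cons)
  show ?thesis
  proof (cases "s = a")
    case False
    then have "cox_root (d @ [a]) s = \<rho> a (cox_root ?c s)"
      using s mem by (simp add: cox_root_def step gen_diff gen_weight del: word_prod_Cons)
    then show ?thesis using False mem by (simp add: rt_def pow gen_involution)
  next
    case True
    have "\<rho> a (\<omega> a) = act ?c (\<omega> a)" using mem by (simp add: act_Cons act_weight_fix del: word_prod_Cons)
    moreover from this have "\<omega> a = \<rho> a (act ?c (\<omega> a))" using mem gen_involution by metis
    ultimately have "cox_root (d @ [a]) a = \<rho> a (act ?c (cox_root ?c a))"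
      unfolding cox_root_def step using mem act_diff[of ?c] by (metis gen_diff)
    then show ?thesis
      using True mem by (simp add: rt_def pow gen_involution act_word_power_Suc' del: word_prod_Cons)
  qed
qed

text \<open>Applying a changes signs only at \<open>\<alpha> a\<close>, which is
  \<open>cox_root (a # d) a\<close>, and at its negative. Before the height, the former occurs only
  at index 0 for s = a, which the offset e skips; the latter is met at the height only if
  \<open>\<phi> s\<close> is a.\<close>

lemma height_rotate_other:
  assumes c: "cox_word (a # d)" and s: "s \<in> S" "\<phi> s \<noteq> a"
  shows "height (d @ [a]) s + (if s = a then 1 else 0) = height (a # d) s"
proof -
  let ?c = "a # d"
  have mem: "a \<in> S" "d \<in> lists S" "a \<notin> set d" using c by (auto simp: cox_word_def)
  then have a: "a \<in> S" "\<alpha> a = cox_root ?c a" using cox_root_split[of ?c "[]" a d] by simp_all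
  define e h where "e = (if s = a then 1 else 0::nat)" and "h = height ?c s"
  have h: "e \<le> h" using height_pos[OF c s(1)] by (auto simp: e_def h_def)
  have rts: "rt (d @ [a]) k s = \<rho> a (rt ?c (k + e) s)" for k
    using rt_rotate[OF c s(1), of k] by (simp add: e_def)
  have "height (d @ [a]) s = h - e"
  proof (rule height_eqI)
    show "cox_word (d @ [a])" using c by (auto simp: cox_word_def)
    show "s \<in> S" by (rule s)
    fix k assume "k < h - e"
    then have k: "k + e < height ?c s" by (simp add: h_def)
    have "rt ?c (k + e) s \<noteq> \<alpha> a"
    proof
      assume "rt ?c (k + e) s = \<alpha> a"
      then have "rt ?c (k + e) s = cox_root ?c a" using a(2) by metis
      from rt_eq_cox_root[OF c s(1) a(1) k this] show False by (auto simp: e_def)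
    qed
    then show "rt (d @ [a]) k s \<in> pos_roots"
      unfolding rts by (rule gen_pos_root[OF a(1) rt_less_height[OF k]])
  next
    have "rt ?c h s = - cox_root ?c (\<phi> s)" using rt_height_conj c s by (simp add: h_def)
    moreover have "cox_root ?c (\<phi> s) \<noteq> \<alpha> a"
      using cox_root_eq_iff[OF c conj_longest_gen[OF s(1)] a(1)] s(2) a(2) by metis
    ultimately have "rt ?c h s \<noteq> - \<alpha> a" by simp
    then have "\<rho> a (rt ?c h s) \<notin> pos_roots"
      using gen_pos_root_iff[OF a(1) rt_root[OF c s(1)]] rt_height[OF c s(1)] by (simp add: h_def)
    then show "rt (d @ [a]) (h - e) s \<notin> pos_roots" using h rts by simp
  qed
  then show ?thesis using h by (simp add: e_def h_def)
qed

text \<open>For s = \<open>\<phi> a\<close> the height is forced by all the others, because both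
  families of heights add up to the number of positive roots.\<close>

lemma height_rotate:
  assumes c: "cox_word (a # d)" and s: "s \<in> S"
  shows "height (d @ [a]) s + (if s = a then 1 else 0) = height (a # d) s + (if s = \<phi> a then 1 else 0)"
proof (cases "s = \<phi> a")
  case False
  then have "\<phi> s \<noteq> a" using conj_longest_involution s by metis
  then show ?thesis using height_rotate_other[OF c s] False by simp
next
  case True
  have a: "a \<in> S" using c by (auto simp: cox_word_def)
  have c': "cox_word (d @ [a])" using c by (auto simp: cox_word_def)
  have other: "height (d @ [a]) t + (if t = a then 1 else 0) = height (a # d) t" if "t \<in> S - {s}" for t
  proof -
    have "\<phi> t \<noteq> a" using that conj_longest_involution[of t] True by (metis DiffD1 DiffD2 singletonI)
    then show ?thesis using height_rotate_other[OF c, of t] that by simp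
  qed
  have "(\<Sum>t\<in>S. height (d @ [a]) t + (if t = a then 1 else 0)) = card pos_roots + 1"
    using sum_height[OF c'] a finite_S by (simp add: sum.distrib)
  moreover have "(\<Sum>t\<in>S. height (d @ [a]) t + (if t = a then 1 else 0)) =
     height (d @ [a]) s + (if s = a then 1 else 0) + (\<Sum>t\<in>S - {s}. height (a # d) t)"
    using s finite_S other by (simp add: sum.remove[OF finite_S s])
  moreover have "card pos_roots = height (a # d) s + (\<Sum>t\<in>S - {s}. height (a # d) t)"
    using sum_height[OF c] by (simp add: sum.remove[OF finite_S s])
  ultimately show ?thesis using True by simp
qed

end

section \<open>Commutation classes\<close>

lemma commutations_trans:
  assumes "commutations W Q f R" "commutations W R g T"
  shows "commutations W Q (g \<circ> f) T"
  using assms(2)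
proof induction
  case id
  then show ?case using assms(1) by simp
next
  case (step g P a b R')
  show ?case using commutations.step[OF step.IH step.hyps(2,3)] by (simp only: comp_assoc)
qed

lemma commutations_Cons: "commutations W Q f R \<Longrightarrow> \<exists>g. commutations W (a # Q) g (a # R)"
proof (induction rule: commutations.induct)
  case id
  then show ?case using commutations.id by blast
next
  case (step f P x y R)
  then obtain g where "commutations W (a # Q) g ((a # P) @ x # y # R)" by auto
  from commutations.step[OF this step.hyps(2,3)] show ?case by auto
qed

lemma commutations_move:
  "(\<And>b. b \<in> set v \<Longrightarrow> a \<noteq> b \<and> a \<otimes>\<^bsub>W\<^esub> b = b \<otimes>\<^bsub>W\<^esub> a) \<Longrightarrow> \<exists>f. commutations W (a # v @ v') f (v @ a # v')"
proof (induction v)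
  case Nil
  then show ?case using commutations.id by auto
next
  case (Cons b v)
  then obtain g where "commutations W (b # a # v @ v') g (b # v @ a # v')"
    using commutations_Cons by (metis list.set_intros(2))
  moreover have "commutations W (a # b # v @ v') id ([] @ a # b # v @ v')"
    using commutations.id by simp
  then have "\<exists>f. commutations W (a # b # v @ v') f ([] @ b # a # v @ v')"
    using commutations.step Cons.prems by (metis list.set_intros(1))
  ultimately show ?case using commutations_trans by fastforce
qed

text \<open>The projection lemma for partially commutative words. Let a be the first letter of u:
  the projections to a and one further letter show that everything before the first a in v commutes
  with a, so a can be moved to the front. The case s = t compares the numbers of
  occurrences.\<close>

lemma filter_eq_commutations:
  assumes "u \<in> lists A" "v \<in> lists A"
    "\<And>s t. s \<in> A \<Longrightarrow> t \<in> A \<Longrightarrow> s = t \<or> s \<otimes>\<^bsub>W\<^esub> t \<noteq> t \<otimes>\<^bsub>W\<^esub> s \<Longrightarrow>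
      filter (\<lambda>x. x = s \<or> x = t) u = filter (\<lambda>x. x = s \<or> x = t) v"
  shows "\<exists>f. commutations W u f v"
  using assms
proof (induction u arbitrary: v)
  case Nil
  have "v = []"
  proof (cases v)
    case (Cons b v')
    then show ?thesis using Nil.prems(1) Nil.prems(2)[of b b] by simp
  qed
  then show ?case using commutations.id by blast
next
  case (Cons a u)
  have a: "a \<in> A" using Cons.hyps by simp
  have "filter (\<lambda>x. x = a) v = a # filter (\<lambda>x. x = a) u" using Cons.prems(2)[OF a a] by simp
  then have "a \<in> set (filter (\<lambda>x. x = a) v)" by (simp only: list.set insertI1)
  then have "a \<in> set v" by simp
  then obtain v1 v2 where v: "v = v1 @ a # v2" "a \<notin> set v1" using split_list_first by metis
  have vA: "v1 \<in> lists A" "v2 \<in> lists A" using Cons.prems(1) v by auto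
  have com: "a \<noteq> b \<and> a \<otimes>\<^bsub>W\<^esub> b = b \<otimes>\<^bsub>W\<^esub> a" if b: "b \<in> set v1" for b
  proof (rule ccontr)
    assume nc: "\<not> ?thesis"
    have "b \<in> A" using vA b by (auto simp: lists_eq_set)
    then have "filter (\<lambda>x. x = a \<or> x = b) (a # u) = filter (\<lambda>x. x = a \<or> x = b) v"
      using Cons.prems(2)[OF a \<open>b \<in> A\<close>] nc b v by auto
    moreover have "filter (\<lambda>x. x = a \<or> x = b) v1 \<noteq> []" using b by (auto simp: filter_empty_conv)
    ultimately have "hd (filter (\<lambda>x. x = a \<or> x = b) v1) = a"
      by (cases "filter (\<lambda>x. x = a \<or> x = b) v1") (auto simp: v)
    moreover have "hd (filter (\<lambda>x. x = a \<or> x = b) v1) \<in> set v1"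
      using \<open>filter (\<lambda>x. x = a \<or> x = b) v1 \<noteq> []\<close> hd_in_set by fastforce
    ultimately show False using v by simp
  qed
  have "filter (\<lambda>x. x = s \<or> x = t) u = filter (\<lambda>x. x = s \<or> x = t) (v1 @ v2)"
    if st: "s \<in> A" "t \<in> A" "s = t \<or> s \<otimes>\<^bsub>W\<^esub> t \<noteq> t \<otimes>\<^bsub>W\<^esub> s" for s t
  proof (cases "a = s \<or> a = t")
    case False
    then show ?thesis using Cons.prems(2)[OF st] by (simp add: v)
  next
    case True
    have "filter (\<lambda>x. x = s \<or> x = t) v1 = []"
      using com st True v(2) by (fastforce simp: filter_empty_conv)
    then show ?thesis using Cons.prems(2)[OF st] True by (auto simp: v)
  qed
  then obtain f where "commutations W u f (v1 @ v2)" using Cons.IH[of "v1 @ v2"] vA by auto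
  then show ?case unfolding v using commutations_Cons commutations_move[OF com] commutations_trans by metis
qed

lemma count_list_filter: "P s \<Longrightarrow> count_list (filter P u) s = count_list u s"
  by (induction u) auto

lemma take_filter: "\<exists>j. take k (filter P u) = filter P (take j u)"
proof (induction u arbitrary: k)
  case (Cons a u)
  show ?case
  proof (cases "P a \<and> k = 0")
    case True
    then show ?thesis by (intro exI[of _ 0]) simp
  next
    case False
    obtain j where "take (if P a then k - 1 else k) (filter P u) = filter P (take j u)" using Cons.IH by blast
    then show ?thesis using False by (intro exI[of _ "Suc j"]) (cases k, auto)
  qed
qed simp

text \<open>Both words must start with s, and without this letter they satisfy the hypotheses with s
  and t exchanged.\<close>

lemma alternating_pair_unique:
  assumes "set x \<subseteq> {s, t}" "set y \<subseteq> {s, t}" "s \<noteq> t" "length x = length y"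
    "\<And>k. count_list (take k x) t \<le> count_list (take k x) s \<and> count_list (take k x) s \<le> Suc (count_list (take k x) t)"
    "\<And>k. count_list (take k y) t \<le> count_list (take k y) s \<and> count_list (take k y) s \<le> Suc (count_list (take k y) t)"
  shows "x = y"
  using assms
proof (induction x arbitrary: y s t)
  case (Cons a x)
  then obtain b y' where y: "y = b # y'" by (metis Suc_length_conv)
  have a: "a = s" using Cons.prems(1,3) Cons.prems(5)[of 1] by (auto split: if_splits)
  have b: "b = s" using Cons.prems(2,3) Cons.prems(6)[of 1] by (auto simp: y split: if_splits)
  have "x = y'"
  proof (rule Cons.IH)
    show "set x \<subseteq> {t, s}" "set y' \<subseteq> {t, s}" "t \<noteq> s" "length x = length y'"
      using Cons.prems by (auto simp: y)
    show "count_list (take k x) s \<le> count_list (take k x) t \<and> count_list (take k x) t \<le> Suc (count_list (take k x) s)" for k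
      using Cons.prems(5)[of "Suc k"] Cons.prems(3) by (auto simp: a)
    show "count_list (take k y') s \<le> count_list (take k y') t \<and> count_list (take k y') t \<le> Suc (count_list (take k y') s)" for k
      using Cons.prems(6)[of "Suc k"] Cons.prems(3) by (auto simp: b y)
  qed
  then show ?case by (simp add: a b y)
qed simp

lemma filter_eq_replicate: "filter (\<lambda>x. x = s \<or> x = s) u = replicate (count_list u s) s"
  by (induction u) auto

lemma count_list_take_distinct:
  "distinct c \<Longrightarrow> s \<in> set c \<Longrightarrow> count_list (take k c) s = (if first_index c s < k then 1 else 0)"
proof (induction c arbitrary: k)
  case (Cons a c)
  show ?case
  proof (cases k)
    case (Suc l)
    have "a \<notin> set (take l c)" using Cons.prems by (auto dest: in_set_takeD)
    then have "count_list (take l c) a = 0" by simp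
    then show ?thesis using Cons Suc by (auto simp: first_index_Cons)
  qed simp
qed simp

section \<open>Commutation classes determined by letter counts\<close>

context finite_coxeter
begin

text \<open>\<open>heap c e u\<close>: up to commutations, u is the sorting word of c for e = 0, and the word
  \<open>c\<close> followed by its sorting word for e = 1.\<close>

definition heap :: "'w list \<Rightarrow> nat \<Rightarrow> 'w list \<Rightarrow> bool" where
  "heap c e u \<longleftrightarrow> u \<in> lists S \<and> alternating c u \<and> (\<forall>s\<in>S. count_list u s = height c s + e)"

text \<open>Projections to one letter are fixed by the counts; those to two noncommuting letters
  alternate and are fixed by their length.\<close>

lemma heap_unique:
  assumes c: "cox_word c" and u: "heap c e u" and v: "heap c e v"
  shows "\<exists>f. commutations W u f v"
proof (rule filter_eq_commutations)
  show "u \<in> lists S" "v \<in> lists S" using u v by (auto simp: heap_def)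
  have pair: "filter (\<lambda>x. x = s \<or> x = t) u = filter (\<lambda>x. x = s \<or> x = t) v"
    if st: "s \<in> S" "t \<in> S" "s \<otimes>\<^bsub>W\<^esub> t \<noteq> t \<otimes>\<^bsub>W\<^esub> s" "first_index c s < first_index c t" for s t
  proof (rule alternating_pair_unique)
    let ?P = "\<lambda>x. x = s \<or> x = t"
    show ne: "s \<noteq> t" using st by auto
    show "set (filter ?P u) \<subseteq> {s, t}" "set (filter ?P v) \<subseteq> {s, t}" by auto
    have len: "length (filter ?P w) = count_list w s + count_list w t" for w
      using ne by (induction w) auto
    show "length (filter ?P u) = length (filter ?P v)"
      using u v st unfolding len heap_def by simp
    have alt: "count_list (take k (filter ?P w)) t \<le> count_list (take k (filter ?P w)) s \<and>
        count_list (take k (filter ?P w)) s \<le> Suc (count_list (take k (filter ?P w)) t)"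
      if "alternating c w" for w k
    proof -
      obtain j where "take k (filter ?P w) = filter ?P (take j w)" using take_filter by blast
      then show ?thesis
        using that st unfolding alternating_def interlaced_def by (simp add: count_list_filter)
    qed
    show "count_list (take k (filter ?P u)) t \<le> count_list (take k (filter ?P u)) s \<and>
        count_list (take k (filter ?P u)) s \<le> Suc (count_list (take k (filter ?P u)) t)" for k
      using alt u by (simp add: heap_def)
    show "count_list (take k (filter ?P v)) t \<le> count_list (take k (filter ?P v)) s \<and>
        count_list (take k (filter ?P v)) s \<le> Suc (count_list (take k (filter ?P v)) t)" for k
      using alt v by (simp add: heap_def)
  qed
  fix s t assume st: "s \<in> S" "t \<in> S" "s = t \<or> s \<otimes>\<^bsub>W\<^esub> t \<noteq> t \<otimes>\<^bsub>W\<^esub> s"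
  show "filter (\<lambda>x. x = s \<or> x = t) u = filter (\<lambda>x. x = s \<or> x = t) v"
  proof (cases "s = t")
    case True
    then show ?thesis using u v st unfolding heap_def by (simp only: filter_eq_replicate)
  next
    case False
    then have nc: "s \<otimes>\<^bsub>W\<^esub> t \<noteq> t \<otimes>\<^bsub>W\<^esub> s" using st by blast
    have "first_index c s \<noteq> first_index c t"
      using False st c first_index_eq_iff[of s c t] by (auto simp: cox_word_def)
    then consider "first_index c s < first_index c t" | "first_index c t < first_index c s" by linarith
    then show ?thesis
    proof cases
      case 1
      then show ?thesis using pair st nc by blast
    next
      case 2
      then have "filter (\<lambda>x. x = t \<or> x = s) u = filter (\<lambda>x. x = t \<or> x = s) v"
        using pair[of t s] st nc by metis
      then show ?thesis by (simp only: disj_commute)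
    qed
  qed
qed

lemma heap_sorting_word: "cox_word c \<Longrightarrow> heap c 0 (sorting_word W S c)"
  by (simp add: heap_def sorting_word_lists sorting_word_alternating sorting_word_count)

lemma interlaced_add: "interlaced c g \<Longrightarrow> interlaced c (\<lambda>s. g s + e)"
  by (simp add: interlaced_def)

lemma interlaced_cong: "(\<And>s. s \<in> S \<Longrightarrow> f s = g s) \<Longrightarrow> interlaced c f \<longleftrightarrow> interlaced c g"
  by (simp add: interlaced_def)

text \<open>Inside the initial c the counts are 0 or 1 in the order of c; afterwards c adds one to
  every count, which does not affect interlacing.\<close>

lemma heap_cw_word:
  assumes c: "cox_word c"
  shows "heap c 1 (cw_word W S c)"
proof -
  let ?w = "sorting_word W S c"
  have dc: "distinct c" "set c = S" "c \<in> lists S" using c by (auto simp: cox_word_def)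
  have "interlaced c (count_list (take k (c @ ?w)))" for k
  proof (cases "k \<le> length c")
    case True
    have "interlaced c (\<lambda>s. if first_index c s < k then 1 else 0)" by (auto simp: interlaced_def)
    then show ?thesis using True dc interlaced_cong[of "count_list (take k c)" "\<lambda>s. if first_index c s < k then 1 else 0"]
      by (simp add: count_list_take_distinct)
  next
    case False
    have one: "count_list c s = 1" if "s \<in> S" for s
      using count_list_take_distinct[OF dc(1), of s "length c"] that dc by (simp add: first_index_less_iff)
    have "interlaced c (\<lambda>s. count_list (take (k - length c) ?w) s + 1)"
      using sorting_word_alternating[OF c] by (intro interlaced_add) (simp add: alternating_def)
    then show ?thesis using False one
        interlaced_cong[of "count_list (take k (c @ ?w))" "\<lambda>s. count_list (take (k - length c) ?w) s + 1"]
      by simp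
  qed
  moreover have "count_list c s = 1" if "s \<in> S" for s
    using count_list_take_distinct[OF dc(1), of s "length c"] that dc by (simp add: first_index_less_iff)
  ultimately show ?thesis
    using sorting_word_lists[OF c] sorting_word_count[OF c] dc
    by (simp add: heap_def cw_word_def alternating_def)
qed

text \<open>Dropping the first a lowers the count of a by one while a becomes last in the order,
  which matches the inequalities for pairs containing a. The appended \<open>\<phi> a\<close>
  accounts for the change of heights in \<open>height_rotate\<close>, and the full counts interlace
  because the heights do.\<close>

lemma heap_rotation:
  assumes c: "cox_word (a # d)" and u: "heap (a # d) e (a # u)"
  shows "heap (d @ [a]) e (u @ [\<phi> a])"
proof -
  have c': "cox_word (d @ [a])" using c by (auto simp: cox_word_def)
  have a: "a \<in> S" "a \<notin> set d" "\<phi> a \<in> S" using c conj_longest_gen by (auto simp: cox_word_def)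
  have cnt: "count_list (u @ [\<phi> a]) s = height (d @ [a]) s + e" if s: "s \<in> S" for s
  proof -
    have "count_list (a # u) s = height (a # d) s + e" using u s by (simp add: heap_def)
    then show ?thesis using height_rotate[OF c s] by (auto split: if_splits)
  qed
  have pre: "interlaced (d @ [a]) (count_list (take k u))" for k
    unfolding interlaced_def
  proof (intro ballI impI)
    fix s t assume st: "s \<in> S" "t \<in> S" "s \<otimes>\<^bsub>W\<^esub> t \<noteq> t \<otimes>\<^bsub>W\<^esub> s"
      "first_index (d @ [a]) s < first_index (d @ [a]) t"
    have il: "interlaced (a # d) (count_list (a # take k u))"
      using u unfolding heap_def alternating_def by (metis take_Suc_Cons)
    have sd: "s \<in> set d" "t = a \<or> t \<in> set d"
      using st c by (auto simp: cox_word_def first_index_append first_index_Cons split: if_splits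
          dest!: first_index_less_iff[THEN iffD2])
    show "count_list (take k u) t \<le> count_list (take k u) s \<and> count_list (take k u) s \<le> Suc (count_list (take k u) t)"
    proof (cases "t = a")
      case True
      then have "first_index (a # d) t < first_index (a # d) s" using sd a by (auto simp: first_index_Cons)
      then have "count_list (a # take k u) s \<le> count_list (a # take k u) t \<and>
          count_list (a # take k u) t \<le> Suc (count_list (a # take k u) s)"
        using il st unfolding interlaced_def by metis
      moreover have "s \<noteq> a" using sd a by auto
      ultimately show ?thesis using True by simp
    next
      case False
      then have "first_index (a # d) s < first_index (a # d) t"
        using sd a st(4) by (auto simp: first_index_Cons first_index_append)
      then have "count_list (a # take k u) t \<le> count_list (a # take k u) s \<and>
          count_list (a # take k u) s \<le> Suc (count_list (a # take k u) t)"
        using il st unfolding interlaced_def by metis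
      moreover have "s \<noteq> a" using sd a by auto
      ultimately show ?thesis using False by simp
    qed
  qed
  have "interlaced (d @ [a]) (count_list (u @ [\<phi> a]))"
    using interlaced_add[OF interlaced_height[OF c'], of e] cnt interlaced_cong[of "count_list (u @ [\<phi> a])"]
    by simp
  then have "alternating (d @ [a]) (u @ [\<phi> a])"
    unfolding alternating_snoc using pre by (simp add: alternating_def del: count_list_append)
  then show ?thesis using u a cnt by (simp add: heap_def del: count_list_append)
qed

lemma count_list_map_conj:
  assumes "u \<in> lists S" "s \<in> S"
  shows "count_list (map \<phi> u) s = count_list u (\<phi> s)"
  using assms(1)
proof (induction u)
  case (Cons a u)
  then have "\<phi> a = s \<longleftrightarrow> a = \<phi> s" using assms(2) conj_longest_involution by auto
  then show ?case using Cons by simp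
qed simp

text \<open>Prefix counts of the reversed word are total counts minus prefix counts of u. By
  \<open>height_conj_order\<close> the order of two conjugate letters tells whether their heights
  agree or differ by one, and in either case the subtraction yields the required
  inequalities.\<close>

lemma heap_reversal:
  assumes c: "cox_word c" and u: "heap c e u"
  shows "heap (rev c) e (map \<phi> (rev u))"
proof -
  have uS: "u \<in> lists S" using u by (simp add: heap_def)
  have G: "count_list u s = height c s + e" if "s \<in> S" for s using u that by (simp add: heap_def)
  have "interlaced (rev c) (count_list (take k (map \<phi> (rev u))))" for k
    unfolding interlaced_def
  proof (intro ballI impI)
    fix s t assume st: "s \<in> S" "t \<in> S" "s \<otimes>\<^bsub>W\<^esub> t \<noteq> t \<otimes>\<^bsub>W\<^esub> s"
      "first_index (rev c) s < first_index (rev c) t"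
    define x y j where "x = \<phi> s" and "y = \<phi> t" and "j = length u - k"
    have xy: "x \<in> S" "y \<in> S" "\<phi> x = s" "\<phi> y = t"
      using st conj_longest_gen conj_longest_involution by (auto simp: x_def y_def)
    have nc: "x \<otimes>\<^bsub>W\<^esub> y \<noteq> y \<otimes>\<^bsub>W\<^esub> x" using conj_longest_noncommuting[OF st(1-3)] by (simp add: x_def y_def)
    have ts: "first_index c t < first_index c s"
      using st(4) c st(1,2) first_index_rev[of c s] first_index_rev[of c t] by (simp add: cox_word_def)
    have il: "interlaced c (count_list (take j u))" using u by (simp add: heap_def alternating_def)
    have drop: "take k (map \<phi> (rev u)) = map \<phi> (rev (drop j u))"
      by (simp add: take_map take_rev j_def)
    have "rev (drop j u) \<in> lists S" using uS by (auto simp: lists_eq_set dest: in_set_dropD)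
    then have cnt: "count_list (take k (map \<phi> (rev u))) r = count_list (drop j u) (\<phi> r)" if "r \<in> S" for r
      using that by (simp add: drop count_list_map_conj)
    have sum: "count_list (take j u) r + count_list (drop j u) r = height c r + e" if "r \<in> S" for r
      using G[OF that] by (metis append_take_drop_id count_list_append)
    have neq: "first_index c x \<noteq> first_index c y"
      using first_index_eq_iff[of x c y] xy nc c by (auto simp: cox_word_def)
    have "count_list (drop j u) y \<le> count_list (drop j u) x \<and> count_list (drop j u) x \<le> Suc (count_list (drop j u) y)"
    proof (cases "first_index c x < first_index c y")
      case True
      have "height c x \<noteq> height c y" using height_conj_order(1)[OF c xy(1,2) nc True] xy ts by auto
      then have "height c x = Suc (height c y)" using height_interlace[OF c xy(1,2) nc True] by simp
      moreover have "count_list (take j u) y \<le> count_list (take j u) x \<and> count_list (take j u) x \<le> Suc (count_list (take j u) y)"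
        using il True xy nc unfolding interlaced_def by blast
      ultimately show ?thesis using sum[OF xy(1)] sum[OF xy(2)] by linarith
    next
      case False
      then have lt: "first_index c y < first_index c x" using neq by simp
      have nc': "y \<otimes>\<^bsub>W\<^esub> x \<noteq> x \<otimes>\<^bsub>W\<^esub> y" using nc by metis
      have "height c y \<noteq> Suc (height c x)" using height_conj_order(2)[OF c xy(2,1) nc' lt] xy ts by auto
      then have "height c x = height c y" using height_interlace[OF c xy(2,1) nc' lt] by simp
      moreover have "count_list (take j u) x \<le> count_list (take j u) y \<and> count_list (take j u) y \<le> Suc (count_list (take j u) x)"
        using il lt xy nc' unfolding interlaced_def by blast
      ultimately show ?thesis using sum[OF xy(1)] sum[OF xy(2)] by linarith
    qed
    then show "count_list (take k (map \<phi> (rev u))) t \<le> count_list (take k (map \<phi> (rev u))) s \<and>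
        count_list (take k (map \<phi> (rev u))) s \<le> Suc (count_list (take k (map \<phi> (rev u))) t)"
      unfolding cnt[OF st(1)] cnt[OF st(2)] by (simp add: x_def y_def)
  qed
  moreover have "count_list (map \<phi> (rev u)) s = height (rev c) s + e" if s: "s \<in> S" for s
    using G[of "\<phi> s"] height_rev[OF c, of "\<phi> s"] s uS
    by (simp add: count_list_map_conj conj_longest_gen conj_longest_involution)
  moreover have "map \<phi> (rev u) \<in> lists S" using uS conj_longest_gen by (auto simp: lists_eq_set)
  ultimately show ?thesis by (simp add: heap_def alternating_def)
qed

text \<open>Interlacing compares noncommuting letters only, and a commutation preserves their
  order.\<close>

lemma commutations_cox_word:
  assumes "commutations W c f d" "cox_word c"
  shows "cox_word d \<and> word_prod W d = word_prod W c \<and> (\<forall>g. interlaced d g \<longleftrightarrow> interlaced c g)"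
  using assms
proof (induction rule: commutations.induct)
  case id
  then show ?case by simp
next
  case (step f P a b R)
  have cw: "cox_word (P @ a # b # R)" using step by blast
  then have mem: "P \<in> lists S" "R \<in> lists S" "a \<in> S" "b \<in> S" by (auto simp: cox_word_def)
  have "word_prod W (P @ b # a # R) = word_prod W (P @ a # b # R)"
    using mem step.hyps by (simp add: word_prod_append gen_carrier m_assoc[symmetric])
  moreover have "cox_word (P @ b # a # R)" using cw by (auto simp: cox_word_def)
  moreover have "interlaced (P @ b # a # R) g \<longleftrightarrow> interlaced (P @ a # b # R) g" for g
  proof -
    have "first_index (P @ b # a # R) s < first_index (P @ b # a # R) t \<longleftrightarrow>
        first_index (P @ a # b # R) s < first_index (P @ a # b # R) t"
      if "s \<otimes>\<^bsub>W\<^esub> t \<noteq> t \<otimes>\<^bsub>W\<^esub> s" for s t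
    proof -
      have "\<not> (s = a \<and> t = b)" "\<not> (s = b \<and> t = a)" "s \<noteq> t" using that step.hyps by auto
      then show ?thesis
        using first_index_less_iff[of P s] first_index_less_iff[of P t]
        by (auto simp: first_index_append first_index_Cons)
    qed
    then show ?thesis unfolding interlaced_def by blast
  qed
  ultimately show ?case using step by simp
qed

lemma heap_commutations:
  assumes "cox_word c" "commutations W c f d"
  shows "heap d e u \<longleftrightarrow> heap c e u"
  using commutations_cox_word[OF assms(2,1)] height_cong[of d c] cox_word_lists assms(1)
  by (simp add: heap_def alternating_def)

end

section \<open>Labels and marked words\<close>

text \<open>The label of a position is its letter together with the number of earlier occurrences of that letter.
  Commutations preserve labels, and rotations act on them through the letter counts only.\<close>

definition label :: "'w list \<Rightarrow> nat \<Rightarrow> 'w \<times> nat" where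
  "label Q i = (Q ! i, count_list (take i Q) (Q ! i))"

lemma count_list_take_mono: "i \<le> j \<Longrightarrow> count_list (take i Q) x \<le> count_list (take j Q) x"
  using take_add[of i "j - i" Q] by simp

lemma label_less:
  assumes "i < j" "j < length Q"
  shows "label Q i \<noteq> label Q j"
proof
  assume eq: "label Q i = label Q j"
  have "count_list (take (Suc i) Q) (Q ! i) = Suc (count_list (take i Q) (Q ! i))"
    using assms by (simp add: take_Suc_conv_app_nth)
  moreover have "count_list (take (Suc i) Q) (Q ! i) \<le> count_list (take j Q) (Q ! i)"
    using assms by (intro count_list_take_mono) simp
  moreover have "count_list (take i Q) (Q ! i) = count_list (take j Q) (Q ! i)"
    using eq by (auto simp: label_def)
  ultimately show False by linarith
qed

lemma label_inj: "i < length Q \<Longrightarrow> j < length Q \<Longrightarrow> label Q i = label Q j \<Longrightarrow> i = j"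
  using label_less by (metis linorder_neqE_nat)

lemma label_transpose:
  fixes P R :: "'w list"
  assumes "a \<noteq> b" "j < length (P @ a # b # R)"
  defines "\<tau> \<equiv> Transposition.transpose (length P) (Suc (length P))"
  shows "\<tau> j < length (P @ a # b # R) \<and> label (P @ b # a # R) (\<tau> j) = label (P @ a # b # R) j"
proof -
  have "j < length P \<or> j = length P \<or> j = Suc (length P) \<or> (\<exists>i. j = length P + Suc (Suc i))"
    by presburger
  then consider "j < length P" | "j = length P" | "j = Suc (length P)" | i where "j = length P + Suc (Suc i)"
    by blast
  then show ?thesis
    by cases (use assms in \<open>auto simp: label_def \<tau>_def Transposition.transpose_def nth_append Suc_diff_le\<close>)
qed

lemma bij_betw_labels:
  fixes m :: nat
  assumes "\<And>i. i < m \<Longrightarrow> f i < m \<and> g (f i) = h i" "inj_on h {..<m}"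
  shows "bij_betw f {..<m} {..<m}"
proof -
  have "inj_on f {..<m}" using assms by (metis inj_on_def lessThan_iff)
  moreover have "f ` {..<m} \<subseteq> {..<m}" using assms by auto
  ultimately show ?thesis using endo_inj_surj[of "{..<m}" f] by (simp add: bij_betw_def)
qed

lemma inj_on_label: "inj_on (label Q) {..<length Q}"
  using label_inj by (auto simp: inj_on_def)

text \<open>Values outside the positions are recorded as well, because
  \<open>commutation_bij\<close> has to determine a function on all numbers.\<close>

lemma commutations_label:
  assumes "commutations W Q f R"
  shows "length R = length Q \<and> (\<forall>i<length Q. f i < length Q \<and> label R (f i) = label Q i) \<and>
    (\<forall>i\<ge>length Q. f i = i)"
  using assms
proof induction
  case id
  then show ?case by simp
next
  case (step f P a b R)
  let ?\<tau> = "Transposition.transpose (length P) (Suc (length P))"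
  have len: "length (P @ a # b # R) = length Q" "length (P @ b # a # R) = length Q"
    using step.IH by simp_all
  have "?\<tau> i = i" if "i \<ge> length Q" for i
    using that len by (auto simp: Transposition.transpose_def)
  then have "(?\<tau> \<circ> f) i = i" if "i \<ge> length Q" for i using step.IH that by simp
  moreover have "(?\<tau> \<circ> f) i < length Q \<and> label (P @ b # a # R) ((?\<tau> \<circ> f) i) = label Q i" if "i < length Q" for i
    using label_transpose[OF step.hyps(2), of "f i" P R] step.IH that len(1) unfolding comp_apply by metis
  ultimately show ?case using len by blast
qed

lemma commutations_bij: "commutations W Q f R \<Longrightarrow> bij_betw f {..<length Q} {..<length Q}"
  using commutations_label[of W Q f R] inj_on_label[of Q] bij_betw_labels[of "length Q" f "label R" "label Q"]
  by blast

lemma commutation_bij_eq: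
  assumes "commutations W Q f R"
  shows "commutation_bij W Q R = f"
  unfolding commutation_bij_def
proof (rule the_equality)
  show "commutations W Q f R" by (rule assms)
next
  fix g assume g: "commutations W Q g R"
  show "g = f"
  proof
    fix i
    show "g i = f i"
      using commutations_label[OF g] commutations_label[OF assms] label_inj[of "g i" R "f i"]
      by (cases "i < length Q") auto
  qed
qed

text \<open>A set I of positions of Q is encoded by marking the letters of Q at the positions in I, so that rotations,
  reversals and commutations become operations on lists.\<close>

definition mark :: "'w list \<Rightarrow> nat set \<Rightarrow> ('w \<times> bool) list" where
  "mark Q I = map (\<lambda>i. (Q ! i, i \<in> I)) [0..<length Q]"

definition unmarked :: "('w \<times> bool) list \<Rightarrow> 'w list" where
  "unmarked L = map fst (filter (\<lambda>x. \<not> snd x) L)"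

lemma unmarked_Nil [simp]: "unmarked [] = []"
  and unmarked_Cons [simp]: "unmarked (x # L) = (if snd x then unmarked L else fst x # unmarked L)"
  and unmarked_append [simp]: "unmarked (L @ M) = unmarked L @ unmarked M"
  by (auto simp: unmarked_def)

lemma length_mark [simp]: "length (mark Q I) = length Q"
  by (simp add: mark_def)

lemma map_fst_mark: "map fst (mark Q I) = Q"
  by (simp add: mark_def comp_def map_nth)

lemma mark_Nil [simp]: "mark [] I = []"
  by (simp add: mark_def)

lemma mark_Cons: "mark (a # Q) I = (a, 0 \<in> I) # mark Q {i. Suc i \<in> I}"
proof -
  have "[0..<Suc (length Q)] = 0 # map Suc [0..<length Q]"
    by (simp add: map_Suc_upt upt_conv_Cons del: upt_Suc)
  then show ?thesis by (simp add: mark_def comp_def del: upt_Suc)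
qed

lemma mark_append: "mark (P @ Q) I = mark P I @ mark Q {i. i + length P \<in> I}"
  by (induction P arbitrary: I) (simp_all add: mark_Cons)

lemma mark_cong: "(\<And>i. i < length Q \<Longrightarrow> i \<in> I \<longleftrightarrow> i \<in> J) \<Longrightarrow> mark Q I = mark Q J"
  by (simp add: mark_def)

lemma nths_conv_nth: "nths Q A = map (\<lambda>i. Q ! i) (filter (\<lambda>i. i \<in> A) [0..<length Q])"
proof -
  have "zip Q [0..<length Q] = map (\<lambda>i. (Q ! i, i)) [0..<length Q]"
    by (intro nth_equalityI) auto
  then show ?thesis by (simp add: nths_def filter_map comp_def)
qed

lemma nths_mark:
  assumes "k \<le> length Q"
  shows "nths Q ({..<k} - I) = unmarked (take k (mark Q I))"
proof -
  have "[0..<length Q] = [0..<k] @ [k..<length Q]" using assms upt_add_eq_append[of 0 k "length Q - k"] by simp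
  moreover have "filter (\<lambda>i. i \<in> {..<k} - I) [k..<length Q] = []" by (auto simp: filter_empty_conv)
  moreover have "filter (\<lambda>i. i \<in> {..<k} - I) [0..<k] = filter (\<lambda>i. i \<notin> I) [0..<k]"
    by (rule filter_cong) auto
  ultimately have "nths Q ({..<k} - I) = map (\<lambda>i. Q ! i) (filter (\<lambda>i. i \<notin> I) [0..<k])"
    by (simp add: nths_conv_nth)
  also have "\<dots> = unmarked (take k (mark Q I))"
    using assms by (simp add: unmarked_def mark_def take_map filter_map comp_def)
  finally show ?thesis .
qed

lemma mark_transpose:
  fixes P R :: "'w list" and J :: "nat set"
  defines "k \<equiv> length P"
  defines "\<tau> \<equiv> Transposition.transpose k (Suc k)"
  shows "mark (P @ a # b # R) J = mark P J @ (a, k \<in> J) # (b, Suc k \<in> J) # mark R {i. Suc (Suc (i + k)) \<in> J}"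
    and "mark (P @ b # a # R) (\<tau> ` J) = mark P J @ (b, Suc k \<in> J) # (a, k \<in> J) # mark R {i. Suc (Suc (i + k)) \<in> J}"
proof -
  show "mark (P @ a # b # R) J = mark P J @ (a, k \<in> J) # (b, Suc k \<in> J) # mark R {i. Suc (Suc (i + k)) \<in> J}"
    by (simp add: mark_append mark_Cons k_def)
  have inv: "j \<in> \<tau> ` J \<longleftrightarrow> \<tau> j \<in> J" for j
  proof -
    have t: "\<tau> (\<tau> i) = i" for i by (simp add: \<tau>_def)
    show ?thesis by (metis image_iff t)
  qed
  have "mark P (\<tau> ` J) = mark P J"
    by (rule mark_cong) (unfold inv, auto simp: \<tau>_def k_def Transposition.transpose_def)
  then show "mark (P @ b # a # R) (\<tau> ` J) = mark P J @ (b, Suc k \<in> J) # (a, k \<in> J) # mark R {i. Suc (Suc (i + k)) \<in> J}"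
    unfolding mark_append mark_Cons mem_Collect_eq inv
    by (simp add: k_def[symmetric]) (simp add: \<tau>_def Transposition.transpose_def)
qed

lemma mark_rotate:
  assumes "I \<subseteq> {..<Suc (length Q)}"
  shows "mark (Q @ [r]) (rotation_pos (Suc (length Q)) ` I) = mark Q {i. Suc i \<in> I} @ [(r, 0 \<in> I)]"
proof -
  have 1: "i \<in> rotation_pos (Suc (length Q)) ` I \<longleftrightarrow> Suc i \<in> I" if "i < length Q" for i
    using that by (force simp: rotation_pos_def image_iff)
  have 2: "length Q \<in> rotation_pos (Suc (length Q)) ` I \<longleftrightarrow> 0 \<in> I"
    using assms by (force simp: rotation_pos_def image_iff)
  have "mark Q (rotation_pos (Suc (length Q)) ` I) = mark Q {i. Suc i \<in> I}"
    by (rule mark_cong) (simp add: 1)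
  then show ?thesis using 2 by (simp add: mark_append mark_Cons)
qed

lemma mark_reverse:
  assumes "I \<subseteq> {..<length Q}"
  shows "mark (map f (rev Q)) ((\<lambda>i. length Q - 1 - i) ` I) = map (\<lambda>x. (f (fst x), snd x)) (rev (mark Q I))"
proof (rule nth_equalityI)
  fix j assume "j < length (mark (map f (rev Q)) ((\<lambda>i. length Q - 1 - i) ` I))"
  then have j: "j < length Q" by simp
  have "j \<in> (\<lambda>i. length Q - 1 - i) ` I \<longleftrightarrow> length Q - Suc j \<in> I"
  proof
    assume "j \<in> (\<lambda>i. length Q - 1 - i) ` I"
    then obtain i where "i \<in> I" "j = length Q - 1 - i" by blast
    then show "length Q - Suc j \<in> I" using assms by auto
  next
    assume "length Q - Suc j \<in> I"
    then show "j \<in> (\<lambda>i. length Q - 1 - i) ` I" using j by (intro image_eqI[of _ _ "length Q - Suc j"]) auto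
  qed
  moreover have "length Q - Suc j < length Q" using j by simp
  ultimately show "mark (map f (rev Q)) ((\<lambda>i. length Q - 1 - i) ` I) ! j = map (\<lambda>x. (f (fst x), snd x)) (rev (mark Q I)) ! j"
    using j by (simp add: mark_def rev_nth)
qed simp

section \<open>Brick vectors of marked words\<close>

context finite_coxeter
begin

text \<open>For L = \<open>mark Q I\<close> this says that I is a facet: the letters outside I spell
  a reduced word of the longest element; see \<open>facets_iff\<close>.\<close>

definition marked_word :: "('w \<times> bool) list \<Rightarrow> bool" where
  "marked_word L \<longleftrightarrow> map fst L \<in> lists S \<and> word_prod W (unmarked L) = w\<^sub>0 \<and> length (unmarked L) = card pos_roots"

text \<open>Besides brick vectors of facets this also covers \<Omega>, as the value at the sorting
  word without marks; see \<open>Omega_eq\<close>.\<close>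

definition brick :: "('w \<times> bool) list \<Rightarrow> 'v" where
  "brick L = (\<Sum>k<length L. act (unmarked (take k L)) (\<omega> (fst (L ! k))))"

lemma unmarked_lists: "map fst L \<in> lists S \<Longrightarrow> unmarked L \<in> lists S"
  by (induction L) auto

lemma brick_Nil [simp]: "brick [] = 0"
  by (simp add: brick_def)

lemma brick_Cons:
  assumes "fst x \<in> S" "map fst L \<in> lists S"
  shows "brick (x # L) = \<omega> (fst x) + (if snd x then brick L else \<rho> (fst x) (brick L))"
proof -
  have L: "unmarked (take k L) \<in> lists S" for k
    using assms(2) by (intro unmarked_lists) (auto simp: lists_eq_set dest: in_set_takeD)
  have "brick (x # L) = \<omega> (fst x) + (\<Sum>k<length L. act (unmarked (x # take k L)) (\<omega> (fst (L ! k))))"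
    unfolding brick_def list.size(4) add_Suc_right add_0_right sum.lessThan_Suc_shift by simp
  also have "(\<Sum>k<length L. act (unmarked (x # take k L)) (\<omega> (fst (L ! k)))) =
      (if snd x then brick L else act [fst x] (brick L))"
    using assms L unfolding brick_def
    by (auto simp: act_sum act_Cons gen_carrier simp del: word_prod_Cons intro!: sum.cong)
  finally show ?thesis using assms by (simp add: act_single del: word_prod_Cons)
qed

lemma brick_append:
  assumes "map fst L \<in> lists S" "map fst M \<in> lists S"
  shows "brick (L @ M) = brick L + act (unmarked L) (brick M)"
  using assms(1)
proof (induction L)
  case (Cons x L)
  then have x: "fst x \<in> S" "map fst L \<in> lists S" by auto
  have "brick ((x # L) @ M) = \<omega> (fst x) + (if snd x then brick (L @ M) else \<rho> (fst x) (brick (L @ M)))"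
    using brick_Cons[of x "L @ M"] x assms(2) by simp
  also have "\<dots> = brick (x # L) + act (unmarked (x # L)) (brick M)"
  proof -
    have "\<rho> (fst x) (u + v) = \<rho> (fst x) u + \<rho> (fst x) v" for u v
      using act_add[of "[fst x]" u v] x by (simp add: gen_carrier)
    then show ?thesis using x Cons.IH unmarked_lists[of L]
      by (auto simp: brick_Cons act_Cons simp del: word_prod_Cons)
  qed
  finally show ?case .
qed simp

lemma brick_snoc:
  assumes "map fst L \<in> lists S" "fst x \<in> S"
  shows "brick (L @ [x]) = brick L + act (unmarked L) (\<omega> (fst x))"
  using brick_append[of L "[x]"] assms act_zero[of "[fst x]"] by (simp add: brick_Cons gen_carrier)

text \<open>Each of the two distinct letters fixes the fundamental weight of the other, so their
  weights merely trade places, and later weights see the same product.\<close>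

lemma brick_swap:
  assumes L: "map fst L \<in> lists S" "map fst M \<in> lists S" and x: "fst x \<in> S" and y: "fst y \<in> S"
    and xy: "fst x \<noteq> fst y" "fst x \<otimes>\<^bsub>W\<^esub> fst y = fst y \<otimes>\<^bsub>W\<^esub> fst x"
  shows "brick (L @ y # x # M) = brick (L @ x # y # M)"
proof -
  have com: "\<rho> (fst x) (\<rho> (fst y) v) = \<rho> (fst y) (\<rho> (fst x) v)" for v
    using xy x y by (metis action_mult gen_carrier)
  have add: "\<rho> s (u + v) = \<rho> s u + \<rho> s v" if "s \<in> S" for s u v
    using act_add[of "[s]" u v] that by (simp add: gen_carrier)
  have fix1: "\<rho> (fst x) (\<omega> (fst y)) = \<omega> (fst y)" "\<rho> (fst y) (\<omega> (fst x)) = \<omega> (fst x)"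
    using xy x y by (simp_all add: gen_weight)
  have "brick (y # x # M) = brick (x # y # M)"
    using x y L com add fix1 by (simp add: brick_Cons)
  then show ?thesis using brick_append[of L "y # x # M"] brick_append[of L "x # y # M"] L x y by simp
qed

lemma marked_word_swap:
  assumes "marked_word (L @ x # y # M)" "fst x \<otimes>\<^bsub>W\<^esub> fst y = fst y \<otimes>\<^bsub>W\<^esub> fst x"
  shows "marked_word (L @ y # x # M)"
proof -
  have mem: "unmarked L \<in> lists S" "unmarked M \<in> lists S" "fst x \<in> S" "fst y \<in> S"
    using assms(1) unmarked_lists[of L] unmarked_lists[of M] by (auto simp: marked_word_def)
  then have "word_prod W (unmarked (L @ y # x # M)) = word_prod W (unmarked (L @ x # y # M))"
    using assms(2) by (auto simp: word_prod_append gen_carrier m_assoc[symmetric])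
  then show ?thesis using assms(1) by (auto simp: marked_word_def)
qed

text \<open>Let a be the first letter. If it is marked, the rest spells the longest element, so the
  lost weight is \<open>\<omega> a\<close> and the new one \<open>- \<omega> a\<close>. If it is
  unmarked, a is cancelled in front of all later weights, and the new one is
  \<open>- \<rho> a (\<omega> a)\<close>.\<close>

lemma marked_word_rotate:
  assumes "marked_word (x # L)"
  shows "marked_word (L @ [(\<phi> (fst x), snd x)])"
    and "brick (L @ [(\<phi> (fst x), snd x)]) = (if snd x then id else \<rho> (fst x)) (brick (x # L) - 2 *\<^sub>R \<omega> (fst x))"
proof -
  let ?a = "fst x" and ?L = "L @ [(\<phi> (fst x), snd x)]"
  have mem: "?a \<in> S" "\<phi> ?a \<in> S" "map fst L \<in> lists S" "unmarked L \<in> lists S"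
    and w0: "word_prod W (unmarked (x # L)) = w\<^sub>0" and len: "length (unmarked (x # L)) = card pos_roots"
    using assms unmarked_lists[of L] conj_longest_gen by (auto simp: marked_word_def)
  have brick': "brick ?L = brick L + act (unmarked L) (\<omega> (\<phi> ?a))"
    using brick_snoc[OF mem(3), of "(\<phi> ?a, snd x)"] mem by simp
  have "marked_word ?L \<and> brick ?L = (if snd x then id else \<rho> ?a) (brick (x # L) - 2 *\<^sub>R \<omega> ?a)"
  proof (cases "snd x")
    case True
    have "act (unmarked L) (\<omega> (\<phi> ?a)) = - \<omega> ?a"
      using w0 True longest_weight[OF mem(2)] mem(1) by (simp add: conj_longest_involution)
    then have "brick ?L = brick (x # L) - 2 *\<^sub>R \<omega> ?a"
      using brick' True brick_Cons[OF mem(1,3)] by (simp add: scaleR_2)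
    then show ?thesis using True w0 len mem by (simp add: marked_word_def)
  next
    case False
    have U: "act (unmarked L) v = \<rho> ?a (\<rho> w\<^sub>0 v)" for v
    proof -
      have "\<rho> w\<^sub>0 v = act (?a # unmarked L) v" using w0 False by (simp del: word_prod_Cons)
      also have "\<dots> = \<rho> ?a (act (unmarked L) v)" using mem by (simp add: act_Cons del: word_prod_Cons)
      finally show ?thesis using gen_involution[OF mem(1)] by metis
    qed
    have "act (unmarked L) (\<omega> (\<phi> ?a)) = - \<rho> ?a (\<omega> ?a)"
      using longest_weight[OF mem(2)] mem(1) by (simp add: U conj_longest_involution gen_minus)
    moreover have "brick L = \<rho> ?a (brick (x # L)) - \<rho> ?a (\<omega> ?a)"
      using brick_Cons[OF mem(1,3)] False mem(1) gen_diff[of ?a "brick (x # L)" "\<omega> ?a"] gen_involution[OF mem(1)] by simp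
    ultimately have "brick ?L = \<rho> ?a (brick (x # L) - 2 *\<^sub>R \<omega> ?a)"
      using brick' mem(1) by (simp add: scaleR_2 gen_diff diff_diff_eq[symmetric])
    moreover have "word_prod W (unmarked L @ [\<phi> ?a]) = w\<^sub>0"
    proof (rule action_inj)
      show "word_prod W (unmarked L @ [\<phi> ?a]) \<in> carrier W" using mem by simp
      show "w\<^sub>0 \<in> carrier W" by (rule longest_carrier)
      fix v
      show "act (unmarked L @ [\<phi> ?a]) v = \<rho> w\<^sub>0 v"
        using mem by (simp add: act_append act_single U conj_longest_action longest_involution gen_involution
            del: word_prod_Cons)
    qed
    ultimately show ?thesis using False len mem by (simp add: marked_word_def)
  qed
  then show "marked_word ?L" "brick ?L = (if snd x then id else \<rho> ?a) (brick (x # L) - 2 *\<^sub>R \<omega> ?a)" by auto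
qed

text \<open>For a reduced word of the longest element this is the sum of the positive roots, the
  constant that appears when a marked word is reversed.\<close>

definition root_sum :: "'w list \<Rightarrow> 'v" where
  "root_sum U = (\<Sum>k<length U. act (take k U) (\<alpha> (U ! k)))"

lemma root_sum_snoc: "root_sum (U @ [a]) = root_sum U + act U (\<alpha> a)"
  by (simp add: root_sum_def nth_append)

lemma root_sum_longest:
  assumes "reduced_expression W S U w\<^sub>0"
  shows "root_sum U = \<Sum> pos_roots"
proof -
  have U: "U \<in> lists S" "pos_word U" using assms by (auto simp: reduced_expression_iff)
  let ?f = "\<lambda>k. act (take k U) (\<alpha> (U ! k))"
  have inv: "?f ` {..<length U} = pos_roots"
    using pos_word_inversions[OF U] longest_iff[OF U(1)] assms by (simp add: reduced_expression_iff)
  moreover have "card (?f ` {..<length U}) = card {..<length U}"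
    unfolding inv using assms by (simp add: reduced_longest_iff)
  then have "inj_on ?f {..<length U}" by (intro eq_card_imp_inj_on) auto
  ultimately show ?thesis unfolding root_sum_def by (metis (no_types, lifting) sum.reindex_cong)
qed

definition conj_mark :: "'w \<times> bool \<Rightarrow> 'w \<times> bool" where
  "conj_mark x = (\<phi> (fst x), snd x)"

lemma unmarked_conj_rev: "unmarked (map conj_mark (rev L)) = map \<phi> (rev (unmarked L))"
  by (induction L) (auto simp: conj_mark_def)

lemma act_map_conj: "U \<in> lists S \<Longrightarrow> act (map \<phi> U) v = \<rho> w\<^sub>0 (act U (\<rho> w\<^sub>0 v))"
proof (induction U arbitrary: v)
  case Nil
  then show ?case by (simp add: longest_involution)
next
  case (Cons a U)
  then have "map \<phi> U \<in> lists S" "\<phi> a \<in> S" using conj_longest_gen by (auto simp: lists_eq_set)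
  then show ?case using Cons by (simp add: act_Cons longest_gen del: word_prod_Cons)
qed

text \<open>Up to the sign, \<open>w\<^sub>0\<close> and the inverse of the unmarked product, the
  weight at a letter of the reversed word is the original prefix applied to the fundamental weight,
  with the letter itself included if it is unmarked. Including it subtracts the root met there,
  whence \<open>root_sum\<close>.\<close>

lemma brick_reverse:
  assumes "map fst L \<in> lists S"
  shows "brick (map conj_mark (rev L)) =
    - \<rho> w\<^sub>0 (act (rev (unmarked L)) (brick L - root_sum (unmarked L)))"
  using assms
proof (induction L rule: rev_induct)
  case Nil
  have "\<rho> w\<^sub>0 0 = 0" using longest_diff[of 0 0] by simp
  then show ?case by (simp add: root_sum_def)
next
  case (snoc x M)
  let ?a = "fst x" and ?U = "unmarked M"
  have mem: "?a \<in> S" "map fst M \<in> lists S" "?U \<in> lists S" "rev ?U \<in> lists S" "\<phi> ?a \<in> S"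
    using snoc.prems unmarked_lists[of M] conj_longest_gen by auto
  have cm: "fst (conj_mark x) = \<phi> ?a" "snd (conj_mark x) = snd x" by (simp_all add: conj_mark_def)
  have memr: "map fst (map conj_mark (rev M)) \<in> lists S"
    using mem(2) conj_longest_gen by (auto simp: lists_eq_set conj_mark_def)
  define B where "B = brick M - root_sum ?U"
  have IH: "brick (map conj_mark (rev M)) = - \<rho> w\<^sub>0 (act (rev ?U) B)"
    using snoc.IH mem(2) by (simp add: B_def)
  have B': "brick (map conj_mark (rev (M @ [x]))) =
      \<omega> (\<phi> ?a) + (if snd x then - \<rho> w\<^sub>0 (act (rev ?U) B) else \<rho> (\<phi> ?a) (- \<rho> w\<^sub>0 (act (rev ?U) B)))"
    using brick_Cons[of "conj_mark x" "map conj_mark (rev M)"] cm mem memr IH by simp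
  have add: "\<rho> w\<^sub>0 (u + v) = \<rho> w\<^sub>0 u + \<rho> w\<^sub>0 v" for u v
    using longest_diff[of u "- v"] by (simp add: longest_minus)
  have \<omega>: "\<rho> w\<^sub>0 (\<omega> ?a) = - \<omega> (\<phi> ?a)" using longest_weight mem by blast
  show ?case
  proof (cases "snd x")
    case True
    have "brick (M @ [x]) - root_sum (unmarked (M @ [x])) = B + act ?U (\<omega> ?a)"
      using brick_snoc[OF mem(2,1)] True by (simp add: B_def)
    then have "act (rev (unmarked (M @ [x]))) (brick (M @ [x]) - root_sum (unmarked (M @ [x])))
        = act (rev ?U) B + \<omega> ?a"
      using True mem by (simp add: act_add act_rev)
    then show ?thesis unfolding B' using True \<omega> by (simp add: add)
  next
    case False
    have "brick (M @ [x]) - root_sum (unmarked (M @ [x])) = B + act ?U (\<rho> ?a (\<omega> ?a))"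
      using brick_snoc[OF mem(2,1)] False mem
      by (simp add: B_def root_sum_snoc gen_weight act_diff)
    moreover have "rev (unmarked (M @ [x])) = ?a # rev ?U" using False by simp
    ultimately have "act (rev (unmarked (M @ [x]))) (brick (M @ [x]) - root_sum (unmarked (M @ [x])))
        = \<rho> ?a (act (rev ?U) (B + act ?U (\<rho> ?a (\<omega> ?a))))"
      using mem by (simp only: act_Cons)
    also have "\<dots> = \<rho> ?a (act (rev ?U) B + \<rho> ?a (\<omega> ?a))"
      using mem by (simp add: act_add act_rev)
    also have "\<dots> = \<rho> ?a (act (rev ?U) B) + \<omega> ?a"
      using act_add[of "[?a]"] mem by (simp add: gen_carrier gen_involution)
    finally show ?thesis unfolding B' using False \<omega> mem by (simp add: add longest_gen gen_minus)
  qed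
qed

text \<open>The inverse of the unmarked product is again the longest element, so it cancels against
  the \<open>w\<^sub>0\<close> in \<open>brick_reverse\<close>.\<close>

lemma marked_word_reverse:
  assumes L: "marked_word L"
  shows "marked_word (map conj_mark (rev L))"
    and "brick (map conj_mark (rev L)) = \<Sum> pos_roots - brick L"
proof -
  let ?U = "unmarked L"
  have U: "map fst L \<in> lists S" "?U \<in> lists S" "word_prod W ?U = w\<^sub>0" "length ?U = card pos_roots"
    using L unmarked_lists by (auto simp: marked_word_def)
  have rev: "act (rev ?U) v = \<rho> w\<^sub>0 v" for v
    using act_rev[OF U(2), of "\<rho> w\<^sub>0 v"] U(3) by (simp add: longest_involution)
  have red: "reduced_expression W S ?U w\<^sub>0" using U by (simp add: reduced_longest_iff')
  show "brick (map conj_mark (rev L)) = \<Sum> pos_roots - brick L"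
    using brick_reverse[OF U(1)] root_sum_longest[OF red] by (simp add: rev longest_involution)
  have "word_prod W (map \<phi> (rev ?U)) = w\<^sub>0"
  proof (rule action_inj)
    show "word_prod W (map \<phi> (rev ?U)) \<in> carrier W"
      using U conj_longest_gen by (intro word_prod_closed) (auto simp: lists_eq_set)
    show "act (map \<phi> (rev ?U)) v = \<rho> w\<^sub>0 v" for v
      using act_map_conj[of "rev ?U" v] U by (simp add: rev longest_involution)
  qed (rule longest_carrier)
  moreover have "map fst (map conj_mark (rev L)) \<in> lists S"
    using U(1) conj_longest_gen by (auto simp: lists_eq_set conj_mark_def)
  ultimately show "marked_word (map conj_mark (rev L))"
    using U by (simp add: marked_word_def unmarked_conj_rev)
qed

end

section \<open>The isomorphisms of subword complexes\<close>

lemma unmarked_mark_empty [simp]: "unmarked (mark Q {}) = Q"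
  by (induction Q) (simp_all add: mark_Cons)

lemma take_mark_empty: "take k (mark Q {}) = mark (take k Q) {}"
  by (auto simp: mark_def take_map min_def intro: map_cong)

lemma inj_on_image_subset:
  assumes "bij_betw p A A" "K \<subseteq> Pow A"
  shows "inj_on ((`) p) K"
  using inj_on_image_Pow[of p A] assms inj_on_subset unfolding bij_betw_def by blast

lemma commutations_count: "commutations W Q f R \<Longrightarrow> count_list R = count_list Q"
proof (induction rule: commutations.induct)
  case (step f P a b R)
  have "count_list (P @ b # a # R) = count_list (P @ a # b # R)" by (rule ext) simp
  then show ?case using step.IH by (simp only:)
qed simp

lemma rotation_pos_bij: "bij_betw (rotation_pos m) {..<m} {..<m}"
proof -
  have "inj_on (rotation_pos m) {..<m}" by (auto simp: inj_on_def rotation_pos_def split: if_splits)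
  moreover have "rotation_pos m ` {..<m} \<subseteq> {..<m}" by (auto simp: rotation_pos_def)
  ultimately show ?thesis using endo_inj_surj[of "{..<m}" "rotation_pos m"] by (simp add: bij_betw_def)
qed

lemma reverse_pos_bij: "bij_betw (\<lambda>i. m - 1 - i) {..<m} {..<m::nat}"
proof -
  have "inj_on (\<lambda>i. m - 1 - i) {..<m}" by (auto simp: inj_on_def)
  moreover have "(\<lambda>i. m - 1 - i) ` {..<m} \<subseteq> {..<m}" by auto
  ultimately show ?thesis using endo_inj_surj[of "{..<m}" "\<lambda>i. m - 1 - i"] by (simp add: bij_betw_def)
qed

text \<open>G stands for the letter counts. The first q becomes the last \<open>f q\<close>, whose
  index is the number of such letters left in the word; if \<open>f q = q\<close>, the removed
  letter must not be counted.\<close>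

definition rotate_label :: "('w \<Rightarrow> 'w) \<Rightarrow> 'w \<Rightarrow> ('w \<Rightarrow> nat) \<Rightarrow> 'w \<times> nat \<Rightarrow> 'w \<times> nat" where
  "rotate_label f q G x = (if fst x = q
     then (if snd x = 0 then (f q, G (f q) - (if f q = q then 1 else 0)) else (q, snd x - 1)) else x)"

definition rotate_count :: "('w \<Rightarrow> 'w) \<Rightarrow> 'w \<Rightarrow> ('w \<Rightarrow> nat) \<Rightarrow> 'w \<Rightarrow> nat" where
  "rotate_count f q G s = G s - (if s = q then 1 else 0) + (if s = f q then 1 else 0)"

lemma count_rotation: "count_list (Q @ [f q]) = rotate_count f q (count_list (q # Q))"
  by (auto simp: rotate_count_def fun_eq_iff)

lemma label_rotation:
  assumes "i < length (q # Q)"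
  shows "label (Q @ [f q]) (rotation_pos (length (q # Q)) i) = rotate_label f q (count_list (q # Q)) (label (q # Q) i)"
proof (cases i)
  case 0
  then show ?thesis by (auto simp: label_def rotation_pos_def rotate_label_def)
next
  case (Suc j)
  then show ?thesis using assms by (auto simp: label_def rotation_pos_def rotate_label_def nth_append)
qed

lemma label_reverse:
  assumes i: "i < length Q" and inj: "inj_on f (set Q)"
  shows "label (map f (rev Q)) (length Q - 1 - i) =
    (f (fst (label Q i)), count_list Q (fst (label Q i)) - 1 - snd (label Q i))"
proof -
  let ?x = "Q ! i"
  have n: "map f (rev Q) ! (length Q - 1 - i) = f ?x" using i by (simp add: rev_nth)
  have "take (length Q - 1 - i) (map f (rev Q)) = map f (rev (drop (Suc i) Q))"
    using i by (simp add: take_map take_rev)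
  moreover have "count_list (map f (rev (drop (Suc i) Q))) (f ?x) = count_list (drop (Suc i) Q) ?x"
  proof -
    have "count_list (map f R) (f ?x) = count_list R ?x" if "set R \<subseteq> set Q" for R
      using that
    proof (induction R)
      case (Cons r R)
      have "r \<in> set Q" "?x \<in> set Q" using Cons.prems i by simp_all
      then have "f r = f ?x \<longleftrightarrow> r = ?x" by (rule inj_on_eq_iff[OF inj])
      then show ?case using Cons by simp
    qed simp
    moreover have "set (rev (drop (Suc i) Q)) \<subseteq> set Q" by (simp add: set_drop_subset)
    ultimately have "count_list (map f (rev (drop (Suc i) Q))) (f ?x) = count_list (rev (drop (Suc i) Q)) ?x" by blast
    then show ?thesis by simp
  qed
  moreover have "count_list Q ?x = count_list (take i Q) ?x + 1 + count_list (drop (Suc i) Q) ?x"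
    using arg_cong[OF id_take_nth_drop[OF i], of "\<lambda>l. count_list l ?x"] by simp
  ultimately show ?thesis unfolding label_def n by simp
qed

lemma label_count: "i < length Q \<Longrightarrow> snd (label Q i) < count_list Q (fst (label Q i))"
  using arg_cong[OF id_take_nth_drop, of i Q "\<lambda>l. count_list l (Q ! i)"] by (simp add: label_def)

section \<open>Facets and the three kinds of isomorphisms between them\<close>

context finite_coxeter
begin

lemma length_sorting_word: "cox_word c \<Longrightarrow> length (sorting_word W S c) = card pos_roots"
  using sorting_word_reduced by (simp add: reduced_longest_iff)

definition cw_length :: nat where
  "cw_length = card S + card pos_roots"

lemma length_cw_word: "cox_word c \<Longrightarrow> length (cw_word W S c) = cw_length"
  using distinct_card[of c] by (simp add: cw_word_def cw_length_def length_sorting_word cox_word_def)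

lemma cw_word_lists: "cox_word c \<Longrightarrow> cw_word W S c \<in> lists S"
  using heap_cw_word by (simp add: heap_def)

text \<open>All reduced words of the longest element have the same length, so a face is maximal
  exactly when its whole complement spells such a word.\<close>

lemma facets_iff:
  assumes Q: "Q \<in> lists S"
  shows "I \<in> facets (subword_complex W S Q) \<longleftrightarrow> I \<subseteq> {..<length Q} \<and> marked_word (mark Q I)"
proof -
  have len: "length (nths Q Z) = card Z" if "Z \<subseteq> {..<length Q}" for Z
    unfolding length_nths using that by (intro arg_cong[of _ _ card]) auto
  have mk: "marked_word (mark Q I) \<longleftrightarrow> reduced_expression W S (nths Q ({..<length Q} - I)) w\<^sub>0" for I
    using Q unmarked_lists[of "mark Q I"] nths_mark[of "length Q" Q I]
    by (auto simp: marked_word_def reduced_longest_iff' map_fst_mark)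
  have card: "card Z = card pos_roots" if "Z \<subseteq> {..<length Q}" "reduced_expression W S (nths Q Z) w\<^sub>0" for Z
    using that len by (simp add: reduced_longest_iff)
  show ?thesis unfolding mk
  proof
    assume I: "I \<in> facets (subword_complex W S Q)"
    then obtain J where J: "I \<subseteq> {..<length Q}" "J \<subseteq> {..<length Q} - I" "reduced_expression W S (nths Q J) w\<^sub>0"
      by (auto simp: facets_def subword_complex_def)
    have "{..<length Q} - J \<in> subword_complex W S Q"
      using J by (auto simp: subword_complex_def intro!: exI[of _ J])
    moreover have "I \<subseteq> {..<length Q} - J" using J by blast
    ultimately have "{..<length Q} - J = I" using I unfolding facets_def by blast
    moreover have "{..<length Q} - ({..<length Q} - J) = J" using J by blast
    ultimately show "I \<subseteq> {..<length Q} \<and> reduced_expression W S (nths Q ({..<length Q} - I)) w\<^sub>0"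
      using J by metis
  next
    assume I: "I \<subseteq> {..<length Q} \<and> reduced_expression W S (nths Q ({..<length Q} - I)) w\<^sub>0"
    then have "I \<in> subword_complex W S Q" by (auto simp: subword_complex_def)
    moreover have "J = I" if J: "J \<in> subword_complex W S Q" "I \<subseteq> J" for J
    proof -
      obtain Z where Z: "J \<subseteq> {..<length Q}" "Z \<subseteq> {..<length Q} - J" "reduced_expression W S (nths Q Z) w\<^sub>0"
        using J(1) by (auto simp: subword_complex_def)
      have "card Z = card ({..<length Q} - I)" using card[of Z] card[of "{..<length Q} - I"] Z I by auto
      then have "Z = {..<length Q} - I" using Z J(2) by (intro card_subset_eq) auto
      then show ?thesis using Z I J(2) by blast
    qed
    ultimately show "I \<in> facets (subword_complex W S Q)" by (auto simp: facets_def)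
  qed
qed

lemma brick_vector_eq: "brick_vector W S \<rho> \<alpha> Q I = brick (mark Q I)"
  unfolding brick_vector_def brick_def weight_def length_mark
proof (rule sum.cong)
  fix k assume "k \<in> {..<length Q}"
  then show "act (nths Q ({..<k} - I)) (\<omega> (Q ! k)) = act (unmarked (take k (mark Q I))) (\<omega> (fst (mark Q I ! k)))"
    by (simp add: nths_mark) (simp add: mark_def)
qed simp

lemma Omega_eq: "Omega W S \<rho> \<alpha> c = brick (mark (sorting_word W S c) {})"
  unfolding Omega_def brick_def Let_def length_mark take_mark_empty unmarked_mark_empty
  by (intro sum.cong) (auto simp: mark_def)

lemma marked_word_sorting: "cox_word c \<Longrightarrow> marked_word (mark (sorting_word W S c) {})"
  using sorting_word_reduced by (simp add: marked_word_def reduced_longest_iff' map_fst_mark)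

lemma commutations_brick:
  assumes "commutations W Q f R" "Q \<in> lists S" "I \<subseteq> {..<length Q}"
  shows "R \<in> lists S \<and> brick (mark R (f ` I)) = brick (mark Q I) \<and>
    (marked_word (mark Q I) \<longrightarrow> marked_word (mark R (f ` I)))"
  using assms
proof (induction rule: commutations.induct)
  case id
  then show ?case by simp
next
  case (step f P a b R)
  let ?\<tau> = "Transposition.transpose (length P) (Suc (length P))"
  let ?J = "f ` I"
  define A x y B where "A = mark P ?J" and "x = (a, length P \<in> ?J)" and "y = (b, Suc (length P) \<in> ?J)"
    and "B = mark R {i. Suc (Suc (i + length P)) \<in> ?J}"
  have m: "mark (P @ a # b # R) ?J = A @ x # y # B" "mark (P @ b # a # R) (?\<tau> ` ?J) = A @ y # x # B"
    unfolding A_def x_def y_def B_def by (rule mark_transpose)+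
  have im: "(?\<tau> \<circ> f) ` I = ?\<tau> ` ?J" by (rule image_comp[symmetric])
  have mem: "P @ a # b # R \<in> lists S" using step by blast
  then have AB: "map fst A \<in> lists S" "map fst B \<in> lists S" "fst x \<in> S" "fst y \<in> S"
    by (auto simp: A_def B_def x_def y_def map_fst_mark)
  have xy: "fst x \<noteq> fst y" "fst x \<otimes>\<^bsub>W\<^esub> fst y = fst y \<otimes>\<^bsub>W\<^esub> fst x"
    using step.hyps by (auto simp: x_def y_def)
  have "brick (A @ y # x # B) = brick (A @ x # y # B)" using brick_swap AB xy by blast
  moreover have "marked_word (A @ x # y # B) \<longrightarrow> marked_word (A @ y # x # B)" using marked_word_swap xy(2) by blast
  moreover have "P @ b # a # R \<in> lists S" using mem by auto
  ultimately show ?case using step.IH step.prems unfolding im m by auto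
qed

definition defect :: "'w list \<Rightarrow> nat set \<Rightarrow> 'v" where
  "defect c I = brick (mark (cw_word W S c) I) - Omega W S \<rho> \<alpha> c"

abbreviation cw_facets :: "'w list \<Rightarrow> nat set set" where
  "cw_facets c \<equiv> facets (subword_complex W S (cw_word W S c))"

lemma cw_facets_iff:
  "cox_word c \<Longrightarrow> I \<in> cw_facets c \<longleftrightarrow> I \<subseteq> {..<cw_length} \<and> marked_word (mark (cw_word W S c) I)"
  by (simp add: facets_iff cw_word_lists length_cw_word)

lemma cw_facets_Pow: "cox_word c \<Longrightarrow> cw_facets c \<subseteq> Pow {..<cw_length}"
  using cw_facets_iff by auto

lemma sorting_word_first:
  assumes "cox_word (a # d)"
  obtains w where "sorting_word W S (a # d) = a # w"
proof -
  have a: "a \<in> S" using assms by (auto simp: cox_word_def)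
  have pos: "0 < height (a # d) a" using height_pos assms a by blast
  have "\<exists>w. sorting_prefix (a # d) (height (a # d)) (Suc p) = a # w" for p
  proof (induction p)
    case 0
    show ?case using pos by (simp add: sorting_prefix_Suc)
  next
    case (Suc p)
    then show ?case by (subst sorting_prefix_Suc) auto
  qed
  moreover have "0 < sorting_bound (a # d)"
    using pos a finite_S unfolding sorting_bound_def by (auto intro!: sum_pos2[of _ a])
  ultimately show ?thesis using that sorting_word_eq[OF assms] by (metis gr0_conv_Suc)
qed

definition rotate_pos :: "'w list \<Rightarrow> nat \<Rightarrow> nat" where
  "rotate_pos c = commutation_bij W (rotation W S (cw_word W S c)) (cw_word W S (rotate1 c)) \<circ>
     rotation_pos (length (cw_word W S c))"

lemma rotate_first_image: "rotate_first W S c I = rotate_pos c ` I"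
  by (simp add: rotate_first_def rotate_pos_def image_comp)

text \<open>The rotated word and the word of the rotated c are heaps with the same data, so they
  differ by commutations and \<open>rotate_first\<close> tracks letters. The rotation formula for
  brick vectors holds for the facet and for the unmarked sorting word: the terms with
  \<open>\<omega> a\<close> cancel in the defect, and what remains are applications of a, which
  change vectors by multiples of \<open>\<alpha> a\<close>.\<close>

lemma rotate_first_props:
  assumes c: "cox_word (a # d)"
  shows "bij_betw (rotate_pos (a # d)) {..<cw_length} {..<cw_length}" (is ?bij)
    and "i < cw_length \<Longrightarrow> label (cw_word W S (d @ [a])) (rotate_pos (a # d) i) =
      rotate_label \<phi> a (count_list (cw_word W S (a # d))) (label (cw_word W S (a # d)) i)" (is "_ \<Longrightarrow> ?lab")
    and "count_list (cw_word W S (d @ [a])) = rotate_count \<phi> a (count_list (cw_word W S (a # d)))" (is ?cnt)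
    and "I \<in> cw_facets (a # d) \<Longrightarrow> rotate_first W S (a # d) I \<in> cw_facets (d @ [a])" (is "_ \<Longrightarrow> ?facet")
    and "I \<in> cw_facets (a # d) \<Longrightarrow>
      \<exists>r. defect (d @ [a]) (rotate_first W S (a # d) I) = defect (a # d) I + r *\<^sub>R \<alpha> a" (is "_ \<Longrightarrow> ?def")
proof -
  let ?c = "a # d" and ?c' = "d @ [a]"
  have c': "cox_word ?c'" using c by (auto simp: cox_word_def)
  have a: "a \<in> S" using c by (auto simp: cox_word_def)
  obtain w where w: "sorting_word W S ?c = a # w" using sorting_word_first c by blast
  define u where "u = d @ a # w"
  have u: "cw_word W S ?c = a # u" by (simp add: cw_word_def w u_def)
  have len: "length (a # u) = cw_length" using length_cw_word[OF c] by (simp add: u)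
  have uS: "a # u \<in> lists S" "u @ [\<phi> a] \<in> lists S"
    using cw_word_lists[OF c] a conj_longest_gen by (auto simp: u)
  obtain f where f: "commutations W (u @ [\<phi> a]) f (cw_word W S ?c')"
    using heap_unique[OF c' heap_rotation[OF c] heap_cw_word[OF c']] heap_cw_word[OF c] u by metis
  have pos: "rotate_pos ?c = f \<circ> rotation_pos (length (a # u))"
    using commutation_bij_eq[OF f] by (simp add: rotate_pos_def u)
  have lf: "bij_betw f {..<cw_length} {..<cw_length}" using commutations_bij[OF f] len by simp
  show bij: ?bij unfolding pos len using lf rotation_pos_bij by (rule bij_betw_trans[rotated])
  show ?lab if i: "i < cw_length"
  proof -
    have "rotation_pos (length (a # u)) i < length (u @ [\<phi> a])"
      using i len by (auto simp: rotation_pos_def)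
    then have "label (cw_word W S ?c') (rotate_pos ?c i) = label (u @ [\<phi> a]) (rotation_pos (length (a # u)) i)"
      using commutations_label[OF f] by (simp add: pos)
    also have "\<dots> = rotate_label \<phi> a (count_list (a # u)) (label (a # u) i)"
      using i len by (intro label_rotation) simp
    finally show ?thesis by (simp add: u)
  qed
  show ?cnt using commutations_count[OF f] count_rotation[of u \<phi> a] by (simp add: u)
  have img: "rotate_first W S ?c I = f ` (rotation_pos (length (a # u)) ` I)" for I
    by (simp add: rotate_first_image pos image_comp)
  have step: "marked_word (mark (cw_word W S ?c') (rotate_first W S ?c I)) \<and>
      brick (mark (cw_word W S ?c') (rotate_first W S ?c I)) =
        (if 0 \<in> I then id else \<rho> a) (brick (mark (cw_word W S ?c) I) - 2 *\<^sub>R \<omega> a)"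
    if I: "I \<in> cw_facets ?c" for I
  proof -
    have sub: "I \<subseteq> {..<Suc (length u)}" "marked_word (mark (a # u) I)"
      using I cw_facets_iff[OF c] len by (auto simp: u)
    let ?I' = "rotation_pos (length (a # u)) ` I"
    have I': "?I' \<subseteq> {..<length (u @ [\<phi> a])}" using sub by (auto simp: rotation_pos_def)
    have mk: "mark (u @ [\<phi> a]) ?I' = mark u {i. Suc i \<in> I} @ [(\<phi> a, 0 \<in> I)]"
      using mark_rotate[OF sub(1)] by simp
    have "marked_word (mark (u @ [\<phi> a]) ?I') \<and>
      brick (mark (u @ [\<phi> a]) ?I') = (if 0 \<in> I then id else \<rho> a) (brick (mark (a # u) I) - 2 *\<^sub>R \<omega> a)"
      using marked_word_rotate[of "(a, 0 \<in> I)" "mark u {i. Suc i \<in> I}"] sub(2)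
      unfolding mk mark_Cons by simp
    then show ?thesis using commutations_brick[OF f uS(2) I'] by (simp add: img u)
  qed
  show ?facet if I: "I \<in> cw_facets ?c"
  proof -
    have "rotate_first W S ?c I \<subseteq> {..<cw_length}"
      unfolding rotate_first_image using bij I cw_facets_iff[OF c] unfolding bij_betw_def by blast
    then show ?thesis using step[OF I] cw_facets_iff[OF c'] by blast
  qed
  obtain g where g: "commutations W (w @ [\<phi> a]) g (sorting_word W S ?c')"
    using heap_unique[OF c' heap_rotation[OF c] heap_sorting_word[OF c']] heap_sorting_word[OF c] w by metis
  have wS: "w @ [\<phi> a] \<in> lists S" using sorting_word_lists[OF c] a conj_longest_gen by (auto simp: w)
  have mw: "mark (a # w) {} = (a, False) # mark w {}" "mark (w @ [\<phi> a]) {} = mark w {} @ [(\<phi> a, False)]"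
    by (simp_all add: mark_Cons mark_append)
  have Omega': "Omega W S \<rho> \<alpha> ?c' = \<rho> a (Omega W S \<rho> \<alpha> ?c - 2 *\<^sub>R \<omega> a)"
    using commutations_brick[OF g wS, of "{}"] marked_word_rotate(2)[of "(a, False)" "mark w {}"]
      marked_word_sorting[OF c] by (simp add: Omega_eq w mw)
  show ?def if I: "I \<in> cw_facets ?c"
  proof -
    have refl: "\<exists>r. \<rho> a v = v + r *\<^sub>R \<alpha> a" for v
      unfolding gen_reflection[OF a] reflection_def by (metis diff_conv_add_uminus scaleR_minus_left)
    define B Om where "B = brick (mark (cw_word W S ?c) I) - 2 *\<^sub>R \<omega> a" and "Om = Omega W S \<rho> \<alpha> ?c - 2 *\<^sub>R \<omega> a"
    obtain r1 r2 where r: "\<rho> a B = B + r1 *\<^sub>R \<alpha> a" "\<rho> a Om = Om + r2 *\<^sub>R \<alpha> a" using refl by metis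
    have D: "defect ?c I = B - Om" by (simp add: defect_def B_def Om_def)
    have D': "defect ?c' (rotate_first W S ?c I) = (if 0 \<in> I then B else \<rho> a B) - \<rho> a Om"
      using step[OF I] Omega' by (simp add: defect_def B_def Om_def)
    have "defect ?c' (rotate_first W S ?c I) = defect ?c I + ((if 0 \<in> I then 0 else r1) - r2) *\<^sub>R \<alpha> a"
      unfolding D D' r by (auto simp: algebra_simps)
    then show ?thesis by blast
  qed
qed

lemma commute_iso_props:
  assumes c: "cox_word c" and com: "commutations W c f e"
  defines "g \<equiv> commutation_bij W (cw_word W S c) (cw_word W S e)"
  shows "cox_word e" "bij_betw g {..<cw_length} {..<cw_length}"
    and "i < cw_length \<Longrightarrow> label (cw_word W S e) (g i) = label (cw_word W S c) i"
    and "count_list (cw_word W S e) = count_list (cw_word W S c)"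
    and "I \<in> cw_facets c \<Longrightarrow> commute_iso W S c e I \<in> cw_facets e"
    and "I \<in> cw_facets c \<Longrightarrow> defect e (commute_iso W S c e I) = defect c I"
proof -
  show e: "cox_word e" using commutations_cox_word[OF com c] by blast
  obtain h where h: "commutations W (cw_word W S c) h (cw_word W S e)"
    using heap_unique[OF c heap_cw_word[OF c]] heap_commutations[OF c com] heap_cw_word[OF e] by blast
  have gh: "g = h" unfolding g_def using h by (rule commutation_bij_eq)
  have len: "length (cw_word W S c) = cw_length" using length_cw_word c by blast
  show bij: "bij_betw g {..<cw_length} {..<cw_length}" using commutations_bij[OF h] len gh by simp
  show "i < cw_length \<Longrightarrow> label (cw_word W S e) (g i) = label (cw_word W S c) i"
    using commutations_label[OF h] len gh by simp
  show "count_list (cw_word W S e) = count_list (cw_word W S c)" using commutations_count[OF h] .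
  obtain h' where h': "commutations W (sorting_word W S c) h' (sorting_word W S e)"
    using heap_unique[OF c heap_sorting_word[OF c]] heap_commutations[OF c com] heap_sorting_word[OF e] by blast
  have Om: "Omega W S \<rho> \<alpha> e = Omega W S \<rho> \<alpha> c"
    using commutations_brick[OF h' sorting_word_lists[OF c], of "{}"] by (simp add: Omega_eq)
  assume I: "I \<in> cw_facets c"
  then have sub: "I \<subseteq> {..<length (cw_word W S c)}" "marked_word (mark (cw_word W S c) I)"
    using cw_facets_iff[OF c] len by auto
  have img: "commute_iso W S c e I = h ` I" by (simp add: commute_iso_def gh[symmetric] g_def)
  have *: "brick (mark (cw_word W S e) (h ` I)) = brick (mark (cw_word W S c) I)"
    "marked_word (mark (cw_word W S e) (h ` I))"
    using commutations_brick[OF h cw_word_lists[OF c] sub(1)] sub(2) by auto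
  have "h ` I \<subseteq> h ` {..<cw_length}" by (rule image_mono) (use sub(1) len in simp)
  also have "\<dots> = {..<cw_length}" using bij by (simp add: gh bij_betw_def)
  finally show "commute_iso W S c e I \<in> cw_facets e" using * cw_facets_iff[OF e] img by simp
  show "defect e (commute_iso W S c e I) = defect c I" using * by (simp add: defect_def Om img)
qed

definition psi2_pos :: "'w list \<Rightarrow> nat \<Rightarrow> nat" where
  "psi2_pos c = commutation_bij W (map \<phi> (rev (cw_word W S c))) (cw_word W S (rev c)) \<circ>
     (\<lambda>i. length (cw_word W S c) - 1 - i)"

lemma psi2_image: "psi2 W S c I = psi2_pos c ` I"
  by (simp add: psi2_def psi2_pos_def image_comp Let_def)

text \<open>Reversal subtracts both the brick vector of a facet and \<Omega> from the sum of the
  positive roots, so this sum cancels in the defect.\<close>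

lemma psi2_props:
  assumes c: "cox_word c"
  shows "bij_betw (psi2_pos c) {..<cw_length} {..<cw_length}" (is ?bij)
    and "i < cw_length \<Longrightarrow> label (cw_word W S (rev c)) (psi2_pos c i) =
      (\<phi> (fst (label (cw_word W S c) i)), count_list (cw_word W S c) (fst (label (cw_word W S c) i)) - 1 -
        snd (label (cw_word W S c) i))" (is "_ \<Longrightarrow> ?lab")
    and "s \<in> S \<Longrightarrow> count_list (cw_word W S (rev c)) s = count_list (cw_word W S c) (\<phi> s)" (is "_ \<Longrightarrow> ?cnt")
    and "I \<in> cw_facets c \<Longrightarrow> psi2 W S c I \<in> cw_facets (rev c)" (is "_ \<Longrightarrow> ?facet")
    and "I \<in> cw_facets c \<Longrightarrow> defect (rev c) (psi2 W S c I) = - defect c I" (is "_ \<Longrightarrow> ?def")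
proof -
  let ?Q = "cw_word W S c"
  let ?w = "sorting_word W S c"
  have c': "cox_word (rev c)" using c by (rule cox_word_rev)
  have len: "length ?Q = cw_length" using length_cw_word c by blast
  have Q: "?Q \<in> lists S" using cw_word_lists c by blast
  have QS: "map \<phi> (rev ?Q) \<in> lists S" using Q conj_longest_gen by (auto simp: lists_eq_set)
  obtain f where f: "commutations W (map \<phi> (rev ?Q)) f (cw_word W S (rev c))"
    using heap_unique[OF c' heap_reversal[OF c heap_cw_word[OF c]] heap_cw_word[OF c']] by blast
  have pos: "psi2_pos c = f \<circ> (\<lambda>i. cw_length - 1 - i)"
    using commutation_bij_eq[OF f] by (simp add: psi2_pos_def len)
  have bf: "bij_betw f {..<cw_length} {..<cw_length}" using commutations_bij[OF f] len by simp
  show bij: ?bij unfolding pos using bf reverse_pos_bij by (rule bij_betw_trans[rotated])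
  have inj: "inj_on \<phi> (set ?Q)"
  proof (rule inj_onI)
    fix x y assume "x \<in> set ?Q" "y \<in> set ?Q" "\<phi> x = \<phi> y"
    then show "x = y" using Q conj_longest_involution by (metis in_lists_conv_set)
  qed
  show ?lab if i: "i < cw_length"
  proof -
    have "label (cw_word W S (rev c)) (psi2_pos c i) = label (map \<phi> (rev ?Q)) (length ?Q - 1 - i)"
      using commutations_label[OF f] i len by (simp add: pos)
    also have "\<dots> = (\<phi> (fst (label ?Q i)), count_list ?Q (fst (label ?Q i)) - 1 - snd (label ?Q i))"
      using i len inj by (intro label_reverse) auto
    finally show ?thesis .
  qed
  show ?cnt if "s \<in> S"
    using commutations_count[OF f] count_list_map_conj[of "rev ?Q" s] that Q by simp
  have conj: "(\<lambda>x. (\<phi> (fst x), snd x)) = conj_mark" by (auto simp: conj_mark_def)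
  have rev_brick: "marked_word (mark (map \<phi> (rev R)) ((\<lambda>i. length R - 1 - i) ` I)) \<and>
      brick (mark (map \<phi> (rev R)) ((\<lambda>i. length R - 1 - i) ` I)) = \<Sum> pos_roots - brick (mark R I)"
    if "I \<subseteq> {..<length R}" "marked_word (mark R I)" for R I
    unfolding mark_reverse[OF that(1)] conj using marked_word_reverse[OF that(2)] by blast
  obtain g where g: "commutations W (map \<phi> (rev ?w)) g (sorting_word W S (rev c))"
    using heap_unique[OF c' heap_reversal[OF c heap_sorting_word[OF c]] heap_sorting_word[OF c']] by blast
  have wS: "map \<phi> (rev ?w) \<in> lists S"
    using sorting_word_lists[OF c] conj_longest_gen by (auto simp: lists_eq_set)
  have Om: "Omega W S \<rho> \<alpha> (rev c) = \<Sum> pos_roots - Omega W S \<rho> \<alpha> c"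
    using commutations_brick[OF g wS, of "{}"] rev_brick[of "{}" ?w] marked_word_sorting[OF c]
    by (simp add: Omega_eq)
  assume I: "I \<in> cw_facets c"
  then have sub: "I \<subseteq> {..<length ?Q}" "marked_word (mark ?Q I)" using cw_facets_iff[OF c] len by auto
  let ?I' = "(\<lambda>i. length ?Q - 1 - i) ` I"
  have I': "?I' \<subseteq> {..<length (map \<phi> (rev ?Q))}" using sub(1) by auto
  have img: "psi2 W S c I = f ` ?I'" by (simp add: psi2_image pos len image_comp)
  have *: "marked_word (mark (cw_word W S (rev c)) (psi2 W S c I))"
    "brick (mark (cw_word W S (rev c)) (psi2 W S c I)) = \<Sum> pos_roots - brick (mark ?Q I)"
    using commutations_brick[OF f QS I'] rev_brick[OF sub] by (auto simp: img)
  have "psi2_pos c ` I \<subseteq> psi2_pos c ` {..<cw_length}" by (rule image_mono) (use sub(1) len in simp)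
  also have "\<dots> = {..<cw_length}" using bij by (simp add: bij_betw_def)
  finally show ?facet using *(1) by (simp add: cw_facets_iff[OF c'] psi2_image)
  show ?def using * by (simp add: defect_def Om)
qed

end

section \<open>Sums over shift orbits\<close>

lemma bij_betw_lessThan: "bij_betw f {..<m} {..<m} \<Longrightarrow> i < m \<Longrightarrow> f i < (m::nat)"
  by (metis bij_betwE lessThan_iff)

lemma funpow_periodic:
  assumes "finite K" "inj_on f K" "f ` K \<subseteq> K" "x \<in> K"
  shows "\<exists>n>0. (f ^^ n) x = x"
proof -
  have mem: "(f ^^ k) y \<in> K" if "y \<in> K" for k y using that assms(3) by (induction k) auto
  have inj: "inj_on (f ^^ k) K" for k
  proof (induction k)
    case (Suc k)
    show ?case
    proof (rule inj_onI)
      fix y z assume yz: "y \<in> K" "z \<in> K" "(f ^^ Suc k) y = (f ^^ Suc k) z"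
      then have "(f ^^ k) y = (f ^^ k) z" using inj_onD[OF assms(2)] mem by simp
      then show "y = z" using Suc yz by (meson inj_onD)
    qed
  qed simp
  have "\<not> inj_on (\<lambda>k. (f ^^ k) x) UNIV"
  proof
    assume "inj_on (\<lambda>k. (f ^^ k) x) UNIV"
    then have "infinite ((\<lambda>k. (f ^^ k) x) ` UNIV)" using finite_imageD by blast
    moreover have "(\<lambda>k. (f ^^ k) x) ` UNIV \<subseteq> K" using mem assms(4) by auto
    ultimately show False using assms(1) finite_subset by blast
  qed
  then obtain i j where ij: "(f ^^ i) x = (f ^^ j) x" "i < j"
    unfolding inj_on_def by (metis linorder_neqE_nat)
  then have "(f ^^ i) ((f ^^ (j - i)) x) = (f ^^ i) x"
    by (metis add_diff_inverse_nat comp_apply funpow_add less_imp_not_less)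
  then have "(f ^^ (j - i)) x = x" using inj mem assms(4) by (meson inj_onD)
  then show ?thesis using ij(2) by (intro exI[of _ "j - i"]) simp
qed

lemma funpow_period_mult: "(f ^^ n) x = x \<Longrightarrow> (f ^^ (n * k)) x = x"
  by (induction k) (simp_all add: funpow_add)

lemma funpow_return:
  assumes "finite K" "inj_on f K" "f ` K \<subseteq> K" "x \<in> K"
  shows "\<exists>j. (f ^^ j) ((f ^^ k) x) = x" "\<exists>j. (f ^^ k) ((f ^^ j) x) = x"
proof -
  obtain n where n: "n > 0" "(f ^^ n) x = x" using funpow_periodic[OF assms] by blast
  have "(f ^^ (n * k)) x = x" using n(2) by (rule funpow_period_mult)
  moreover have "n * k = (n * k - k) + k" "n * k = k + (n * k - k)" using n(1) by auto
  ultimately have "(f ^^ (n * k - k)) ((f ^^ k) x) = x" "(f ^^ k) ((f ^^ (n * k - k)) x) = x"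
    by (metis comp_apply funpow_add)+
  then show "\<exists>j. (f ^^ j) ((f ^^ k) x) = x" "\<exists>j. (f ^^ k) ((f ^^ j) x) = x" by blast+
qed

definition orbit_of :: "('a \<Rightarrow> 'a) \<Rightarrow> 'a \<Rightarrow> 'a set" where
  "orbit_of f x = range (\<lambda>k. (f ^^ k) x)"

lemma orbit_of_mem: "(f ^^ k) x \<in> orbit_of f x"
  by (simp add: orbit_of_def)

lemma orbit_of_self: "x \<in> orbit_of f x"
  using orbit_of_mem[of 0 f x] by simp

lemma orbit_of_subset: "f ` K \<subseteq> K \<Longrightarrow> x \<in> K \<Longrightarrow> orbit_of f x \<subseteq> K"
proof -
  assume "f ` K \<subseteq> K" "x \<in> K"
  then have "(f ^^ k) x \<in> K" for k by (induction k) auto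
  then show ?thesis by (auto simp: orbit_of_def)
qed

lemma orbit_of_step: "y \<in> orbit_of f x \<Longrightarrow> orbit_of f y \<subseteq> orbit_of f x"
proof -
  assume "y \<in> orbit_of f x"
  then obtain k where "y = (f ^^ k) x" by (auto simp: orbit_of_def)
  then have "(f ^^ j) y = (f ^^ (j + k)) x" for j by (simp add: funpow_add)
  then show ?thesis by (auto simp: orbit_of_def)
qed

lemma orbit_of_eq:
  assumes "finite K" "inj_on f K" "f ` K \<subseteq> K" "x \<in> K" "y \<in> orbit_of f x"
  shows "orbit_of f y = orbit_of f x"
proof
  show "orbit_of f y \<subseteq> orbit_of f x" by (rule orbit_of_step[OF assms(5)])
  obtain k where k: "y = (f ^^ k) x" using assms(5) by (auto simp: orbit_of_def)
  obtain j where "(f ^^ j) y = x" using funpow_return(1)[OF assms(1-4)] k by blast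
  then have "x \<in> orbit_of f y" using orbit_of_mem by metis
  then show "orbit_of f x \<subseteq> orbit_of f y" by (rule orbit_of_step)
qed

lemma orbit_of_image:
  assumes "finite K" "inj_on f K" "f ` K \<subseteq> K" "x \<in> K"
  shows "f ` orbit_of f x = orbit_of f x"
proof
  show "f ` orbit_of f x \<subseteq> orbit_of f x"
  proof
    fix y assume "y \<in> f ` orbit_of f x"
    then obtain k where "y = (f ^^ Suc k) x" by (auto simp: orbit_of_def)
    then show "y \<in> orbit_of f x" using orbit_of_mem by metis
  qed
  show "orbit_of f x \<subseteq> f ` orbit_of f x"
  proof
    fix y assume y: "y \<in> orbit_of f x"
    then have "y \<in> K" using orbit_of_subset[OF assms(3,4)] by blast
    then obtain j where "f ((f ^^ j) y) = y" using funpow_return(2)[OF assms(1-3), of y 1] by auto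
    moreover have "(f ^^ j) y \<in> orbit_of f x" using orbit_of_step[OF y] orbit_of_mem[of j f y] by blast
    ultimately show "y \<in> f ` orbit_of f x" by (metis image_eqI)
  qed
qed

lemma shift_orbit_eq: "shift_orbit W S c I = orbit_of (shift W S c) I"
  by (auto simp: shift_orbit_def orbit_of_def)

lemma rotate_firsts_Suc:
  "rotate_firsts W S c (Suc k) I = rotate_firsts W S (rotate1 c) k (rotate_first W S c I)"
proof (induction k)
  case (Suc k)
  have "rotate k (rotate1 c) = rotate (Suc k) c" by (simp add: rotate1_rotate_swap)
  then show ?case using Suc by simp
qed simp

lemma shift_rotate_first: "shift W S (rotate1 c) (rotate_first W S c I) = rotate_first W S c (shift W S c I)"
  unfolding shift_def length_rotate1 rotate_firsts_Suc[symmetric] by simp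

section \<open>The shift and its effect on labels\<close>

context finite_coxeter
begin

text \<open>The state carries the letter counts along with the label, since they give the index of a
  letter that is moved to the end and are themselves changed by the rotation.\<close>

definition label_step :: "('w \<Rightarrow> nat) \<times> 'w \<times> nat \<Rightarrow> 'w \<Rightarrow> ('w \<Rightarrow> nat) \<times> 'w \<times> nat" where
  "label_step st q = (rotate_count \<phi> q (fst st), rotate_label \<phi> q (fst st) (snd st))"

text \<open>The two rotations can interfere only if \<open>\<phi>\<close> exchanges a and b. Then
  the letter just moved to the end must not be the one rotated next, which the positive counts
  ensure.\<close>

lemma label_step_commute:
  assumes "a \<in> S" "b \<in> S" "a \<noteq> b" "0 < G a" "0 < G b" "s \<in> S"
  shows "label_step (label_step (G, s, k) a) b = label_step (label_step (G, s, k) b) a"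
proof -
  have inv: "\<phi> (\<phi> a) = a" "\<phi> (\<phi> b) = b" using assms conj_longest_involution by auto
  have count: "rotate_count \<phi> b (rotate_count \<phi> a G) = rotate_count \<phi> a (rotate_count \<phi> b G)"
  proof
    fix r
    show "rotate_count \<phi> b (rotate_count \<phi> a G) r = rotate_count \<phi> a (rotate_count \<phi> b G) r"
      using assms(3-5) by (cases "r = a"; cases "r = b"; simp add: rotate_count_def)
  qed
  have "rotate_label \<phi> b (rotate_count \<phi> a G) (rotate_label \<phi> a G (s, k)) =
      rotate_label \<phi> a (rotate_count \<phi> b G) (rotate_label \<phi> b G (s, k))"
  proof (cases "s = a \<or> s = b")
    case False
    then show ?thesis by (simp add: rotate_label_def)
  next
    case True
    have ab: "\<phi> a = b \<longleftrightarrow> \<phi> b = a" "\<phi> a \<noteq> \<phi> b" using inv assms(3) by metis+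
    show ?thesis
      using True assms(3,4,5) ab by (cases "k = 0"; cases "\<phi> a = b"; cases "\<phi> a = a"; cases "\<phi> b = b")
        (auto simp: rotate_label_def rotate_count_def)
  qed
  with count show ?thesis by (simp add: label_step_def)
qed

primrec rotate_firsts_pos :: "'w list \<Rightarrow> nat \<Rightarrow> nat \<Rightarrow> nat" where
  "rotate_firsts_pos c 0 = id"
| "rotate_firsts_pos c (Suc k) = rotate_pos (rotate k c) \<circ> rotate_firsts_pos c k"

lemma rotate_firsts_image: "rotate_firsts W S c k I = rotate_firsts_pos c k ` I"
  by (induction k) (simp_all add: rotate_first_image image_comp comp_assoc)

lemma cox_word_rotate: "cox_word c \<Longrightarrow> cox_word (rotate k c)"
  by (auto simp: cox_word_def)

lemma rotate_Cons_nth: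
  assumes "k < length c"
  obtains d where "rotate k c = c ! k # d" "rotate (Suc k) c = d @ [c ! k]"
proof -
  have "c \<noteq> []" using assms by auto
  then have "rotate k c \<noteq> []" "hd (rotate k c) = c ! k" using assms by (simp_all add: hd_rotate_conv_nth)
  then obtain d where "rotate k c = c ! k # d" by (metis list.collapse)
  then show ?thesis using that by simp
qed

lemma rotate_firsts_pos_props:
  assumes c: "cox_word c" and k: "k \<le> length c"
  shows "bij_betw (rotate_firsts_pos c k) {..<cw_length} {..<cw_length} \<and>
    (\<forall>i<cw_length. foldl label_step (count_list (cw_word W S c), label (cw_word W S c) i) (take k c) =
      (count_list (cw_word W S (rotate k c)), label (cw_word W S (rotate k c)) (rotate_firsts_pos c k i))) \<and>
    (\<forall>I\<in>cw_facets c. rotate_firsts W S c k I \<in> cw_facets (rotate k c))"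
  using k
proof (induction k)
  case 0
  show ?case by (simp add: bij_betw_def inj_on_def)
next
  case (Suc k)
  have k: "k < length c" using Suc.prems by simp
  obtain d where d: "rotate k c = c ! k # d" "rotate (Suc k) c = d @ [c ! k]" using rotate_Cons_nth k by blast
  have cd: "cox_word (c ! k # d)" using cox_word_rotate[OF c, of k] d by simp
  have bij: "bij_betw (rotate_firsts_pos c k) {..<cw_length} {..<cw_length}"
    and lab: "\<And>i. i < cw_length \<Longrightarrow> foldl label_step (count_list (cw_word W S c), label (cw_word W S c) i) (take k c) =
      (count_list (cw_word W S (rotate k c)), label (cw_word W S (rotate k c)) (rotate_firsts_pos c k i))"
    and facet: "\<And>I. I \<in> cw_facets c \<Longrightarrow> rotate_firsts W S c k I \<in> cw_facets (c ! k # d)"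
    using Suc.IH k d(1) by simp_all
  note props = rotate_first_props[OF cd]
  have "bij_betw (rotate_firsts_pos c (Suc k)) {..<cw_length} {..<cw_length}"
    unfolding rotate_firsts_pos.simps d(1) using bij props(1) by (rule bij_betw_trans)
  moreover have "rotate_firsts W S c (Suc k) I \<in> cw_facets (rotate (Suc k) c)" if "I \<in> cw_facets c" for I
    unfolding rotate_firsts.simps comp_apply d using props(4)[OF facet[OF that]] by simp
  moreover have "foldl label_step (count_list (cw_word W S c), label (cw_word W S c) i) (take (Suc k) c) =
      (count_list (cw_word W S (rotate (Suc k) c)),
       label (cw_word W S (rotate (Suc k) c)) (rotate_firsts_pos c (Suc k) i))" if i: "i < cw_length" for i
  proof -
    have "rotate_firsts_pos c k i \<in> rotate_firsts_pos c k ` {..<cw_length}" using i by simp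
    then have ri: "rotate_firsts_pos c k i < cw_length" using bij by (simp add: bij_betw_def)
    have "take (Suc k) c = take k c @ [c ! k]" using k by (rule take_Suc_conv_app_nth)
    then have "foldl label_step (count_list (cw_word W S c), label (cw_word W S c) i) (take (Suc k) c) =
        label_step (count_list (cw_word W S (rotate k c)), label (cw_word W S (rotate k c)) (rotate_firsts_pos c k i)) (c ! k)"
      using lab[OF i] by simp
    also have "\<dots> = (count_list (cw_word W S (rotate (Suc k) c)),
        label (cw_word W S (rotate (Suc k) c)) (rotate_firsts_pos c (Suc k) i))"
      unfolding label_step_def fst_conv snd_conv rotate_firsts_pos.simps comp_apply d
      using props(2)[OF ri] props(3) by simp
    finally show ?thesis .
  qed
  ultimately show ?case by blast
qed

lemma shift_image: "shift W S c I = rotate_firsts_pos c (length c) ` I"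
  by (simp add: shift_def rotate_firsts_image)

lemma shift_pos_props:
  assumes c: "cox_word c"
  shows "bij_betw (rotate_firsts_pos c (length c)) {..<cw_length} {..<cw_length}"
    and "i < cw_length \<Longrightarrow> snd (foldl label_step (count_list (cw_word W S c), label (cw_word W S c) i) c) =
      label (cw_word W S c) (rotate_firsts_pos c (length c) i)"
    and "I \<in> cw_facets c \<Longrightarrow> shift W S c I \<in> cw_facets c"
  using rotate_firsts_pos_props[OF c order_refl] by (simp_all add: shift_def)

lemma cw_count_pos: "cox_word c \<Longrightarrow> s \<in> S \<Longrightarrow> 0 < count_list (cw_word W S c) s"
  using heap_cw_word unfolding heap_def by simp

lemma cw_label_gen: "cox_word c \<Longrightarrow> i < cw_length \<Longrightarrow> fst (label (cw_word W S c) i) \<in> S"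
  using cw_word_lists length_cw_word by (auto simp: label_def in_lists_conv_set)

text \<open>On labels, rotations of distinct letters commute, so the shift depends on the letters of c only.\<close>

lemma foldl_label_step_commutations:
  assumes "commutations W c f e" "cox_word c" "i < cw_length"
  shows "foldl label_step (count_list (cw_word W S e), label (cw_word W S c) i) e =
    foldl label_step (count_list (cw_word W S c), label (cw_word W S c) i) c"
  using assms
proof (induction arbitrary: i rule: commutations.induct)
  case id
  then show ?case by simp
next
  case (step f P a b R)
  let ?e = "P @ a # b # R" and ?e' = "P @ b # a # R"
  have com': "commutations W c (Transposition.transpose (length P) (Suc (length P)) \<circ> f) ?e'"
    using commutations.step[OF step.hyps(1-3)] .
  have e: "cox_word ?e" using commutations_cox_word[OF step.hyps(1) step.prems(1)] by blast
  note props = commute_iso_props[OF step.prems(1) step.hyps(1)]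
  define g where "g = commutation_bij W (cw_word W S c) (cw_word W S ?e)"
  have cnt: "count_list (cw_word W S ?e) = count_list (cw_word W S c)"
    "count_list (cw_word W S ?e') = count_list (cw_word W S c)"
    using props(4) commute_iso_props(4)[OF step.prems(1) com'] by simp_all
  have gi: "g i < cw_length" using bij_betw_lessThan[OF props(2) step.prems(2)] by (simp add: g_def)
  have lab: "label (cw_word W S ?e) (g i) = label (cw_word W S c) i"
    using props(3)[OF step.prems(2)] by (simp add: g_def)
  define e1 where "e1 = rotate (length P) ?e"
  define j where "j = rotate_firsts_pos ?e (length P) (g i)"
  have e1: "cox_word e1" unfolding e1_def using e by (rule cox_word_rotate)
  have j: "j < cw_length"
    using rotate_firsts_pos_props[OF e, of "length P"] gi unfolding j_def bij_betw_def by auto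
  have P: "foldl label_step (count_list (cw_word W S c), label (cw_word W S c) i) P =
      (count_list (cw_word W S e1), label (cw_word W S e1) j)"
    using rotate_firsts_pos_props[OF e, of "length P"] gi by (simp add: lab[symmetric] cnt[symmetric] e1_def j_def)
  have ab: "a \<in> S" "b \<in> S" using e by (auto simp: cox_word_def)
  obtain s k where sk: "label (cw_word W S e1) j = (s, k)" by fastforce
  have s: "s \<in> S" using cw_label_gen[OF e1 j] sk by simp
  have "label_step (label_step (count_list (cw_word W S e1), s, k) a) b =
      label_step (label_step (count_list (cw_word W S e1), s, k) b) a"
    using label_step_commute[OF ab step.hyps(2) cw_count_pos[OF e1 ab(1)] cw_count_pos[OF e1 ab(2)] s] .
  then have "foldl label_step (count_list (cw_word W S c), label (cw_word W S c) i) ?e' =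
      foldl label_step (count_list (cw_word W S c), label (cw_word W S c) i) ?e"
    by (simp add: P sk)
  then show ?case using step.IH[OF step.prems] unfolding cnt by metis
qed

text \<open>Positions are determined by their labels, on which the order of the rotations does not
  matter.\<close>

lemma shift_commute_iso:
  assumes c: "cox_word c" and com: "commutations W c f e" and I: "I \<subseteq> {..<cw_length}"
  shows "commute_iso W S c e (shift W S c I) = shift W S e (commute_iso W S c e I)"
proof -
  define g where "g = commutation_bij W (cw_word W S c) (cw_word W S e)"
  note props = commute_iso_props[OF c com, folded g_def]
  have "g (rotate_firsts_pos c (length c) i) = rotate_firsts_pos e (length e) (g i)" if i: "i < cw_length" for i
  proof (rule label_inj)
    let ?i = "rotate_firsts_pos c (length c) i"
    have i': "?i < cw_length" "g i < cw_length"
      using bij_betw_lessThan[OF shift_pos_props(1)[OF c] i] bij_betw_lessThan[OF props(2) i] by simp_all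
    show "g ?i < length (cw_word W S e)" "rotate_firsts_pos e (length e) (g i) < length (cw_word W S e)"
      using bij_betw_lessThan[OF props(2) i'(1)] bij_betw_lessThan[OF shift_pos_props(1)[OF props(1)] i'(2)]
        length_cw_word[OF props(1)] by simp_all
    have "label (cw_word W S e) (g ?i) = label (cw_word W S c) ?i" using props(3)[OF i'(1)] .
    also have "\<dots> = snd (foldl label_step (count_list (cw_word W S c), label (cw_word W S c) i) c)"
      using shift_pos_props(2)[OF c i] by simp
    also have "\<dots> = snd (foldl label_step (count_list (cw_word W S e), label (cw_word W S e) (g i)) e)"
      using foldl_label_step_commutations[OF com c i] props(3)[OF i] by simp
    also have "\<dots> = label (cw_word W S e) (rotate_firsts_pos e (length e) (g i))"
      using shift_pos_props(2)[OF props(1) i'(2)] .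
    finally show "label (cw_word W S e) (g ?i) = label (cw_word W S e) (rotate_firsts_pos e (length e) (g i))" .
  qed
  then show ?thesis
    using I unfolding commute_iso_def shift_image g_def[symmetric] image_image by (intro image_cong) auto
qed

text \<open>Rotation puts \<open>\<phi> a\<close> at the end, reversal turns it into a first letter
  a, and rotating this a leaves the reversal of the original word. On labels this is a finite case
  distinction.\<close>

lemma psi2_rotate:
  assumes c: "cox_word (a # d)" and I: "I \<subseteq> {..<cw_length}"
  shows "rotate_first W S (rev (d @ [a])) (psi2 W S (d @ [a]) (rotate_first W S (a # d) I)) = psi2 W S (a # d) I"
proof -
  let ?c = "a # d" and ?c' = "d @ [a]"
  have c': "cox_word ?c'" using c by (auto simp: cox_word_def)
  have rc': "cox_word (rev ?c')" using c' by (rule cox_word_rev)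
  then have rc'': "cox_word (a # rev d)" by simp
  have rc: "cox_word (rev ?c)" using c by (rule cox_word_rev)
  have a: "a \<in> S" using c by (auto simp: cox_word_def)
  have "rotate_pos (rev ?c') (psi2_pos ?c' (rotate_pos ?c i)) = psi2_pos ?c i" if i: "i < cw_length" for i
  proof (rule label_inj)
    let ?i1 = "rotate_pos ?c i"
    let ?i2 = "psi2_pos ?c' ?i1"
    have i1: "?i1 < cw_length" using bij_betw_lessThan[OF rotate_first_props(1)[OF c] i] .
    have i2: "?i2 < cw_length" using bij_betw_lessThan[OF psi2_props(1)[OF c'] i1] .
    show "rotate_pos (rev ?c') ?i2 < length (cw_word W S (rev ?c))" "psi2_pos ?c i < length (cw_word W S (rev ?c))"
      using bij_betw_lessThan[OF rotate_first_props(1)[OF rc''] i2] bij_betw_lessThan[OF psi2_props(1)[OF c] i]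
        length_cw_word[OF rc] by simp_all
    obtain s k where sk: "label (cw_word W S ?c) i = (s, k)" by fastforce
    define G where "G = count_list (cw_word W S ?c)"
    have s: "s \<in> S" using cw_label_gen[OF c i] sk by simp
    have k: "k < G s" using label_count[of i "cw_word W S ?c"] i length_cw_word[OF c] sk by (simp add: G_def)
    have Ga: "0 < G a" using cw_count_pos[OF c a] by (simp add: G_def)
    have inv: "\<phi> (\<phi> a) = a" "\<phi> (\<phi> s) = s" "\<phi> a \<in> S" using a s conj_longest_involution conj_longest_gen by auto
    have l1: "label (cw_word W S ?c') ?i1 = rotate_label \<phi> a G (s, k)"
      using rotate_first_props(2)[OF c i] sk by (simp add: G_def)
    have G1: "count_list (cw_word W S ?c') = rotate_count \<phi> a G"
      using rotate_first_props(3)[OF c] by (simp add: G_def)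
    have l2: "label (cw_word W S (rev ?c')) ?i2 = (\<phi> (fst (rotate_label \<phi> a G (s, k))),
       rotate_count \<phi> a G (fst (rotate_label \<phi> a G (s, k))) - 1 - snd (rotate_label \<phi> a G (s, k)))"
      using psi2_props(2)[OF c' i1] l1 G1 by simp
    have G2: "count_list (cw_word W S (rev ?c')) (\<phi> a) = rotate_count \<phi> a G a"
      using psi2_props(3)[OF c' inv(3)] G1 inv by simp
    have "label (cw_word W S (rev ?c)) (rotate_pos (rev ?c') ?i2) =
      rotate_label \<phi> a (count_list (cw_word W S (rev ?c'))) (label (cw_word W S (rev ?c')) ?i2)"
      using rotate_first_props(2)[OF rc'' i2] by simp
    also have "\<dots> = (\<phi> s, G s - 1 - k)"
      using k Ga inv G2 unfolding l2
      by (cases "s = a"; cases "k = 0"; cases "\<phi> a = a"; cases "\<phi> s = a")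
        (auto simp: rotate_label_def rotate_count_def)
    also have "\<dots> = label (cw_word W S (rev ?c)) (psi2_pos ?c i)"
      using psi2_props(2)[OF c i] sk by (simp add: G_def)
    finally show "label (cw_word W S (rev ?c)) (rotate_pos (rev ?c') ?i2) = label (cw_word W S (rev ?c)) (psi2_pos ?c i)" .
  qed
  then show ?thesis
    using I unfolding rotate_first_image psi2_image image_image by (intro image_cong) auto
qed

lemma psi2_rotate_firsts:
  assumes c: "cox_word c" and I: "I \<in> cw_facets c" and k: "k \<le> length c"
  shows "psi2 W S c I =
    rotate_firsts W S (rev (rotate k c)) k (psi2 W S (rotate k c) (rotate_firsts W S c k I))"
  using k
proof (induction k)
  case (Suc k)
  have k: "k < length c" using Suc.prems by simp
  obtain d where d: "rotate k c = c ! k # d" "rotate (Suc k) c = d @ [c ! k]" using rotate_Cons_nth k by blast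
  have cd: "cox_word (c ! k # d)" using cox_word_rotate[OF c, of k] d by simp
  have J: "rotate_firsts W S c k I \<subseteq> {..<cw_length}"
    using rotate_firsts_pos_props[OF c, of k] I cw_facets_iff[OF cd] k d(1) by simp
  have last: "rotate_firsts W S c (Suc k) I = rotate_first W S (c ! k # d) (rotate_firsts W S c k I)"
    by (simp add: d(1))
  have rev: "rotate1 (rev (d @ [c ! k])) = rev (c ! k # d)" by simp
  have "rotate_firsts W S (rev (rotate (Suc k) c)) (Suc k) (psi2 W S (rotate (Suc k) c) (rotate_firsts W S c (Suc k) I))
    = rotate_firsts W S (rev (c ! k # d)) k (rotate_first W S (rev (d @ [c ! k]))
        (psi2 W S (d @ [c ! k]) (rotate_first W S (c ! k # d) (rotate_firsts W S c k I))))"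
    unfolding last d(2) rotate_firsts_Suc[of W S "rev (d @ [c ! k])"] rev ..
  also have "\<dots> = rotate_firsts W S (rev (rotate k c)) k (psi2 W S (rotate k c) (rotate_firsts W S c k I))"
    unfolding psi2_rotate[OF cd J] d(1) by simp
  finally show ?case using Suc by simp
qed simp

text \<open>The conjugation into an inverse shift, stated as an equation without inverses so that it
  can be iterated.\<close>

lemma psi2_shift:
  assumes "cox_word c" "I \<in> cw_facets c"
  shows "psi2 W S c I = shift W S (rev c) (psi2 W S c (shift W S c I))"
  using psi2_rotate_firsts[OF assms order_refl] by (simp add: shift_def)

section \<open>Defects summed over shift-invariant sets of facets\<close>

lemma finite_cw_facets: "cox_word c \<Longrightarrow> finite (cw_facets c)"
  using cw_facets_Pow finite_subset by blast

lemma shift_inj: "cox_word c \<Longrightarrow> inj_on (shift W S c) (cw_facets c)"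
  using inj_on_image_subset[OF shift_pos_props(1) cw_facets_Pow, of c c] unfolding inj_on_def shift_image by simp

lemma shift_facets: "cox_word c \<Longrightarrow> shift W S c ` cw_facets c \<subseteq> cw_facets c"
  using shift_pos_props(3) by blast

lemma simple_combination_zero:
  assumes c: "cox_word c" and sum: "(\<Sum>k<length c. r k *\<^sub>R \<alpha> (c ! k)) = 0" and j: "j < length c"
  shows "r j = 0"
proof -
  have mem: "c ! k \<in> S" if "k < length c" for k using that c by (auto simp: cox_word_def)
  have "0 = (\<Sum>k<length c. r k * (\<alpha> (c ! k) \<bullet> \<omega> (c ! j)))"
    using arg_cong[OF sum, of "\<lambda>v. v \<bullet> \<omega> (c ! j)"] by (simp add: inner_sum_left)
  also have "\<dots> = (\<Sum>k<length c. if k = j then r j * (\<alpha> (c ! j) \<bullet> \<omega> (c ! j)) else 0)"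
    using c j by (intro sum.cong) (auto simp: cox_word_def weight_inner mem nth_eq_iff_index_eq)
  also have "\<dots> = r j * (\<alpha> (c ! j) \<bullet> \<omega> (c ! j))" using j by simp
  finally show ?thesis using weight_inner_self_pos[OF mem[OF j]] by auto
qed

text \<open>Each rotation changes the sum of the defects by a multiple of one simple root, and all these
  changes add up to zero after a full shift; hence each of them is zero.\<close>

lemma sum_defect_rotate_first:
  assumes c: "cox_word c" "c \<noteq> []" and O: "Z \<subseteq> cw_facets c" "shift W S c ` Z = Z"
  shows "(\<Sum>J\<in>Z. defect (rotate1 c) (rotate_first W S c J)) = (\<Sum>J\<in>Z. defect c J)"
proof -
  define T where "T k = (\<Sum>J\<in>Z. defect (rotate k c) (rotate_firsts W S c k J))" for k
  have "\<exists>r. T (Suc k) = T k + r *\<^sub>R \<alpha> (c ! k)" if k: "k < length c" for k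
  proof -
    obtain d where d: "rotate k c = c ! k # d" "rotate (Suc k) c = d @ [c ! k]" using rotate_Cons_nth k by blast
    have cd: "cox_word (c ! k # d)" using cox_word_rotate[OF c(1), of k] d by simp
    have "\<exists>r. defect (rotate (Suc k) c) (rotate_firsts W S c (Suc k) J) =
        defect (rotate k c) (rotate_firsts W S c k J) + r *\<^sub>R \<alpha> (c ! k)" if J: "J \<in> Z" for J
    proof -
      have "rotate_firsts W S c k J \<in> cw_facets (c ! k # d)"
        using rotate_firsts_pos_props[OF c(1), of k] k J O(1) d(1) by auto
      from rotate_first_props(5)[OF cd this] show ?thesis by (simp add: d)
    qed
    then obtain r where r: "\<And>J. J \<in> Z \<Longrightarrow> defect (rotate (Suc k) c) (rotate_firsts W S c (Suc k) J) =
        defect (rotate k c) (rotate_firsts W S c k J) + r J *\<^sub>R \<alpha> (c ! k)" by metis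
    have "T (Suc k) = T k + (\<Sum>J\<in>Z. r J) *\<^sub>R \<alpha> (c ! k)"
      unfolding T_def scaleR_sum_left sum.distrib[symmetric] by (rule sum.cong) (simp_all only: r)
    then show ?thesis by blast
  qed
  then obtain r where r: "\<And>k. k < length c \<Longrightarrow> T (Suc k) = T k + r k *\<^sub>R \<alpha> (c ! k)" by metis
  have "(\<Sum>k<length c. r k *\<^sub>R \<alpha> (c ! k)) = (\<Sum>k<length c. T (Suc k) - T k)"
    using r by (intro sum.cong) auto
  also have "\<dots> = T (length c) - T 0" by (rule sum_lessThan_telescope)
  also have "T (length c) = (\<Sum>J\<in>shift W S c ` Z. defect c J)"
    unfolding T_def using inj_on_subset[OF shift_inj[OF c(1)] O(1)] by (simp add: sum.reindex shift_def)
  also have "\<dots> = T 0" unfolding O(2) T_def by simp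
  finally have "(\<Sum>k<length c. r k *\<^sub>R \<alpha> (c ! k)) = 0" by simp
  then have "r 0 = 0" using simple_combination_zero[OF c(1)] c(2) by blast
  then have "T (Suc 0) = T 0" using r[of 0] c(2) by simp
  then show ?thesis by (simp add: T_def)
qed

text \<open>Equivariance is part of the induction because it makes the image of an invariant set
  invariant again, as \<open>sum_defect_rotate_first\<close> requires for the next rotation.\<close>

lemma rotation_path_props:
  assumes "rotation_path W S c F e" "cox_word c" "c \<noteq> []"
  shows "cox_word e \<and> inj_on F (cw_facets c) \<and> F ` cw_facets c \<subseteq> cw_facets e \<and>
    (\<forall>I\<in>cw_facets c. F (shift W S c I) = shift W S e (F I)) \<and>
    (\<forall>Z\<subseteq>cw_facets c. shift W S c ` Z = Z \<longrightarrow> (\<Sum>J\<in>Z. defect e (F J)) = (\<Sum>J\<in>Z. defect c J))"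
  using assms
proof (induction rule: rotation_path.induct)
  case id
  then show ?case by simp
next
  case (rotate F d)
  then have d: "cox_word d" and inj: "inj_on F (cw_facets c)" and img: "F ` cw_facets c \<subseteq> cw_facets d"
    and sh: "\<forall>I\<in>cw_facets c. F (shift W S c I) = shift W S d (F I)"
    and sm: "\<forall>Z\<subseteq>cw_facets c. shift W S c ` Z = Z \<longrightarrow> (\<Sum>J\<in>Z. defect d (F J)) = (\<Sum>J\<in>Z. defect c J)"
    by blast+
  have "d \<noteq> []" using d rotate.prems by (auto simp: cox_word_def)
  then obtain a d' where ad: "d = a # d'" by (cases d) auto
  note props = rotate_first_props[OF d[unfolded ad], folded ad]
  have inj_R: "inj_on (rotate_first W S d) (cw_facets d)"
    using inj_on_image_subset[OF props(1) cw_facets_Pow[OF d]] unfolding inj_on_def rotate_first_image by simp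
  have "(\<Sum>J\<in>Z. defect (rotate1 d) (rotate_first W S d (F J))) = (\<Sum>J\<in>Z. defect c J)"
    if Z: "Z \<subseteq> cw_facets c" "shift W S c ` Z = Z" for Z
  proof -
    have "shift W S d ` (F ` Z) = (\<lambda>J. shift W S d (F J)) ` Z" by (rule image_image)
    also have "\<dots> = (\<lambda>J. F (shift W S c J)) ` Z" using sh Z(1) by (intro image_cong) auto
    also have "\<dots> = F ` (shift W S c ` Z)" by (rule image_image[symmetric])
    finally have inv: "shift W S d ` (F ` Z) = F ` Z" by (simp add: Z(2))
    have injX: "inj_on F Z" using inj Z(1) by (rule inj_on_subset)
    have "(\<Sum>J\<in>F ` Z. defect (rotate1 d) (rotate_first W S d J)) = (\<Sum>J\<in>F ` Z. defect d J)"
      using Z(1) img by (intro sum_defect_rotate_first[OF d \<open>d \<noteq> []\<close> _ inv]) auto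
    then show ?thesis using sm Z by (simp add: sum.reindex[OF injX])
  qed
  moreover have "inj_on (rotate_first W S d \<circ> F) (cw_facets c)"
    using inj inj_on_subset[OF inj_R img] by (rule comp_inj_on)
  moreover have "(rotate_first W S d \<circ> F) ` cw_facets c \<subseteq> cw_facets (rotate1 d)"
    using img props(4) by (auto simp: ad)
  moreover have "(rotate_first W S d \<circ> F) (shift W S c I) = shift W S (rotate1 d) ((rotate_first W S d \<circ> F) I)"
    if "I \<in> cw_facets c" for I
    using sh that by (simp add: shift_rotate_first)
  ultimately show ?case using cox_word_rotate1[OF d] unfolding comp_def by blast
next
  case (commute F d f e)
  then have d: "cox_word d" and inj: "inj_on F (cw_facets c)" and img: "F ` cw_facets c \<subseteq> cw_facets d"
    and sh: "\<forall>I\<in>cw_facets c. F (shift W S c I) = shift W S d (F I)"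
    and sm: "\<forall>Z\<subseteq>cw_facets c. shift W S c ` Z = Z \<longrightarrow> (\<Sum>J\<in>Z. defect d (F J)) = (\<Sum>J\<in>Z. defect c J)"
    by blast+
  note props = commute_iso_props[OF d commute.hyps(2)]
  have inj_R: "inj_on (commute_iso W S d e) (cw_facets d)"
    using inj_on_image_subset[OF props(2) cw_facets_Pow[OF d]] unfolding inj_on_def commute_iso_def by simp
  have "(\<Sum>J\<in>Z. defect e (commute_iso W S d e (F J))) = (\<Sum>J\<in>Z. defect c J)"
    if Z: "Z \<subseteq> cw_facets c" "shift W S c ` Z = Z" for Z
  proof -
    have "(\<Sum>J\<in>Z. defect e (commute_iso W S d e (F J))) = (\<Sum>J\<in>Z. defect d (F J))"
      using Z(1) img props(6) by (intro sum.cong) auto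
    then show ?thesis using sm Z by simp
  qed
  moreover have "inj_on (commute_iso W S d e \<circ> F) (cw_facets c)"
    using inj inj_on_subset[OF inj_R img] by (rule comp_inj_on)
  moreover have "(commute_iso W S d e \<circ> F) ` cw_facets c \<subseteq> cw_facets e"
    using img props(5) by auto
  moreover have "(commute_iso W S d e \<circ> F) (shift W S c I) = shift W S e ((commute_iso W S d e \<circ> F) I)"
    if I: "I \<in> cw_facets c" for I
  proof -
    have "F I \<subseteq> {..<cw_length}" using I img cw_facets_iff[OF d] by blast
    then show ?thesis using sh I shift_commute_iso[OF d commute.hyps(2)] by simp
  qed
  ultimately show ?case using props(1) unfolding comp_def by blast
qed

section \<open>Two orbits with opposite sums\<close>

lemma funpow_intertwine:
  assumes "\<And>x. x \<in> K \<Longrightarrow> F (f x) = g (F x)" "f ` K \<subseteq> K" "x \<in> K"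
  shows "F ((f ^^ k) x) = (g ^^ k) (F x)"
proof -
  have "(f ^^ k) x \<in> K" for k using assms(2,3) by (induction k) auto
  then show ?thesis by (induction k) (simp_all add: assms(1))
qed

lemma sum_defect_opposite_orbits:
  assumes c: "cox_word c" "c \<noteq> []" and path: "rotation_path W S c F (rev c)" and I: "I \<in> cw_facets c"
  defines "I' \<equiv> inv_into (cw_facets c) (psi2 W S c) (F I)"
  shows "I' \<in> cw_facets c" and
    "(\<Sum>J\<in>shift_orbit W S c I'. defect c J) = - (\<Sum>J\<in>shift_orbit W S c I. defect c J)"
proof -
  define K K' where "K = cw_facets c" and "K' = cw_facets (rev c)"
  define s s' where "s = shift W S c" and "s' = shift W S (rev c)"
  have c': "cox_word (rev c)" using c(1) by (rule cox_word_rev)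
  have finK: "finite K" "finite K'" unfolding K_def K'_def using finite_cw_facets c(1) c' by blast+
  have s: "inj_on s K" "s ` K \<subseteq> K" unfolding s_def K_def using shift_inj shift_facets c(1) by blast+
  have s': "inj_on s' K'" "s' ` K' \<subseteq> K'" unfolding s'_def K'_def using shift_inj shift_facets c' by blast+
  have IK: "I \<in> K" using I by (simp add: K_def)
  have F: "inj_on F K" "F ` K \<subseteq> K'" "\<And>J. J \<in> K \<Longrightarrow> F (s J) = s' (F J)"
    "\<And>Z. Z \<subseteq> K \<Longrightarrow> s ` Z = Z \<Longrightarrow> (\<Sum>J\<in>Z. defect (rev c) (F J)) = (\<Sum>J\<in>Z. defect c J)"
    using rotation_path_props[OF path c] unfolding K_def K'_def s_def s'_def by blast+
  define \<psi> where "\<psi> = psi2 W S c"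
  have inj_psi: "inj_on (psi2 W S d) (cw_facets d)" if "cox_word d" for d
    using inj_on_image_subset[OF psi2_props(1)[OF that] cw_facets_Pow[OF that]] unfolding inj_on_def psi2_image by simp
  have \<psi>: "inj_on \<psi> K" "\<psi> ` K \<subseteq> K'" unfolding \<psi>_def K_def K'_def using inj_psi psi2_props(4) c(1) by blast+
  \<comment> \<open>Surjectivity of \<psi> comes from counting: \<open>psi2\<close> of the reversed
    word is an injection in the other direction.\<close>
  have "card K' \<le> card K"
    using inj_psi[OF c'] psi2_props(4)[OF c'] finK unfolding K_def K'_def rev_rev_ident
    by (intro card_inj_on_le[of "psi2 W S (rev c)"]) auto
  moreover have "card K \<le> card K'" using card_mono[OF finK(2) \<psi>(2)] card_image[OF \<psi>(1)] by simp
  ultimately have \<psi>_surj: "\<psi> ` K = K'"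
    using card_image[OF \<psi>(1)] by (intro card_subset_eq[OF finK(2) \<psi>(2)]) simp
  have y: "F I \<in> \<psi> ` K" unfolding \<psi>_surj using F(2) IK by (rule subsetD[OF _ imageI])
  have "I' = inv_into K \<psi> (F I)" by (simp add: I'_def K_def \<psi>_def)
  then have I': "I' \<in> K" "\<psi> I' = F I" using inv_into_into[OF y] f_inv_into_f[OF y] by simp_all
  then show "I' \<in> cw_facets c" by (simp add: K_def)
  have OI: "orbit_of s I \<subseteq> K" "orbit_of s I' \<subseteq> K"
    using orbit_of_subset[OF s(2) IK] orbit_of_subset[OF s(2) I'(1)] by simp_all
  have F_orbit: "F ` orbit_of s I = orbit_of s' (F I)"
    unfolding orbit_of_def image_image using funpow_intertwine[of K F s s' I] F(3) s(2) IK by simp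
  \<comment> \<open>Iterating \<open>psi2_shift\<close>: k steps forward before \<psi> are undone by
    k steps forward after it.\<close>
  have undo: "(s' ^^ k) (\<psi> ((s ^^ k) J)) = \<psi> J" if "J \<in> K" for J k
    using that
  proof (induction k arbitrary: J)
    case (Suc k)
    have "s J \<in> K" using Suc.prems s(2) by blast
    then have "(s' ^^ k) (\<psi> ((s ^^ k) (s J))) = \<psi> (s J)" by (rule Suc.IH)
    moreover have "(s ^^ Suc k) J = (s ^^ k) (s J)" by (simp add: funpow_swap1)
    ultimately show ?case
      using psi2_shift[OF c(1), of J] Suc.prems by (simp add: s_def s'_def \<psi>_def K_def)
  qed simp
  have "\<psi> ` orbit_of s I' = orbit_of s' (F I)"
  proof
    show "\<psi> ` orbit_of s I' \<subseteq> orbit_of s' (F I)"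
    proof
      fix z assume "z \<in> \<psi> ` orbit_of s I'"
      then obtain k where k: "z = \<psi> ((s ^^ k) I')" by (auto simp: orbit_of_def)
      then have zK: "z \<in> K'" using OI(2) \<psi>(2) orbit_of_mem[of k s I'] by blast
      have "(s' ^^ k) z = F I" using undo[OF I'(1), of k] by (simp add: k I'(2))
      then have "F I \<in> orbit_of s' z" using orbit_of_mem by metis
      then have "orbit_of s' (F I) = orbit_of s' z" using orbit_of_eq[OF finK(2) s' zK] by blast
      then show "z \<in> orbit_of s' (F I)" using orbit_of_self by metis
    qed
    show "orbit_of s' (F I) \<subseteq> \<psi> ` orbit_of s I'"
    proof
      fix z assume "z \<in> orbit_of s' (F I)"
      then obtain k where k: "z = (s' ^^ k) (F I)" by (auto simp: orbit_of_def)
      \<comment> \<open>The element j steps after \<open>I'\<close> serves as the one k steps before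
        it; by \<open>undo\<close> its image lies k steps after
        \<open>\<psi> I' = F I\<close>.\<close>
      obtain j where j: "(s ^^ k) ((s ^^ j) I') = I'" using funpow_return(2)[OF finK(1) s I'(1)] by blast
      have mem: "(s ^^ j) I' \<in> orbit_of s I'" by (rule orbit_of_mem)
      then have "(s' ^^ k) (\<psi> ((s ^^ k) ((s ^^ j) I'))) = \<psi> ((s ^^ j) I')" using undo OI(2) by blast
      then have "z = \<psi> ((s ^^ j) I')" using j I'(2) k by simp
      then show "z \<in> \<psi> ` orbit_of s I'" using mem by blast
    qed
  qed
  then have orbits: "\<psi> ` orbit_of s I' = F ` orbit_of s I" using F_orbit by simp
  have "(\<Sum>J\<in>orbit_of s I'. defect c J) = - (\<Sum>J\<in>orbit_of s I'. defect (rev c) (\<psi> J))"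
    unfolding sum_negf[symmetric] using OI(2) psi2_props(5)[OF c(1)]
    by (intro sum.cong) (auto simp: \<psi>_def K_def)
  also have "(\<Sum>J\<in>orbit_of s I'. defect (rev c) (\<psi> J)) = (\<Sum>J\<in>F ` orbit_of s I. defect (rev c) J)"
    unfolding orbits[symmetric] using inj_on_subset[OF \<psi>(1) OI(2)] by (simp add: sum.reindex)
  also have "\<dots> = (\<Sum>J\<in>orbit_of s I. defect (rev c) (F J))"
    using inj_on_subset[OF F(1) OI(1)] by (simp add: sum.reindex)
  also have "\<dots> = (\<Sum>J\<in>orbit_of s I. defect c J)"
    using F(4)[OF OI(1)] orbit_of_image[OF finK(1) s IK] by blast
  finally show "(\<Sum>J\<in>shift_orbit W S c I'. defect c J) = - (\<Sum>J\<in>shift_orbit W S c I. defect c J)"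
    by (simp add: shift_orbit_eq s_def)
qed

lemma vectors_zero: "S = {} \<Longrightarrow> (v::'v) = 0"
  using inner_weight_eqI[of v 0] by simp

end

theorem theorem3p10:
  fixes W :: "('w, 'x) monoid_scheme"
    and S :: "'w set"
    and \<rho> :: "'w \<Rightarrow> 'v::real_inner \<Rightarrow> 'v"
    and \<alpha> :: "'w \<Rightarrow> 'v"
    and cox :: 'w
    and c :: "'w list"
    and I :: "nat set"
    and \<psi>\<^sub>1 :: "nat set \<Rightarrow> nat set"
  assumes "coxeter_system W S" and "finite (carrier W)"
    and "reflection_representation W S \<rho> \<alpha>"
    and "coxeter_element W S cox" and "reduced_expression W S c cox"
    and "I \<in> facets (subword_complex W S (cw_word W S c))"
    and "rotation_path W S c \<psi>\<^sub>1 (rev c)"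
  shows
    "let K = facets (subword_complex W S (cw_word W S c));
         \<O> = shift_orbit W S c I;
         \<O>' = shift_orbit W S c (inv_into K (psi2 W S c) (\<psi>\<^sub>1 I));
         f = (\<lambda>J. brick_vector W S \<rho> \<alpha> (cw_word W S c) J - Omega W S \<rho> \<alpha> c)
     in (\<O> = \<O>' \<longrightarrow> (\<Sum>J\<in>\<O>. f J) = 0) \<and>
        (\<O> \<noteq> \<O>' \<longrightarrow> \<O> \<inter> \<O>' = {} \<and> (\<Sum>J\<in>\<O> \<union> \<O>'. f J) = 0)"
proof -
  interpret finite_coxeter W S \<rho> \<alpha> using assms by unfold_locales
  have c: "cox_word c" using reduced_coxeter_word assms by blast
  define I' where "I' = inv_into (cw_facets c) (psi2 W S c) (\<psi>\<^sub>1 I)"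
  define Z Z' where "Z = shift_orbit W S c I" and "Z' = shift_orbit W S c I'"
  have f: "brick_vector W S \<rho> \<alpha> (cw_word W S c) J - Omega W S \<rho> \<alpha> c = defect c J" for J
    by (simp add: defect_def brick_vector_eq)
  have "(Z = Z' \<longrightarrow> (\<Sum>J\<in>Z. defect c J) = 0) \<and>
        (Z \<noteq> Z' \<longrightarrow> Z \<inter> Z' = {} \<and> (\<Sum>J\<in>Z \<union> Z'. defect c J) = 0)"
  \<comment> \<open>Without letters V is the zero space; the orbit argument needs a first letter to
    rotate.\<close>
  proof (cases "c = []")
    case True
    then have "S = {}" using c by (simp add: cox_word_def)
    then have zero: "v = 0" for v :: 'v by (rule vectors_zero)
    have "shift W S c = id" using True by (simp add: shift_def)
    then have "Z = {I}" "Z' = {I'}" by (auto simp: Z_def Z'_def shift_orbit_def)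
    then show ?thesis using zero by auto
  next
    case False
    note opp = sum_defect_opposite_orbits[OF c False assms(7,6), folded I'_def]
    have sub: "Z \<subseteq> cw_facets c" "Z' \<subseteq> cw_facets c"
      unfolding Z_def Z'_def shift_orbit_eq
      using orbit_of_subset[OF shift_facets[OF c] assms(6)] orbit_of_subset[OF shift_facets[OF c] opp(1)] by simp_all
    have sum: "(\<Sum>J\<in>Z'. defect c J) = - (\<Sum>J\<in>Z. defect c J)" using opp(2) by (simp add: Z_def Z'_def)
    have "Z \<inter> Z' = {}" if "Z \<noteq> Z'"
    proof (rule ccontr)
      assume "Z \<inter> Z' \<noteq> {}"
      then obtain J where "J \<in> Z" "J \<in> Z'" by blast
      then have "Z = Z'"
        unfolding Z_def Z'_def shift_orbit_eq
        using orbit_of_eq[OF finite_cw_facets[OF c] shift_inj[OF c] shift_facets[OF c]] assms(6) opp(1) by metis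
      with that show False by blast
    qed
    moreover have "(\<Sum>J\<in>Z. defect c J) = 0" if "Z = Z'"
    \<comment> \<open>For a single orbit the sum is its own negative, so all its coordinates
      vanish.\<close>
    proof (rule inner_weight_eqI)
      fix t
      have "(\<Sum>J\<in>Z. defect c J) \<bullet> \<omega> t = - ((\<Sum>J\<in>Z. defect c J) \<bullet> \<omega> t)"
        using sum that by (metis inner_minus_left)
      then show "(\<Sum>J\<in>Z. defect c J) \<bullet> \<omega> t = 0 \<bullet> \<omega> t" by simp
    qed
    moreover have "(\<Sum>J\<in>Z \<union> Z'. defect c J) = 0" if "Z \<inter> Z' = {}"
      using sum that finite_subset[OF sub(1) finite_cw_facets[OF c]] finite_subset[OF sub(2) finite_cw_facets[OF c]]
      by (simp add: sum.union_disjoint)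
    ultimately show ?thesis by blast
  qed
  then show ?thesis unfolding Let_def f I'_def[symmetric] Z_def[symmetric] Z'_def[symmetric] .
qed

end
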